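(* Let $\Lambda\subset\mathbb C$ be such that $\{K_\lambda\}_{\lambda\in\Lambda}$ is exact in $\mathcal{P}W_\pi$, with biorthogonal system $\{g_\lambda\}_{\lambda\in\Lambda}$, and let $\Lambda=\Lambda_1\cup\Lambda_2$ be a partition with $D_+(\Lambda_1)>0$, where $D_+(\Lambda_1)=\limsup_{r\to\infty}\frac{n_r(\Lambda_1)}{2r}$ and $n_r(\Lambda_1)=\operatorname{card}\{\lambda\in\Lambda_1:|\lambda|\le r\}$. Then the system $\{g_\lambda\}_{\lambda\in\Lambda_1}\cup\{K_\lambda\}_{\lambda\in\Lambda_2}$ is complete in $\mathcal{P}W_\pi$.
   Context: $\mathcal{P}W_\pi$ denotes the Paley–Wiener space: entire functions of exponential type at most $\pi$ whose restriction to $\mathbb R$ lies in $L^2(\mathbb R)$, with the $L^2(\mathbb R)$ inner product. Its reproducing kernel at $\lambda\in\mathbb C$ is $K_\lambda(z)=\frac{\sin\pi(z-\bar\lambda)}{\pi(z-\bar\lambda)}$. A system is exact if it is complete and minimal; an exact system has a unique biorthogonal system. If $\{K_\lambda\}_{\lambda\in\Lambda}$ is exact, there is an entire function $G$ of exponential type $\pi$ with simple zeros exactly at $\Lambda$ (generating function), and the biorthogonal system is $g_\lambda(z)=\frac{G(z)}{G'(\lambda)(z-\lambda)}$. *)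

theory Defs
  imports "HOL-Analysis.Analysis"
begin

definition exp_type_le_pi :: "(complex \<Rightarrow> complex) \<Rightarrow> bool" where
  "exp_type_le_pi f \<longleftrightarrow>
     (\<forall>e>0. \<exists>C. \<forall>z. cmod (f z) \<le> C * exp ((pi + e) * cmod z))"

definition PW :: "(complex \<Rightarrow> complex) set" where
  "PW = {f. f holomorphic_on UNIV \<and> exp_type_le_pi f \<and>
            integrable lborel (\<lambda>x::real. (cmod (f (complex_of_real x)))\<^sup>2)}"

definition pw_inner :: "(complex \<Rightarrow> complex) \<Rightarrow> (complex \<Rightarrow> complex) \<Rightarrow> complex" where
  "pw_inner f g = (LINT x|lborel. f (complex_of_real x) * cnj (g (complex_of_real x)))"

definition pw_norm :: "(complex \<Rightarrow> complex) \<Rightarrow> real" where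
  "pw_norm f = sqrt (LINT x|lborel. (cmod (f (complex_of_real x)))\<^sup>2)"

definition pw_kernel :: "complex \<Rightarrow> complex \<Rightarrow> complex" where
  "pw_kernel l z = (if z = cnj l then 1
                    else sin (of_real pi * (z - cnj l)) / (of_real pi * (z - cnj l)))"

definition lin_comb :: "('i \<Rightarrow> complex \<Rightarrow> complex) \<Rightarrow> 'i set \<Rightarrow> (complex \<Rightarrow> complex) set" where
  "lin_comb F I = {h. \<exists>J c. finite J \<and> J \<subseteq> I \<and> h = (\<lambda>z. \<Sum>j\<in>J. c j * F j z)}"

definition complete_PW :: "('i \<Rightarrow> complex \<Rightarrow> complex) \<Rightarrow> 'i set \<Rightarrow> bool" where
  "complete_PW F I \<longleftrightarrow>
     (\<forall>f\<in>PW. \<forall>e>0. \<exists>h\<in>lin_comb F I. pw_norm (\<lambda>z. f z - h z) < e)"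

definition minimal_PW :: "('i \<Rightarrow> complex \<Rightarrow> complex) \<Rightarrow> 'i set \<Rightarrow> bool" where
  "minimal_PW F I \<longleftrightarrow>
     (\<forall>i\<in>I. \<exists>e>0. \<forall>h\<in>lin_comb F (I - {i}). pw_norm (\<lambda>z. F i z - h z) \<ge> e)"

definition exact_PW :: "('i \<Rightarrow> complex \<Rightarrow> complex) \<Rightarrow> 'i set \<Rightarrow> bool" where
  "exact_PW F I \<longleftrightarrow> complete_PW F I \<and> minimal_PW F I"

definition upper_density :: "complex set \<Rightarrow> ereal" where
  "upper_density L =
     Limsup at_top (\<lambda>r::real. ereal (real (card {l\<in>L. cmod l \<le> r}) / (2 * r)))"

end

theory Submission
  imports Defs "HOL-Complex_Analysis.Complex_Analysis" "HOL-Probability.Sinc_Integral" "HOL-Real_Asymp.Real_Asymp"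
begin

text \<open>Suppose the mixed system is incomplete. Then there is a nonzero \<open>f \<in> PW\<close> that vanishes on \<open>\<Lambda>2\<close> and is
orthogonal to \<open>g\<^sub>l\<close> for \<open>l \<in> \<Lambda>1\<close>. Fix \<open>l\<^sub>0 \<in> \<Lambda>1\<close> and put \<open>G = g l\<^sub>0\<close>, whose zeros are exactly the points of
\<open>\<Lambda> - {l\<^sub>0}\<close>, all simple. With the Cauchy transforms \<open>A\<close> of \<open>G * cnj f\<close> and \<open>\<beta>\<close> of \<open>|f|\<^sup>2\<close>, the function
\<open>f * A - G * \<beta>\<close> extends to an entire function of exponential type at most \<open>\<pi>\<close> that vanishes on \<open>\<Lambda> - {l\<^sub>0}\<close>, so that
\<open>f * A = G * (P + \<beta>)\<close> off the real line with an affine polynomial \<open>P\<close>.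

Since \<open>G / f = A / (P + \<beta>)\<close> grows at most polynomially away from the real line, Jensen's formula bounds the zeros
of \<open>G\<close> by those of \<open>f\<close>. The zeros on \<open>\<Lambda>2\<close> cancel, and every other zero \<open>t\<close> of \<open>f\<close> is
a zero of (the boundary values of) \<open>P + \<beta>\<close>. If \<open>P \<noteq> 0\<close> there are finitely many such \<open>t\<close>, because \<open>\<beta>\<close> tends to \<open>0\<close> at infinity. If \<open>P = 0\<close> they are
real and the functions \<open>f / (z - t)\<close> are pairwise orthogonal, which forces them to have zero density. In either case
\<open>\<Lambda>1\<close> has zero density.\<close>

subsection \<open>Functions of exponential type bounded on the real line\<close>

text \<open>\<open>A\<close> and \<open>\<beta>\<close> are paired because at a zero
  \<open>l\<close> of \<open>G\<close> the entire extension takes the value \<open>f l\<close> times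
  the inner product of \<open>G / (z - l)\<close> with \<open>f\<close>: on
  \<open>\<Lambda>2\<close> the first factor vanishes, on \<open>\<Lambda>1\<close> the second.
  Taking \<open>g l0\<close> instead of the generating function keeps everything in
  \<open>PW\<close>, where completeness of the kernels is a uniqueness theorem; interpolation at one
  or two nodes then replaces the explicit formula for \<open>g\<close>.

  The obstacle is the real line, where the Cauchy transforms are controlled only up to powers of
  \<open>1 / |Im w|\<close>. On circles centred at real points this blow-up is absorbed by a
  quadratic vanishing at the two real points; at real zeros of \<open>f\<close> the identity is read
  along a vertical segment. When \<open>P\<close> is zero, orthogonality makes the points
  \<open>t\<close> separated and the squared norms of \<open>f / (z - t)\<close> small in total far
  out. Cauchy-Schwarz bounds the number of such \<open>t\<close> in \<open>[-R, R]\<close> by a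
  constant times \<open>R\<close> times the root of that total, which is o(R).\<close>

lemma le_of_le_mult_exp:
  fixes x M T :: real
  assumes "\<And>d. d > 0 \<Longrightarrow> x \<le> M * exp (d * T)"
  shows "x \<le> M"
proof (rule tendsto_lowerbound)
  show "((\<lambda>d. M * exp (d * T)) \<longlongrightarrow> M) (at_right 0)"
    by (auto intro!: tendsto_eq_intros)
  show "\<forall>\<^sub>F d in at_right 0. x \<le> M * exp (d * T)"
    using assms by (auto simp: eventually_at_right_field intro: exI[of _ 1])
qed auto

text \<open>A number within angle \<open>pi/4\<close> of the positive axis has its root within
  \<open>pi/8\<close> and the cube of the root within \<open>3 pi/8\<close>, so the power 3/2 keeps
  a positive real part of full order. The rational constants stand in for these angles:
  \<open>|b| <= a/2\<close> is slightly weaker than the slope \<open>tan (pi/8)\<close>.\<close>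

lemma csqrt_near_axis:
  assumes "\<bar>Im w\<bar> \<le> Re w" "Re w > 0"
  defines "a \<equiv> Re (csqrt w)"
  shows "a > 0" "cmod w \<le> 5/4 * a^2" "a^3 / 4 \<le> Re ((csqrt w)^3)"
proof -
  define b where "b = Im (csqrt w)"
  have w: "w = (csqrt w)^2" by simp
  have cs: "csqrt w = Complex a b" by (simp add: a_def b_def del: csqrt.sel)
  have re: "Re w = a^2 - b^2"
    using arg_cong[OF w, of Re] unfolding cs by (simp add: power2_eq_square)
  have im: "Im w = 2*a*b"
    using arg_cong[OF w, of Im] unfolding cs by (simp add: power2_eq_square)
  have a0: "a \<ge> 0" using csqrt_principal[of w] by (auto simp: a_def simp del: csqrt.sel)
  show a: "a > 0" using a0 re assms(2) by (cases "a = 0") auto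
  have "\<bar>b\<bar> \<le> a/2"
  proof (rule ccontr)
    assume "\<not> \<bar>b\<bar> \<le> a/2"
    then have b: "\<bar>b\<bar> > a/2" by simp
    have "2*a*\<bar>b\<bar> \<le> a^2 - b^2" using assms(1) a unfolding re im by (simp add: abs_mult)
    moreover have "2*a*\<bar>b\<bar> > a^2" using mult_strict_left_mono[OF b a] by (simp add: power2_eq_square)
    ultimately show False by (smt (verit) zero_le_power2)
  qed
  then have b2: "b^2 \<le> a^2/4" using power_mono[of "\<bar>b\<bar>" "a/2" 2] by (simp add: power_divide)
  have "cmod w = (cmod (csqrt w))^2" by (metis w norm_power)
  also have "\<dots> = a^2 + b^2" unfolding cs by (simp add: cmod_power2)
  finally show "cmod w \<le> 5/4 * a^2" using b2 by simp
  have "Re ((csqrt w)^3) = a^3 - 3*a*b^2" unfolding cs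
    by (simp add: power3_eq_cube power2_eq_square algebra_simps)
  moreover have "3*a*b^2 \<le> 3*a*(a^2/4)" using b2 a by (intro mult_left_mono) auto
  ultimately show "a^3 / 4 \<le> Re ((csqrt w)^3)" by (simp add: power3_eq_cube power2_eq_square)
qed

text \<open>The comparison function is \<open>exp (- d w^(3/2))\<close> with
  \<open>w = 1 + (1 - \<i>) z\<close>: order 3/2 lies above the order 1 of \<open>f\<close> and
  below the critical order 2 of a quadrant. The factor \<open>1 - \<i>\<close> turns the quadrant
  into the sector about the positive axis, and the summand 1 keeps the branch point of the root
  outside.\<close>

lemma phragmen_lindelof_quadrant:
  fixes f :: "complex \<Rightarrow> complex"
  assumes hol: "f holomorphic_on UNIV"
    and growth: "\<And>z. cmod (f z) \<le> C * exp (B * cmod z)"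
    and re: "\<And>x. x \<ge> 0 \<Longrightarrow> cmod (f (of_real x)) \<le> M"
    and im: "\<And>y. y \<ge> 0 \<Longrightarrow> cmod (f (\<i> * of_real y)) \<le> M"
    and M: "M > 0" and z: "Re z \<ge> 0" "Im z \<ge> 0"
  shows "cmod (f z) \<le> M"
proof -
  define s where "s = (\<lambda>z. csqrt (1 + (1 - \<i>) * z))"
  have C: "C \<ge> 0" using growth[of 0] norm_ge_zero[of "f 0"] by (simp del: norm_ge_zero)
  have s: "Re (s u) > 0" "cmod u \<le> 5/4 * (Re (s u))^2" "(Re (s u))^3 / 4 \<le> Re ((s u)^3)"
    if "Re u \<ge> 0" "Im u \<ge> 0" for u
  proof -
    let ?w = "1 + (1 - \<i>) * u"
    have c: "Re ?w = 1 + Re u + Im u" "Im ?w = Im u - Re u" by (auto simp: algebra_simps)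
    have "\<bar>Im ?w\<bar> \<le> Re ?w" "Re ?w > 0" using that unfolding c by auto
    note k = csqrt_near_axis[OF this]
    have "(cmod u)^2 \<le> (cmod ?w)^2" unfolding cmod_power2 c using that
      by (simp add: power2_eq_square algebra_simps)
    then have "cmod u \<le> cmod ?w" using power2_le_imp_le by (metis norm_ge_zero)
    then show "cmod u \<le> 5/4 * (Re (s u))^2" using k(2) unfolding s_def by linarith
    show "Re (s u) > 0" "(Re (s u))^3 / 4 \<le> Re ((s u)^3)" using k(1,3) unfolding s_def by auto
  qed
  have main: "cmod (f z) \<le> M * exp (d * Re ((s z)^3))" if d: "d > 0" for d
  proof -
    define h where "h = (\<lambda>z. f z * exp (- of_real d * (s z)^3))"
    \<comment> \<open>The last two entries serve the arc: the fourth makes the damping beat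
      \<open>exp (B R)\<close> with \<open>exp (- R)\<close> to spare, and the third lets this spare
      factor bring \<open>C\<close> down to \<open>M\<close>.\<close>
    define R where "R = Max {cmod z, 1, C / M, 5/4 * (5 * (\<bar>B\<bar> + 1) / d)^2}"
    have R: "cmod z \<le> R" "1 \<le> R" "C / M \<le> R" "5/4 * (5 * (\<bar>B\<bar> + 1) / d)^2 \<le> R"
      unfolding R_def by (rule Max_ge; simp)+
    define S where "S = {u. 0 \<le> Re u} \<inter> {u. 0 \<le> Im u} \<inter> cball 0 R"
    have clS: "closed S" unfolding S_def
      by (intro closed_Int closed_halfspace_Re_ge closed_halfspace_Im_ge closed_cball)
    have hh: "h holomorphic_on {u. Re (1 + (1 - \<i>) * u) > 0}"
      unfolding h_def s_def
      by (intro holomorphic_intros holomorphic_on_subset[OF hol])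
         (auto simp: complex_nonpos_Reals_iff)
    have sub: "S \<subseteq> {u. Re (1 + (1 - \<i>) * u) > 0}" unfolding S_def by (auto simp: algebra_simps)
    have nh: "cmod (h u) = cmod (f u) * exp (- d * Re ((s u)^3))" for u
      unfolding h_def by (simp add: norm_mult)
    have nh': "cmod (h u) \<le> cmod (f u)" if "Re u \<ge> 0" "Im u \<ge> 0" for u
    proof -
      have "Re ((s u)^3) \<ge> 0" using s(1,3)[OF that] by (smt (verit) divide_nonneg_nonneg zero_le_power)
      then have "exp (- d * Re ((s u)^3)) \<le> 1" using d by simp
      then show ?thesis unfolding nh by (metis mult_left_le norm_ge_zero mult.commute)
    qed
    have fr: "cmod (h u) \<le> M" if u: "u \<in> frontier S" for u
    proof -
      have uS: "u \<in> S" using u clS frontier_subset_closed by blast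
      then have u0: "Re u \<ge> 0" "Im u \<ge> 0" "cmod u \<le> R" unfolding S_def by auto
      consider "Re u = 0" | "Im u = 0" | "cmod u = R" | "Re u > 0" "Im u > 0" "cmod u < R"
        using u0 by linarith
      then show ?thesis
      proof cases
        case 1
        then have "u = \<i> * of_real (Im u)" by (simp add: complex_eq_iff)
        then show ?thesis using im[of "Im u"] nh'[of u] u0 by (metis order_trans)
      next
        case 2
        then have "u = of_real (Re u)" by (simp add: complex_eq_iff)
        then show ?thesis using re[of "Re u"] nh'[of u] u0 by (metis order_trans)
      next
        case 3
        define a where "a = Re (s u)"
        note k = s[OF u0(1,2), folded a_def]
        have a1: "5 * (\<bar>B\<bar> + 1) / d \<le> a"
        proof (rule power2_le_imp_le)
          show "(5 * (\<bar>B\<bar> + 1) / d)^2 \<le> a^2" using k(2) 3 R(4) by simp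
        qed (use k in auto)
        have "B * R + R \<le> (\<bar>B\<bar> + 1) * R" using R(2) by (simp add: algebra_simps abs_if)
        also have "\<dots> \<le> d * a / 5 * R"
          using a1 d R(2) by (intro mult_right_mono) (auto simp: field_simps)
        also have "\<dots> \<le> d * a / 5 * (5/4 * a^2)"
          using k(1,2) d 3 by (intro mult_left_mono) auto
        also have "\<dots> = d * (a^3/4)" by (simp add: power3_eq_cube power2_eq_square)
        also have "\<dots> \<le> d * Re ((s u)^3)" using k(3) d by (intro mult_left_mono) auto
        finally have e: "B * R - d * Re ((s u)^3) \<le> - R" by simp
        have "cmod (h u) \<le> C * exp (B * cmod u) * exp (- d * Re ((s u)^3))"
          unfolding nh by (intro mult_right_mono growth) auto
        also have "\<dots> = C * exp (B * R - d * Re ((s u)^3))" using 3 by (simp add: exp_diff exp_minus field_simps)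
        also have "\<dots> \<le> C * exp (- R)" using e C by (intro mult_left_mono) auto
        also have "\<dots> \<le> M"
        proof -
          have "C \<le> M * R" using R(3) M by (simp add: field_simps)
          also have "\<dots> \<le> M * exp R" using M exp_ge_add_one_self[of R] by (intro mult_left_mono) linarith+
          finally show ?thesis by (simp add: exp_minus field_simps)
        qed
        finally show ?thesis .
      next
        case 4
        have op: "open ({u. 0 < Re u} \<inter> {u. 0 < Im u} \<inter> ball 0 R)"
          by (intro open_Int open_halfspace_Re_gt open_halfspace_Im_gt open_ball)
        have "{u. 0 < Re u} \<inter> {u. 0 < Im u} \<inter> ball 0 R \<subseteq> S" unfolding S_def by auto
        from interior_maximal[OF this op] have "u \<in> interior S" using 4 by auto
        then show ?thesis using u by (simp add: frontier_def)
      qed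
    qed
    have "cmod (h z) \<le> M"
    proof (rule maximum_modulus_frontier[of h S M z])
      show "h holomorphic_on interior S" using hh sub interior_subset by (meson holomorphic_on_subset)
      show "continuous_on (closure S) h"
        using hh sub clS by (simp add: closure_closed) (meson holomorphic_on_imp_continuous_on holomorphic_on_subset)
      show "bounded S" unfolding S_def by (simp add: bounded_Int)
      show "z \<in> S" using z R unfolding S_def by auto
    qed (use fr in auto)
    then show ?thesis unfolding nh by (simp add: exp_minus field_simps)
  qed
  show ?thesis by (rule le_of_le_mult_exp[OF main])
qed

text \<open>Once some bound \<open>K\<close> is known, division by \<open>1 - \<i> d z\<close>,
  whose modulus in the half-plane is at least 1 and at least \<open>d |z|\<close>, makes the far arc
  harmless. Letting \<open>d\<close> tend to 0 replaces \<open>K\<close> by the bound on the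
  axis.\<close>

lemma phragmen_lindelof_bounded:
  fixes f :: "complex \<Rightarrow> complex"
  assumes hol: "f holomorphic_on UNIV"
    and bdd: "\<And>z. Im z \<ge> 0 \<Longrightarrow> cmod (f z) \<le> K"
    and re: "\<And>x. cmod (f (of_real x)) \<le> M"
    and M: "M > 0" and z: "Im z \<ge> 0"
  shows "cmod (f z) \<le> M"
proof -
  have K: "K \<ge> 0" using bdd[of 0] norm_ge_zero[of "f 0"] by (simp del: norm_ge_zero)
  have main: "cmod (f z) \<le> M * cmod (1 - \<i> * of_real d * z)" if d: "d > 0" for d
  proof -
    define h where "h = (\<lambda>z. f z / (1 - \<i> * of_real d * z))"
    define R where "R = Max {cmod z, 1, K / (M * d)}"
    have R: "cmod z \<le> R" "1 \<le> R" "K / (M * d) \<le> R" unfolding R_def by (auto intro: Max_ge)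
    define S where "S = {u. 0 \<le> Im u} \<inter> cball 0 R"
    have clS: "closed S" unfolding S_def by (intro closed_Int closed_halfspace_Im_ge closed_cball)
    have n2: "(cmod (1 - \<i> * of_real d * u))^2 = (1 + d * Im u)^2 + (d * Re u)^2" for u
      unfolding cmod_power2 by simp
    have n1: "cmod (1 - \<i> * of_real d * u) \<ge> 1" if "Im u \<ge> 0" for u
    proof (rule power2_le_imp_le)
      have "1 \<le> (1 + d * Im u)^2" using that d by simp
      then show "1^2 \<le> (cmod (1 - \<i> * of_real d * u))^2" unfolding n2 by (simp add: add_increasing2)
    qed auto
    have n3: "cmod (1 - \<i> * of_real d * u) \<ge> d * cmod u" if "Im u \<ge> 0" for u
    proof (rule power2_le_imp_le)
      have "(d * cmod u)^2 = d^2 * (Re u)^2 + d^2 * (Im u)^2"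
        by (simp add: power_mult_distrib cmod_power2 algebra_simps)
      also have "\<dots> \<le> (1 + d * Im u)^2 + (d * Re u)^2" using that d
        by (simp add: power2_eq_square algebra_simps)
      finally show "(d * cmod u)^2 \<le> (cmod (1 - \<i> * of_real d * u))^2" unfolding n2 .
    qed auto
    have hh: "h holomorphic_on S"
      unfolding h_def
    proof (intro holomorphic_intros holomorphic_on_subset[OF hol])
      fix u assume "u \<in> S"
      then show "1 - \<i> * of_real d * u \<noteq> 0" using n1[of u] unfolding S_def by auto
    qed auto
    have fr: "cmod (h u) \<le> M" if u: "u \<in> frontier S" for u
    proof -
      have uS: "u \<in> S" using u clS frontier_subset_closed by blast
      then have u0: "Im u \<ge> 0" "cmod u \<le> R" unfolding S_def by auto
      consider "Im u = 0" | "cmod u = R" | "Im u > 0" "cmod u < R"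
        using u0 by linarith
      then show ?thesis
      proof cases
        case 1
        then have "u = of_real (Re u)" by (simp add: complex_eq_iff)
        then have "cmod (f u) \<le> M" using re by metis
        moreover have "cmod (h u) \<le> cmod (f u)" using n1[OF u0(1)] frac_le[of "cmod (f u)" "cmod (f u)" 1]
          unfolding h_def norm_divide by simp
        ultimately show ?thesis by simp
      next
        case 2
        have p: "d * R > 0" using d R by simp
        have "cmod (h u) \<le> K / (d * R)"
          unfolding h_def norm_divide using n3[OF u0(1)] bdd[OF u0(1)] 2 p K
          by (intro frac_le) auto
        also have "\<dots> \<le> M" using R(3) M d p by (simp add: field_simps)
        finally show ?thesis .
      next
        case 3
        have op: "open ({u. 0 < Im u} \<inter> ball 0 R)"
          by (intro open_Int open_halfspace_Im_gt open_ball)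
        have "{u. 0 < Im u} \<inter> ball 0 R \<subseteq> S" unfolding S_def by auto
        from interior_maximal[OF this op] have "u \<in> interior S" using 3 by auto
        then show ?thesis using u by (simp add: frontier_def)
      qed
    qed
    have "cmod (h z) \<le> M"
    proof (rule maximum_modulus_frontier[of h S M z])
      show "h holomorphic_on interior S" using hh interior_subset by (meson holomorphic_on_subset)
      show "continuous_on (closure S) h"
        using hh clS by (simp add: closure_closed holomorphic_on_imp_continuous_on)
      show "bounded S" unfolding S_def by (simp add: bounded_Int)
      show "z \<in> S" using z R unfolding S_def by auto
    qed (use fr in auto)
    moreover have "cmod (1 - \<i> * of_real d * z) > 0" using n1[OF z] by linarith
    ultimately show ?thesis unfolding h_def norm_divide by (simp add: divide_le_eq)
  qed
  show ?thesis
  proof (rule tendsto_lowerbound)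
    show "((\<lambda>d. M * cmod (1 - \<i> * of_real d * z)) \<longlongrightarrow> M) (at_right 0)"
      by (auto intro!: tendsto_eq_intros)
    show "\<forall>\<^sub>F d in at_right 0. cmod (f z) \<le> M * cmod (1 - \<i> * of_real d * z)"
      using main by (auto simp: eventually_at_right_field intro: exI[of _ 1])
  qed auto
qed

lemma exp_type_reflect:
  assumes "exp_type_le_pi f" shows "exp_type_le_pi (\<lambda>z. f (- z))"
  using assms unfolding exp_type_le_pi_def by (metis norm_minus_cancel)

text \<open>The factor \<open>exp (\<i> (pi + e) z)\<close> makes \<open>f\<close> bounded on the
  imaginary half-axis, so each of the two quadrants has the boundary bound \<open>max M C\<close>.
  As \<open>C\<close> depends on \<open>e\<close>, that bound is of no use in the limit; a second
  pass with the bounded form restores \<open>M\<close> before \<open>e\<close> tends to 0.\<close>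

lemma exp_type_bounded_upper:
  fixes f :: "complex \<Rightarrow> complex"
  assumes hol: "f holomorphic_on UNIV" and ty: "exp_type_le_pi f"
    and re: "\<And>x. cmod (f (of_real x)) \<le> M" and M: "M > 0" and z: "Im z \<ge> 0"
  shows "cmod (f z) \<le> M * exp (pi * Im z)"
proof -
  have main: "cmod (f z) \<le> (M * exp (pi * Im z)) * exp (e * Im z)" if e: "e > 0" for e
  proof -
    obtain C where C: "\<And>z. cmod (f z) \<le> C * exp ((pi + e) * cmod z)"
      using ty e unfolding exp_type_le_pi_def by blast
    define k where "k = (\<lambda>z. f z * exp (\<i> * of_real (pi + e) * z))"
    have holk: "k holomorphic_on UNIV" unfolding k_def by (intro holomorphic_intros hol)
    have nk: "cmod (k z) = cmod (f z) * exp (- (pi + e) * Im z)" for z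
      unfolding k_def by (simp add: norm_mult algebra_simps)
    have grk: "cmod (k z) \<le> C * exp (2 * (pi + e) * cmod z)" for z
    proof -
      have "- (pi + e) * Im z \<le> (pi + e) * cmod z"
        using abs_Im_le_cmod[of z] e pi_gt_zero by (smt (verit) mult_minus_left mult_left_mono mult_minus_right)
      then have "cmod (k z) \<le> (C * exp ((pi + e) * cmod z)) * exp ((pi + e) * cmod z)"
        unfolding nk using order_trans[OF norm_ge_zero C] by (intro mult_mono C) auto
      also have "\<dots> = C * exp (2 * (pi + e) * cmod z)" by (simp add: mult_exp_exp[symmetric] mult.assoc) (simp add: mult_exp_exp algebra_simps)
      finally show ?thesis .
    qed
    have rek: "cmod (k (of_real x)) \<le> max M C" for x
      unfolding nk using re[of x] by simp
    have imk: "cmod (k (\<i> * of_real y)) \<le> max M C" if "y \<ge> 0" for y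
    proof -
      have "cmod (k (\<i> * of_real y)) \<le> C * exp ((pi + e) * y) * exp (- (pi + e) * y)"
        unfolding nk using C[of "\<i> * of_real y"] that by (simp add: norm_mult)
      also have "\<dots> = C" by (simp add: exp_minus field_simps mult_exp_exp)
      finally show ?thesis by simp
    qed
    have Q1: "cmod (k z) \<le> max M C" if "Re z \<ge> 0" "Im z \<ge> 0" for z
      using that M by (intro phragmen_lindelof_quadrant[OF holk grk rek imk]) auto
    \<comment> \<open>A quarter turn: \<open>k2\<close> on the first quadrant is \<open>k\<close> on
      the second.\<close>
    define k2 where "k2 = (\<lambda>z. k (\<i> * z))"
    have holk2: "k2 holomorphic_on UNIV" unfolding k2_def
      using holomorphic_on_compose[of "\<lambda>z. \<i> * z" UNIV k] holomorphic_on_subset[OF holk]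
      by (auto simp: o_def intro!: holomorphic_intros)
    have Q2: "cmod (k z) \<le> max M C" if "Re z \<le> 0" "Im z \<ge> 0" for z
    proof -
      have "cmod (k2 (- \<i> * z)) \<le> max M C"
      proof (rule phragmen_lindelof_quadrant[OF holk2])
        show "cmod (k2 z) \<le> C * exp (2 * (pi + e) * cmod z)" for z
          using grk[of "\<i> * z"] unfolding k2_def by (simp add: norm_mult)
        show "cmod (k2 (of_real x)) \<le> max M C" if "x \<ge> 0" for x
          using imk[OF that] unfolding k2_def .
        show "cmod (k2 (\<i> * of_real y)) \<le> max M C" for y
          using rek[of "- y"] unfolding k2_def by (simp add: mult.assoc[symmetric])
      qed (use M that in auto)
      then show ?thesis unfolding k2_def by simp
    qed
    have "cmod (k z) \<le> M"
    proof (rule phragmen_lindelof_bounded[OF holk _ _ M z])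
      show "cmod (k z) \<le> max M C" if "Im z \<ge> 0" for z
        using Q1[of z] Q2[of z] that by linarith
      show "cmod (k (of_real x)) \<le> M" for x unfolding nk using re[of x] by simp
    qed
    then show ?thesis unfolding nk by (simp add: exp_diff exp_minus exp_add field_simps)
  qed
  show ?thesis by (rule le_of_le_mult_exp[OF main])
qed

lemma exp_type_bounded:
  fixes f :: "complex \<Rightarrow> complex"
  assumes hol: "f holomorphic_on UNIV" and ty: "exp_type_le_pi f"
    and re: "\<And>x. cmod (f (of_real x)) \<le> M" and M: "M > 0"
  shows "cmod (f z) \<le> M * exp (pi * \<bar>Im z\<bar>)"
proof (cases "Im z \<ge> 0")
  case True
  then show ?thesis using exp_type_bounded_upper[OF hol ty re M] by auto
next
  case False
  have h: "(\<lambda>z. f (- z)) holomorphic_on UNIV"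
    using holomorphic_on_compose[of uminus UNIV f] holomorphic_on_subset[OF hol] holomorphic_on_minus[of "\<lambda>z. z"]
    by (auto simp: o_def)
  have "cmod (f (- of_real x)) \<le> M" for x using re[of "-x"] by simp
  from exp_type_bounded_upper[OF h exp_type_reflect[OF ty] this M, of "-z"] False
  show ?thesis by auto
qed

lemma entire_divide:
  fixes f :: "complex \<Rightarrow> complex"
  assumes "f holomorphic_on UNIV" "f w = 0"
  obtains h where "h holomorphic_on UNIV" "\<And>z. f z = (z - w) * h z"
proof -
  define h where "h = (\<lambda>z. if z = w then deriv f w else f z / (z - w))"
  have "h holomorphic_on UNIV"
    by (rule pole_theorem_0[OF assms(1), of w]) (auto simp: h_def assms)
  moreover have "f z = (z - w) * h z" for z using assms by (auto simp: h_def)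
  ultimately show ?thesis using that by blast
qed

lemma exp_type_divide:
  assumes ty: "exp_type_le_pi f" and h: "h holomorphic_on UNIV" and eq: "\<And>z. f z = (z - w) * h z"
  shows "exp_type_le_pi h"
  unfolding exp_type_le_pi_def
proof (intro allI impI)
  fix e :: real assume "e > 0"
  then obtain C where C: "\<And>z. cmod (f z) \<le> C * exp ((pi + e) * cmod z)"
    using ty unfolding exp_type_le_pi_def by blast
  have "compact (h ` cball w 1)"
    by (intro compact_continuous_image holomorphic_on_imp_continuous_on holomorphic_on_subset[OF h]) auto
  then obtain B where B: "\<And>z. z \<in> cball w 1 \<Longrightarrow> cmod (h z) \<le> B"
    by (metis bounded_iff compact_imp_bounded imageI)
  have "cmod (h z) \<le> max B C * exp ((pi + e) * cmod z)" for z
  proof (cases "z \<in> cball w 1")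
    case True
    have "max B C * 1 \<le> max B C * exp ((pi + e) * cmod z)"
      using order_trans[OF norm_ge_zero B[OF True]] \<open>e > 0\<close>
      by (intro mult_left_mono) (auto simp: max_def)
    then show ?thesis using B[OF True] by linarith
  next
    case False
    then have "1 \<le> cmod (z - w)" by (simp add: dist_norm norm_minus_commute)
    then have "cmod (h z) \<le> cmod (f z)" unfolding eq norm_mult
      by (metis mult_le_cancel_right1 norm_ge_zero not_le)
    also have "\<dots> \<le> C * exp ((pi + e) * cmod z)" by (rule C)
    also have "\<dots> \<le> max B C * exp ((pi + e) * cmod z)" by (intro mult_right_mono) auto
    finally show ?thesis .
  qed
  then show "\<exists>C. \<forall>z. cmod (h z) \<le> C * exp ((pi + e) * cmod z)" by blast
qed

subsection \<open>Square integrability and growth on the real line\<close>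

definition square_integrable :: "(real \<Rightarrow> complex) \<Rightarrow> bool" where
  "square_integrable u \<longleftrightarrow> u \<in> borel_measurable borel \<and> integrable lborel (\<lambda>x. (cmod (u x))\<^sup>2)"

lemma square_integrable_measurable[measurable_dest]:
  "square_integrable u \<Longrightarrow> u \<in> borel_measurable borel"
  by (simp add: square_integrable_def)

lemma square_integrableD: "square_integrable u \<Longrightarrow> integrable lborel (\<lambda>x. (cmod (u x))\<^sup>2)"
  by (simp add: square_integrable_def)

lemma square_integrable_bound:
  assumes v: "square_integrable v" and u: "u \<in> borel_measurable borel"
    and le: "\<And>x. cmod (u x) \<le> B * cmod (v x)"
  shows "square_integrable u"
  unfolding square_integrable_def
proof
  show "integrable lborel (\<lambda>x. (cmod (u x))\<^sup>2)"
  proof (rule Bochner_Integration.integrable_bound)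
    show "integrable lborel (\<lambda>x. B\<^sup>2 * (cmod (v x))\<^sup>2)"
      using square_integrableD[OF v] by simp
    show "(\<lambda>x. (cmod (u x))\<^sup>2) \<in> borel_measurable lborel" using u by measurable
    have "(cmod (u x))\<^sup>2 \<le> B\<^sup>2 * (cmod (v x))\<^sup>2" for x
      using power_mono[OF le, of x 2] by (simp add: power_mult_distrib)
    then show "AE x in lborel. norm ((cmod (u x))\<^sup>2) \<le> norm (B\<^sup>2 * (cmod (v x))\<^sup>2)"
      by simp
  qed
qed fact

lemma square_integrable_cnj: "square_integrable u \<Longrightarrow> square_integrable (\<lambda>x. cnj (u x))"
  by (rule square_integrable_bound[of u _ 1]) (auto simp: square_integrable_def intro!: borel_measurable_continuous_on[OF continuous_on_cnj])

lemma square_integrable_cmult: "square_integrable u \<Longrightarrow> square_integrable (\<lambda>x. c * u x)"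
  by (rule square_integrable_bound[of u _ "cmod c"]) (auto simp: square_integrable_def norm_mult)

lemma square_integrable_add:
  assumes u: "square_integrable u" and v: "square_integrable v"
  shows "square_integrable (\<lambda>x. u x + v x)"
  unfolding square_integrable_def
proof
  note [measurable] = square_integrable_measurable[OF u] square_integrable_measurable[OF v]
  show "(\<lambda>x. u x + v x) \<in> borel_measurable borel" by measurable
  show "integrable lborel (\<lambda>x. (cmod (u x + v x))\<^sup>2)"
  proof (rule Bochner_Integration.integrable_bound)
    show "integrable lborel (\<lambda>x. 2 * (cmod (u x))\<^sup>2 + 2 * (cmod (v x))\<^sup>2)"
      using square_integrableD[OF v] square_integrableD[OF u] by simp
    have "(cmod (u x + v x))\<^sup>2 \<le> 2 * (cmod (u x))\<^sup>2 + 2 * (cmod (v x))\<^sup>2" for x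
    proof -
      have "(cmod (u x + v x))\<^sup>2 \<le> (cmod (u x) + cmod (v x))\<^sup>2"
        by (intro power_mono norm_triangle_ineq) auto
      also have "\<dots> \<le> 2 * (cmod (u x))\<^sup>2 + 2 * (cmod (v x))\<^sup>2"
        using sum_squares_bound[of "cmod (u x)" "cmod (v x)"] by (simp add: power2_sum)
      finally show ?thesis .
    qed
    then show "AE x in lborel. norm ((cmod (u x + v x))\<^sup>2) \<le> norm (2 * (cmod (u x))\<^sup>2 + 2 * (cmod (v x))\<^sup>2)"
      by simp
  qed measurable
qed

lemma square_integrable_mult:
  assumes u: "square_integrable u" and v: "square_integrable v"
  shows "integrable lborel (\<lambda>x. u x * v x)"
proof (rule Bochner_Integration.integrable_bound)
  note [measurable] = square_integrable_measurable[OF u] square_integrable_measurable[OF v]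
  show "integrable lborel (\<lambda>x. (cmod (u x))\<^sup>2 + (cmod (v x))\<^sup>2)"
    using square_integrableD[OF v] square_integrableD[OF u] by simp
  show "(\<lambda>x. u x * v x) \<in> borel_measurable lborel" by measurable
  have "cmod (u x) * cmod (v x) \<le> (cmod (u x))\<^sup>2 + (cmod (v x))\<^sup>2" for x
    using sum_squares_bound[of "cmod (u x)" "cmod (v x)"] mult_nonneg_nonneg[OF norm_ge_zero[of "u x"] norm_ge_zero[of "v x"]]
    by linarith
  then show "AE x in lborel. norm (u x * v x) \<le> norm ((cmod (u x))\<^sup>2 + (cmod (v x))\<^sup>2)"
    by (auto simp: norm_mult)
qed

lemma square_integrable_Cauchy_Schwarz:
  assumes u: "square_integrable u" and v: "square_integrable v"
  shows "(LINT x|lborel. cmod (u x) * cmod (v x))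
          \<le> sqrt (LINT x|lborel. (cmod (u x))\<^sup>2) * sqrt (LINT x|lborel. (cmod (v x))\<^sup>2)"
proof -
  define A B I where "A = (LINT x|lborel. (cmod (u x))\<^sup>2)" and "B = (LINT x|lborel. (cmod (v x))\<^sup>2)"
    and "I = (LINT x|lborel. cmod (u x) * cmod (v x))"
  have iI: "integrable lborel (\<lambda>x. cmod (u x) * cmod (v x))"
    using integrable_norm[OF square_integrable_mult[OF u v]] by (simp add: norm_mult)
  have A0: "A \<ge> 0" unfolding A_def by (intro integral_nonneg_AE) auto
  have B0: "B \<ge> 0" unfolding B_def by (intro integral_nonneg_AE) auto
  have I0: "I \<ge> 0" unfolding I_def by (intro integral_nonneg_AE) auto
  \<comment> \<open>The quadratic in \<open>s\<close> is nonnegative everywhere. Its minimum at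
    \<open>s = I / A\<close> gives the inequality, and for \<open>A = 0\<close> a large
    \<open>s\<close> rules out \<open>I > 0\<close>.\<close>
  have q: "0 \<le> A * s\<^sup>2 - 2 * I * s + B" for s
  proof -
    have "0 \<le> (LINT x|lborel. (s * cmod (u x) - cmod (v x))\<^sup>2)" by (intro integral_nonneg_AE) auto
    also have "\<dots> = (LINT x|lborel. s\<^sup>2 * (cmod (u x))\<^sup>2 - (2 * s) * (cmod (u x) * cmod (v x)) + (cmod (v x))\<^sup>2)"
      by (intro Bochner_Integration.integral_cong) (auto simp: power2_diff power_mult_distrib)
    also have "\<dots> = s\<^sup>2 * A - (2 * s) * I + B"
      unfolding A_def B_def I_def
      using iI square_integrableD[OF v] square_integrableD[OF u] by simp
    finally show ?thesis by (simp add: algebra_simps)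
  qed
  have "I\<^sup>2 \<le> A * B"
  proof (cases "A = 0")
    case True
    have "I = 0"
    proof (rule ccontr)
      assume "I \<noteq> 0"
      then have "I > 0" using I0 by simp
      then show False using q[of "(B + 1) / (2 * I)"] True by simp
    qed
    then show ?thesis using True by simp
  next
    case False
    then have "A > 0" using A0 by simp
    then show ?thesis using q[of "I / A"] by (simp add: power2_eq_square field_simps)
  qed
  then have "I \<le> sqrt (A * B)" using real_le_rsqrt by blast
  then show ?thesis unfolding A_def B_def I_def by (simp add: real_sqrt_mult)
qed

lemma square_integrable_Cauchy_Schwarz_norm:
  assumes u: "square_integrable u" and v: "square_integrable v"
  shows "cmod (LINT x|lborel. u x * v x)
          \<le> sqrt (LINT x|lborel. (cmod (u x))\<^sup>2) * sqrt (LINT x|lborel. (cmod (v x))\<^sup>2)"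
proof -
  have "cmod (LINT x|lborel. u x * v x) \<le> (LINT x|lborel. cmod (u x * v x))" by (rule integral_norm_bound)
  also have "\<dots> = (LINT x|lborel. cmod (u x) * cmod (v x))" by (simp add: norm_mult)
  finally show ?thesis using square_integrable_Cauchy_Schwarz[OF u v] by simp
qed

lemma integrable_inverse_one_plus_square: "integrable lborel (\<lambda>x::real. 1 / (1 + x\<^sup>2))"
  using integrable_inverse_1_plus_square by (simp add: set_integrable_def field_simps)

lemma square_integrable_by_decay:
  assumes u: "u \<in> borel_measurable borel" and le: "\<And>x. cmod (u x) \<le> B / sqrt (1 + x\<^sup>2)"
  shows "square_integrable u" "(LINT x|lborel. (cmod (u x))\<^sup>2) \<le> B\<^sup>2 * (LINT x|lborel. 1 / (1 + (x::real)\<^sup>2))"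
proof -
  have b: "(cmod (u x))\<^sup>2 \<le> B\<^sup>2 * (1 / (1 + x\<^sup>2))" for x
    using power_mono[OF le, of x 2] by (simp add: power_divide add_nonneg_nonneg)
  have i: "integrable lborel (\<lambda>x. (cmod (u x))\<^sup>2)"
  proof (rule Bochner_Integration.integrable_bound)
    show "integrable lborel (\<lambda>x. B\<^sup>2 * (1 / (1 + (x::real)\<^sup>2)))"
      by (intro integrable_mult_right integrable_inverse_one_plus_square)
    show "(\<lambda>x. (cmod (u x))\<^sup>2) \<in> borel_measurable lborel" using u by measurable
    show "AE x in lborel. norm ((cmod (u x))\<^sup>2) \<le> norm (B\<^sup>2 * (1 / (1 + x\<^sup>2)))"
      using b by auto
  qed
  then show "square_integrable u" using u by (simp add: square_integrable_def)
  have "(LINT x|lborel. (cmod (u x))\<^sup>2) \<le> (LINT x|lborel. B\<^sup>2 * (1 / (1 + (x::real)\<^sup>2)))"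
    using i b by (intro integral_mono integrable_mult_right integrable_inverse_one_plus_square) auto
  also have "\<dots> = B\<^sup>2 * (LINT x|lborel. 1 / (1 + (x::real)\<^sup>2))" by (rule integral_mult_right_zero)
  finally show "(LINT x|lborel. (cmod (u x))\<^sup>2) \<le> B\<^sup>2 * (LINT x|lborel. 1 / (1 + (x::real)\<^sup>2))" .
qed

lemma of_real_minus_nonreal: "Im w \<noteq> 0 \<Longrightarrow> complex_of_real x - w \<noteq> 0"
  by (auto simp: complex_eq_iff)

lemma sqrt_le_dist:
  assumes "Im w \<noteq> 0"
  obtains B where "B > 0" "\<And>x. sqrt (1 + x\<^sup>2) \<le> B * cmod (of_real x - w)"
proof -
  \<comment> \<open>The 2 comes from squaring \<open>|x| <= |x - w| + |w|\<close>; the remaining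
    constant is absorbed by \<open>(Im w)^2 <= |x - w|^2\<close>.\<close>
  define B2 where "B2 = 2 + (2 * (cmod w)\<^sup>2 + 1) / (Im w)\<^sup>2"
  have B2: "B2 > 0" unfolding B2_def by (intro add_pos_nonneg divide_nonneg_nonneg) auto
  have "sqrt (1 + x\<^sup>2) \<le> sqrt B2 * cmod (of_real x - w)" for x
  proof -
    let ?d = "cmod (of_real x - w)"
    have v: "(Im w)\<^sup>2 \<le> ?d\<^sup>2" unfolding cmod_power2 by simp
    have "\<bar>x\<bar> \<le> ?d + cmod w" using norm_triangle_ineq[of "of_real x - w" w] by simp
    then have "x\<^sup>2 \<le> (?d + cmod w)\<^sup>2" using power_mono[of "\<bar>x\<bar>" _ 2] by simp
    also have "\<dots> \<le> 2 * ?d\<^sup>2 + 2 * (cmod w)\<^sup>2"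
      using sum_squares_bound[of ?d "cmod w"] by (simp add: power2_sum)
    finally have "1 + x\<^sup>2 \<le> 2 * ?d\<^sup>2 + (2 * (cmod w)\<^sup>2 + 1) * 1" by simp
    also have "\<dots> \<le> 2 * ?d\<^sup>2 + (2 * (cmod w)\<^sup>2 + 1) * (?d\<^sup>2 / (Im w)\<^sup>2)"
      using v assms by (intro add_left_mono mult_left_mono) auto
    also have "\<dots> = B2 * ?d\<^sup>2" unfolding B2_def by (simp add: algebra_simps)
    finally have "sqrt (1 + x\<^sup>2) \<le> sqrt (B2 * ?d\<^sup>2)" by (rule real_sqrt_le_mono)
    then show ?thesis by (simp add: real_sqrt_mult)
  qed
  then show ?thesis using that[of "sqrt B2"] B2 by auto
qed

lemma square_integrable_Cauchy_kernel:
  assumes "Im w \<noteq> 0"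
  shows "square_integrable (\<lambda>x. 1 / (of_real x - w))"
proof -
  obtain B where B: "B > 0" "\<And>x. sqrt (1 + x\<^sup>2) \<le> B * cmod (of_real x - w)"
    using sqrt_le_dist[OF assms] by blast
  show ?thesis
  proof (rule square_integrable_by_decay(1)[where B = B])
    show "(\<lambda>x. 1 / (complex_of_real x - w)) \<in> borel_measurable borel" by measurable
    fix x :: real
    have "1 + x\<^sup>2 > 0" by (simp add: add_pos_nonneg)
    then show "cmod (1 / (of_real x - w)) \<le> B / sqrt (1 + x\<^sup>2)"
      using B(2)[of x] of_real_minus_nonreal[OF assms, of x] by (simp add: norm_divide field_simps)
  qed
qed

lemma square_integrable_Cauchy:
  assumes "square_integrable u" "Im w \<noteq> 0"
  shows "integrable lborel (\<lambda>x. u x / (of_real x - w))"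
  using square_integrable_mult[OF assms(1) square_integrable_Cauchy_kernel[OF assms(2)]] by simp

section \<open>Paley-Wiener functions on the real line\<close>

lemma entire_measurable[measurable_dest]:
  "f holomorphic_on UNIV \<Longrightarrow> (\<lambda>x. f (complex_of_real x)) \<in> borel_measurable borel"
  by (intro borel_measurable_continuous_onI continuous_on_compose2[OF holomorphic_on_imp_continuous_on, of f UNIV])
     (auto intro!: continuous_intros)

lemma PW_entire: "f \<in> PW \<Longrightarrow> f holomorphic_on UNIV" by (simp add: PW_def)

lemma PW_square_integrable: "f \<in> PW \<Longrightarrow> square_integrable (\<lambda>x. f (of_real x))"
  using entire_measurable[of f] by (simp add: PW_def square_integrable_def)

lemma PW_iff: "f \<in> PW \<longleftrightarrow> f holomorphic_on UNIV \<and> exp_type_le_pi f \<and> square_integrable (\<lambda>x. f (of_real x))"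
  using entire_measurable[of f] by (auto simp: PW_def square_integrable_def)

text \<open>Boundedness of \<open>f\<close> on the line is not yet known, so its increments are
  treated first. For a primitive \<open>F\<close>, the function \<open>F (z + 1) - F z\<close> is
  bounded on the line, being the integral of \<open>f\<close> over a unit interval; its exponential
  type then bounds it in strips, and a Cauchy estimate bounds its derivative
  \<open>f (z + 1) - f z\<close>.\<close>

lemma PW_difference_bound:
  assumes f: "f \<in> PW"
  obtains K where "K \<ge> 0" "\<And>x. cmod (f (of_real (x + 1)) - f (of_real x)) \<le> K"
proof -
  define N where "N = (LINT x|lborel. (cmod (f (of_real x)))\<^sup>2)"
  have N: "N \<ge> 0" unfolding N_def by (intro integral_nonneg_AE) auto
  have hol: "f holomorphic_on UNIV" using f by (rule PW_entire)
  have cont: "continuous_on A (\<lambda>x. f (complex_of_real x))" for A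
    by (rule continuous_on_compose2[OF holomorphic_on_imp_continuous_on[OF hol]]) (auto intro!: continuous_intros)
  obtain F where F: "\<And>z. (F has_field_derivative f z) (at z)"
    using holomorphic_convex_primitive'[OF convex_UNIV open_UNIV hol] by auto
  define H where "H = (\<lambda>z. F (z + 1) - F z)"
  have dH: "(H has_field_derivative (f (z + 1) - f z)) (at z)" for z
    unfolding H_def using DERIV_shift[of F "f (z + 1)" z 1] F by (intro derivative_intros) auto
  have hH: "H holomorphic_on UNIV" using dH by (meson field_differentiable_at_within field_differentiable_def holomorphic_on_def)
  have tH: "exp_type_le_pi H" unfolding exp_type_le_pi_def
  proof (intro allI impI)
    fix e :: real assume "e > 0"
    then obtain C where C: "\<And>z. cmod (f z) \<le> C * exp ((pi + e) * cmod z)"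
      using f unfolding PW_def exp_type_le_pi_def by blast
    have C0: "C \<ge> 0" using order_trans[OF norm_ge_zero C[of 0]] by simp
    have "cmod (H z) \<le> (C * exp (pi + e)) * exp ((pi + e) * cmod z)" for z
    proof -
      have "cmod (F (z + 1) - F z) \<le> (C * exp (pi + e) * exp ((pi + e) * cmod z)) * cmod (z + 1 - z)"
      proof (rule field_differentiable_bound[where S = "cball z 1" and f' = f])
        fix u assume u: "u \<in> cball z 1"
        have "cmod u \<le> cmod z + 1" using u norm_triangle_ineq2[of u z] by (simp add: dist_norm norm_minus_commute)
        then have "(pi + e) * cmod u \<le> (pi + e) * (cmod z + 1)"
          using \<open>e > 0\<close> pi_gt_zero by (intro mult_left_mono) auto
        then have "C * exp ((pi + e) * cmod u) \<le> C * exp ((pi + e) * (cmod z + 1))"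
          using C0 by (intro mult_left_mono) auto
        then have "cmod (f u) \<le> C * exp ((pi + e) * (cmod z + 1))" using C[of u] by linarith
        also have "\<dots> = C * exp (pi + e) * exp ((pi + e) * cmod z)"
          by (simp add: mult.assoc exp_add[symmetric] algebra_simps)
        finally show "cmod (f u) \<le> C * exp (pi + e) * exp ((pi + e) * cmod z)" .
      qed (use F in \<open>auto simp: dist_norm intro: has_field_derivative_at_within\<close>)
      then show ?thesis unfolding H_def by simp
    qed
    then show "\<exists>C. \<forall>z. cmod (H z) \<le> C * exp ((pi + e) * cmod z)" by blast
  qed
  have re: "cmod (H (of_real x)) \<le> 1 + N" for x
  proof -
    have "((\<lambda>t. f (of_real t)) has_integral (F (of_real (x + 1)) - F (of_real x))) {x..x+1}"
    proof (rule fundamental_theorem_of_calculus)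
      fix t assume "t \<in> {x..x+1}"
      show "((\<lambda>t. F (of_real t)) has_vector_derivative f (of_real t)) (at t within {x..x+1})"
        using has_vector_derivative_real_field[OF F[of "of_real t"], of "{x..x+1}"] by (simp add: o_def)
    qed auto
    then have H: "H (of_real x) = integral {x..x+1} (\<lambda>t. f (of_real t))"
      unfolding H_def by (simp add: integral_unique)
    have i2: "(\<lambda>t. (cmod (f (of_real t)))\<^sup>2) integrable_on {x..x+1}"
      by (intro integrable_continuous_real continuous_intros cont)
    have "cmod (H (of_real x)) \<le> integral {x..x+1} (\<lambda>t. 1 + (cmod (f (of_real t)))\<^sup>2)"
      unfolding H
    proof (rule Henstock_Kurzweil_Integration.integral_norm_bound_integral)
      show "cmod (f (of_real t)) \<le> 1 + (cmod (f (of_real t)))\<^sup>2" for t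
        using sum_squares_bound[of 1 "cmod (f (of_real t))"] norm_ge_zero[of "f (of_real t)"] by (simp del: norm_ge_zero)
    qed (intro integrable_continuous_real continuous_intros cont)+
    also have "\<dots> = 1 + integral {x..x+1} (\<lambda>t. (cmod (f (of_real t)))\<^sup>2)"
      using i2 by (subst Henstock_Kurzweil_Integration.integral_add) auto
    also have "integral {x..x+1} (\<lambda>t. (cmod (f (of_real t)))\<^sup>2) \<le> integral UNIV (\<lambda>t. (cmod (f (of_real t)))\<^sup>2)"
      using has_integral_integral_lborel[OF square_integrableD[OF PW_square_integrable[OF f]]]
      by (intro integral_subset_le i2) (auto simp: integrable_on_def)
    also have "\<dots> = N" unfolding N_def
      using has_integral_integral_lborel[OF square_integrableD[OF PW_square_integrable[OF f]]] by (rule integral_unique)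
    finally show ?thesis by simp
  qed
  have bH: "cmod (H z) \<le> (1 + N) * exp (pi * \<bar>Im z\<bar>)" for z
    using N by (intro exp_type_bounded[OF hH tH re]) auto
  have "cmod (f (of_real (x + 1)) - f (of_real x)) \<le> (1 + N) * exp pi" for x
  proof -
    have "cmod ((deriv ^^ 1) H (of_real x)) \<le> fact 1 * ((1 + N) * exp pi) / 1 ^ 1"
    proof (rule Cauchy_inequality)
      fix z assume z: "cmod (of_real x - z) = 1"
      have "\<bar>Im z\<bar> \<le> 1" using abs_Im_le_cmod[of "of_real x - z"] z by simp
      then have "(1 + N) * exp (pi * \<bar>Im z\<bar>) \<le> (1 + N) * exp pi" using N by (intro mult_left_mono) auto
      then show "cmod (H z) \<le> (1 + N) * exp pi" using bH[of z] by linarith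
    qed (auto intro!: holomorphic_on_imp_continuous_on holomorphic_on_subset[OF hH])
    then show ?thesis using DERIV_imp_deriv[OF dH[of "of_real x"]] by simp
  qed
  then show ?thesis using that[of "(1 + N) * exp pi"] N by simp
qed

text \<open>Bounded increments give linear growth on the line, so \<open>(f z - f 0) / z\<close> is
  bounded there and obeys the sharp bound for exponential type. This provisional estimate suffices
  for the reproducing formula, which in turn removes the factor \<open>1 + |z|\<close>.\<close>

lemma PW_linear_growth:
  assumes f: "f \<in> PW"
  obtains K where "K > 0" "\<And>z. cmod (f z) \<le> K * (1 + cmod z) * exp (pi * \<bar>Im z\<bar>)"
proof -
  have hol: "f holomorphic_on UNIV" using f by (rule PW_entire)
  obtain K where K: "K \<ge> 0" "\<And>x. cmod (f (of_real (x + 1)) - f (of_real x)) \<le> K"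
    using PW_difference_bound[OF f] by blast
  have "compact (f ` cball 0 1)"
    by (intro compact_continuous_image holomorphic_on_imp_continuous_on holomorphic_on_subset[OF hol]) auto
  then obtain K0 where K0: "\<And>z. z \<in> cball 0 1 \<Longrightarrow> cmod (f z) \<le> K0"
    by (metis bounded_iff compact_imp_bounded imageI)
  have K00: "K0 \<ge> 0" using order_trans[OF norm_ge_zero K0[of 0]] by simp
  have up: "cmod (f (of_real (x + real n))) \<le> K0 + real n * K" if "\<bar>x\<bar> \<le> 1" for x n
  proof (induction n)
    case 0
    then show ?case using K0[of "of_real x"] that by simp
  next
    case (Suc n)
    have "cmod (f (of_real (x + real (Suc n)))) \<le> cmod (f (of_real (x + real n))) + K"
      using K(2)[of "x + real n"] norm_triangle_ineq2[of "f (of_real (x + real n + 1))" "f (of_real (x + real n))"]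
      by (simp add: add_ac)
    then show ?case using Suc by (simp add: algebra_simps)
  qed
  have dn: "cmod (f (of_real (x - real n))) \<le> K0 + real n * K" if "\<bar>x\<bar> \<le> 1" for x n
  proof (induction n)
    case 0
    then show ?case using K0[of "of_real x"] that by simp
  next
    case (Suc n)
    have "cmod (f (of_real (x - real (Suc n)))) \<le> cmod (f (of_real (x - real n))) + K"
      using K(2)[of "x - real (Suc n)"] norm_triangle_ineq2[of "f (of_real (x - real (Suc n)))" "f (of_real (x - real n))"]
      by (simp add: norm_minus_commute algebra_simps)
    then show ?case using Suc by (simp add: algebra_simps)
  qed
  have lin: "cmod (f (of_real x)) \<le> K0 + \<bar>x\<bar> * K" for x
  proof -
    define n where "n = nat \<lfloor>\<bar>x\<bar>\<rfloor>"
    have n: "real n \<le> \<bar>x\<bar>" "\<bar>x\<bar> < real n + 1" unfolding n_def by linarith+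
    have "cmod (f (of_real x)) \<le> K0 + real n * K"
    proof (cases "x \<ge> 0")
      case True
      then show ?thesis using up[of "x - real n" n] n by simp
    next
      case False
      then show ?thesis using dn[of "x + real n" n] n by simp
    qed
    also have "\<dots> \<le> K0 + \<bar>x\<bar> * K" using n K(1) by (intro add_left_mono mult_right_mono) auto
    finally show ?thesis .
  qed
  obtain h where h: "h holomorphic_on UNIV" "\<And>z. f z - f 0 = (z - 0) * h z"
  proof (rule entire_divide[of "\<lambda>z. f z - f 0" 0])
    show "(\<lambda>z. f z - f 0) holomorphic_on UNIV" using hol by (intro holomorphic_intros)
  qed auto
  have ty: "exp_type_le_pi (\<lambda>z. f z - f 0)" unfolding exp_type_le_pi_def
  proof (intro allI impI)
    fix e :: real assume e: "e > 0"
    then obtain C where C: "\<And>z. cmod (f z) \<le> C * exp ((pi + e) * cmod z)"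
      using f unfolding PW_def exp_type_le_pi_def by blast
    have "cmod (f z - f 0) \<le> (C + cmod (f 0)) * exp ((pi + e) * cmod z)" for z
    proof -
      have "1 \<le> exp ((pi + e) * cmod z)" using e by simp
      then have "cmod (f 0) \<le> cmod (f 0) * exp ((pi + e) * cmod z)"
        by (metis mult_left_mono mult.right_neutral norm_ge_zero)
      then show ?thesis using C[of z] norm_triangle_ineq4[of "f z" "f 0"] by (simp add: algebra_simps)
    qed
    then show "\<exists>C. \<forall>z. cmod (f z - f 0) \<le> C * exp ((pi + e) * cmod z)" by blast
  qed
  have "compact (h ` cball 0 1)"
    by (intro compact_continuous_image holomorphic_on_imp_continuous_on holomorphic_on_subset[OF h(1)]) auto
  then obtain B where B: "\<And>z. z \<in> cball 0 1 \<Longrightarrow> cmod (h z) \<le> B"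
    by (metis bounded_iff compact_imp_bounded imageI)
  have B0: "B \<ge> 0" using order_trans[OF norm_ge_zero B[of 0]] by simp
  define M where "M = 1 + B + 2 * K0 + K"
  have re: "cmod (h (of_real x)) \<le> M" for x
  proof (cases "\<bar>x\<bar> \<le> 1")
    case True
    then show ?thesis using B[of "of_real x"] K(1) K00 unfolding M_def by simp
  next
    case False
    then have x: "\<bar>x\<bar> > 1" by simp
    have "\<bar>x\<bar> * cmod (h (of_real x)) = cmod (f (of_real x) - f 0)" using h(2)[of "of_real x"] by (simp add: norm_mult)
    also have "\<dots> \<le> K0 + \<bar>x\<bar> * K + K0" using norm_triangle_ineq4[of "f (of_real x)" "f 0"] lin[of x] K0[of 0] by simp
    also have "\<dots> \<le> \<bar>x\<bar> * (2 * K0 + K)" using mult_right_mono[of 1 "\<bar>x\<bar>" "2*K0"] x K00 by (simp add: algebra_simps)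
    also have "\<dots> \<le> \<bar>x\<bar> * M" unfolding M_def using B0 by (intro mult_left_mono) auto
    finally show ?thesis using x by (simp add: mult_le_cancel_left)
  qed
  have M: "M > 0" unfolding M_def using B0 K(1) K00 by simp
  have hb: "cmod (h z) \<le> M * exp (pi * \<bar>Im z\<bar>)" for z
    by (rule exp_type_bounded[OF h(1) exp_type_divide[OF ty h] re M])
  have "cmod (f z) \<le> (M + K0) * (1 + cmod z) * exp (pi * \<bar>Im z\<bar>)" for z
  proof -
    have e1: "1 \<le> exp (pi * \<bar>Im z\<bar>)" by simp
    have "cmod (f z) \<le> cmod (f 0) + cmod z * cmod (h z)"
      using h(2)[of z] norm_triangle_ineq[of "f 0" "z * h z"] by (simp add: norm_mult algebra_simps)
    also have "\<dots> \<le> K0 * exp (pi * \<bar>Im z\<bar>) + cmod z * (M * exp (pi * \<bar>Im z\<bar>))"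
      using K0[of 0] hb[of z] mult_left_mono[OF e1 K00] by (intro add_mono mult_left_mono) auto
    also have "\<dots> \<le> (M + K0) * (1 + cmod z) * exp (pi * \<bar>Im z\<bar>)"
      using M K00 by (simp add: algebra_simps)
    finally show ?thesis .
  qed
  then show ?thesis using that[of "M + K0"] M K00 by simp
qed

subsection \<open>The reproducing formula\<close>

definition csinc :: "complex \<Rightarrow> complex" where
  "csinc z = (if z = 0 then 1 else sin z / z)"

lemma csinc_0 [simp]: "csinc 0 = 1" by (simp add: csinc_def)

lemma mult_csinc: "z * csinc z = sin z" by (simp add: csinc_def)

lemma csinc_entire: "csinc holomorphic_on UNIV"
proof (rule pole_theorem_0[of sin UNIV 0])
  show "csinc 0 = deriv sin 0" using DERIV_imp_deriv[OF DERIV_sin, of "0::complex"] by simp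
qed (auto simp: mult_csinc intro!: holomorphic_intros)

lemma cnj_csinc: "cnj (csinc z) = csinc (cnj z)"
  by (simp add: csinc_def cnj_sin)

lemma entire_compose:
  "f holomorphic_on UNIV \<Longrightarrow> g holomorphic_on UNIV \<Longrightarrow> (\<lambda>z. f (g z)) holomorphic_on UNIV"
  using holomorphic_on_compose_gen[of g UNIV f UNIV] by (simp add: o_def)

lemma cmod_sin_le: "cmod (sin z) \<le> exp \<bar>Im z\<bar>"
proof -
  have "cmod (exp (\<i> * z) - exp (- (\<i> * z))) \<le> exp (- Im z) + exp (Im z)"
    using norm_triangle_ineq4[of "exp (\<i> * z)" "exp (- (\<i> * z))"] by simp
  also have "\<dots> \<le> exp \<bar>Im z\<bar> + exp \<bar>Im z\<bar>" by (intro add_mono) auto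
  finally show ?thesis unfolding sin_exp_eq by (simp add: norm_divide norm_mult)
qed

lemma csinc_bound:
  obtains C where "C > 0" "\<And>z. cmod (csinc z) \<le> C * exp \<bar>Im z\<bar> / (1 + cmod z)"
proof -
  have "compact (csinc ` cball 0 1)"
    by (intro compact_continuous_image holomorphic_on_imp_continuous_on holomorphic_on_subset[OF csinc_entire]) auto
  then obtain B where B: "\<And>z. z \<in> cball 0 1 \<Longrightarrow> cmod (csinc z) \<le> B"
    by (metis bounded_iff compact_imp_bounded imageI)
  have B0: "B \<ge> 1" using B[of 0] by simp
  have "cmod (csinc z) \<le> (2 * B) * exp \<bar>Im z\<bar> / (1 + cmod z)" for z
  proof -
    have "cmod (csinc z) * (1 + cmod z) \<le> 2 * B * exp \<bar>Im z\<bar>"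
    proof (cases "cmod z \<le> 1")
      case True
      have "cmod (csinc z) * (1 + cmod z) \<le> B * 2" using B[of z] True B0 by (intro mult_mono) auto
      also have "\<dots> \<le> 2 * B * exp \<bar>Im z\<bar>" using B0 by simp
      finally show ?thesis .
    next
      case False
      then have "cmod (csinc z) * (1 + cmod z) \<le> cmod (csinc z) * (2 * cmod z)" by (intro mult_left_mono) auto
      also have "\<dots> = 2 * cmod (sin z)" unfolding mult_csinc[symmetric] norm_mult by simp
      also have "\<dots> \<le> 2 * exp \<bar>Im z\<bar>" using cmod_sin_le by simp
      also have "\<dots> \<le> 2 * B * exp \<bar>Im z\<bar>" using B0 by simp
      finally show ?thesis .
    qed
    then show ?thesis by (simp add: pos_le_divide_eq add_pos_nonneg)
  qed
  then show ?thesis using that[of "2 * B"] B0 by simp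
qed

lemma csinc_real_le_1: "cmod (csinc (of_real x)) \<le> 1"
proof -
  have "\<bar>sin x\<bar> \<le> \<bar>x\<bar>" by (rule abs_sin_x_le_abs_x)
  moreover have "cmod (sin (complex_of_real x)) = \<bar>sin x\<bar>" by (metis norm_of_real sin_of_real)
  ultimately show ?thesis by (auto simp: csinc_def norm_divide)
qed

text \<open>The rectangle has its base on the real line. On the other three sides
  \<open>k z / (z - w)\<close> is of order \<open>1 / n^2\<close> against a length of order
  \<open>n\<close>, so only the residue at \<open>w\<close> survives, and \<open>w\<close> is
  enclosed precisely when \<open>Im w > 0\<close>.\<close>

lemma Cauchy_upper_halfplane:
  assumes hol: "k holomorphic_on UNIV" and K: "\<And>z. Im z \<ge> 0 \<Longrightarrow> cmod (k z) \<le> K / (1 + cmod z)"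
    and w: "Im w \<noteq> 0"
  shows "(LINT x|lborel. k (of_real x) / (of_real x - w)) = (if Im w > 0 then 2 * of_real pi * \<i> * k w else 0)"
proof -
  define c where "c = (if Im w > 0 then 2 * of_real pi * \<i> * k w else 0)"
  define h where "h = (\<lambda>z. k z / (z - w))"
  have K0: "K \<ge> 0" using order_trans[OF norm_ge_zero K[of 0]] by simp
  have sk: "square_integrable (\<lambda>x. k (of_real x))"
  proof (rule square_integrable_by_decay(1)[where B = K])
    show "(\<lambda>x. k (complex_of_real x)) \<in> borel_measurable borel" using entire_measurable[OF hol] .
    fix x :: real
    have "sqrt (1 + x\<^sup>2) \<le> 1 + \<bar>x\<bar>" by (rule real_le_lsqrt) (auto simp: power2_sum)
    then have "K / (1 + \<bar>x\<bar>) \<le> K / sqrt (1 + x\<^sup>2)" using K0 by (intro divide_left_mono) (auto simp: add_pos_nonneg)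
    then show "cmod (k (of_real x)) \<le> K / sqrt (1 + x\<^sup>2)" using K[of "of_real x"] by simp
  qed
  have ih: "integrable lborel (\<lambda>x. h (of_real x))"
    using square_integrable_Cauchy[OF sk w] unfolding h_def .
  define N where "N = Suc (nat \<lceil>cmod w\<rceil>)"
  have N: "real n > cmod w" if "n \<ge> N" for n
  proof -
    have "real N > cmod w" unfolding N_def by linarith
    then show ?thesis using that by (meson less_le_trans of_nat_le_iff)
  qed
  have rect: "cmod ((LINT x:{-real n..real n}|lborel. h (of_real x)) - c) \<le> 4 * K / (real n - cmod w)"
    if n: "n \<ge> N" for n
  proof -
    define r where "r = real n"
    have r: "r > cmod w" "r > 0" unfolding r_def using N[OF n] order_le_less_trans[OF norm_ge_zero N[OF n]] by auto
    define a1 a2 a3 a4 where "a1 = complex_of_real (-r)" and "a2 = complex_of_real r"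
      and "a3 = Complex r r" and "a4 = Complex (-r) r"
    have a: "a2 = Complex (Re a3) (Im a1)" "a4 = Complex (Re a1) (Im a3)"
      unfolding a1_def a2_def a3_def a4_def by (auto simp: complex_eq_iff)
    have rp: "rectpath a1 a3 = linepath a1 a2 +++ linepath a2 a3 +++ linepath a3 a4 +++ linepath a4 a1"
      unfolding rectpath_def Let_def a ..
    have wb: "\<bar>Re w\<bar> < r" "\<bar>Im w\<bar> < r" using r(1) abs_Re_le_cmod[of w] abs_Im_le_cmod[of w] by linarith+
    have wn: "winding_number (rectpath a1 a3) w = (if Im w > 0 then 1 else 0)"
    proof (cases "Im w > 0")
      case True
      then show ?thesis using wb by (auto intro!: winding_number_rectpath simp: in_box_complex_iff a1_def a3_def)
    next
      case False
      then show ?thesis using w r by (auto intro!: winding_number_rectpath_outside simp: in_cbox_complex_iff a1_def a3_def)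
    qed
    have wp: "w \<notin> path_image (rectpath a1 a3)"
      using wb w r by (subst path_image_rectpath) (auto simp: a1_def a3_def)
    have I: "(h has_contour_integral c) (rectpath a1 a3)"
      using Cauchy_integral_formula_convex_simple[OF convex_UNIV hol, of w "rectpath a1 a3"] wp wn
      unfolding h_def c_def by (auto simp: mult_ac split: if_splits)
    have cont: "continuous_on (- {w}) h" unfolding h_def
      by (intro continuous_intros continuous_on_subset[OF holomorphic_on_imp_continuous_on[OF hol]]) auto
    have "path_image (rectpath a1 a3) = closed_segment a1 a2 \<union> (closed_segment a2 a3 \<union> (closed_segment a3 a4 \<union> closed_segment a4 a1))"
      unfolding rp by (simp add: path_image_join)
    then have nw: "w \<notin> closed_segment a1 a2" "w \<notin> closed_segment a2 a3" "w \<notin> closed_segment a3 a4" "w \<notin> closed_segment a4 a1"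
      using wp by auto
    have ci: "h contour_integrable_on linepath a b" if "w \<notin> closed_segment a b" for a b
      by (intro contour_integrable_continuous_linepath continuous_on_subset[OF cont]) (use that in auto)
    have sum: "c = contour_integral (linepath a1 a2) h + (contour_integral (linepath a2 a3) h
        + (contour_integral (linepath a3 a4) h + contour_integral (linepath a4 a1) h))"
      using contour_integral_unique[OF I] ci[OF nw(1)] ci[OF nw(2)] ci[OF nw(3)] ci[OF nw(4)]
      unfolding rp by (simp add: contour_integrable_joinI)
    define B where "B = K / (r * (r - cmod w))"
    have B0: "B \<ge> 0" unfolding B_def using K0 r by simp
    have hb: "cmod (h z) \<le> B" if "cmod z \<ge> r" "Im z \<ge> 0" for z
    proof -
      have z: "cmod (z - w) \<ge> r - cmod w" using norm_triangle_ineq2[of z w] that by linarith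
      have "cmod (h z) \<le> (K / (1 + cmod z)) / (r - cmod w)"
        unfolding h_def norm_divide using K[OF that(2)] z r K0 by (intro frac_le) auto
      also have "\<dots> \<le> (K / r) / (r - cmod w)"
        using that r K0 by (intro divide_right_mono divide_left_mono) (auto simp: add_pos_nonneg)
      finally show ?thesis unfolding B_def by simp
    qed
    have seg: "cmod (contour_integral (linepath a b) h) \<le> B * cmod (b - a)"
      if "w \<notin> closed_segment a b" "\<And>z. z \<in> closed_segment a b \<Longrightarrow> cmod z \<ge> r \<and> Im z \<ge> 0" for a b
      using that by (intro contour_integral_bound_linepath ci B0 hb) auto
    have s2: "cmod (contour_integral (linepath a2 a3) h) \<le> B * r"
    proof -
      have "cmod z \<ge> r \<and> Im z \<ge> 0" if "z \<in> closed_segment a2 a3" for z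
      proof -
        have "Re z = r" "Im z \<in> closed_segment 0 r"
          using that by (auto simp: closed_segment_same_Re a2_def a3_def)
        then show ?thesis using r abs_Re_le_cmod[of z] by (auto simp: closed_segment_eq_real_ivl)
      qed
      moreover have "cmod (a3 - a2) = r" unfolding a2_def a3_def using r by (simp add: cmod_def)
      ultimately show ?thesis using seg[OF nw(2)] by simp
    qed
    have s3: "cmod (contour_integral (linepath a3 a4) h) \<le> B * (2 * r)"
    proof -
      have "cmod z \<ge> r \<and> Im z \<ge> 0" if "z \<in> closed_segment a3 a4" for z
      proof -
        have "Im z = r" using that by (auto simp: closed_segment_same_Im a3_def a4_def)
        then show ?thesis using r abs_Im_le_cmod[of z] by auto
      qed
      moreover have "cmod (a4 - a3) = 2 * r" unfolding a4_def a3_def using r by (simp add: cmod_def power2_eq_square real_sqrt_mult)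
      ultimately show ?thesis using seg[OF nw(3)] by simp
    qed
    have s4: "cmod (contour_integral (linepath a4 a1) h) \<le> B * r"
    proof -
      have "cmod z \<ge> r \<and> Im z \<ge> 0" if "z \<in> closed_segment a4 a1" for z
      proof -
        have "Re z = - r" "Im z \<in> closed_segment r 0"
          using that by (auto simp: closed_segment_same_Re a4_def a1_def)
        then show ?thesis using r abs_Re_le_cmod[of z] by (auto simp: closed_segment_eq_real_ivl)
      qed
      moreover have "cmod (a1 - a4) = r" unfolding a4_def a1_def using r by (simp add: cmod_def)
      ultimately show ?thesis using seg[OF nw(4)] by simp
    qed
    have "contour_integral (linepath a1 a2) h = integral {-r..r} (\<lambda>x. h (of_real x))"
      unfolding a1_def a2_def using r by (subst contour_integral_linepath_Reals_eq) auto
    also have "\<dots> = (LINT x:{-r..r}|lborel. h (of_real x))"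
    proof (rule set_borel_integral_eq_integral(2)[symmetric])
      show "set_integrable lborel {-r..r} (\<lambda>x. h (of_real x))"
        unfolding set_integrable_def by (intro integrable_mult_indicator ih) auto
    qed
    finally have "(LINT x:{-r..r}|lborel. h (of_real x)) - c = - (contour_integral (linepath a2 a3) h
        + (contour_integral (linepath a3 a4) h + contour_integral (linepath a4 a1) h))"
      using sum by (simp add: algebra_simps)
    then have "cmod ((LINT x:{-r..r}|lborel. h (of_real x)) - c) \<le> B * r + (B * (2 * r) + B * r)"
      using norm_triangle_mono[OF s2 norm_triangle_mono[OF s3 s4]] by (metis norm_minus_cancel)
    also have "\<dots> = 4 * (B * r)" by simp
    also have "\<dots> = 4 * K / (r - cmod w)" unfolding B_def using r by (simp add: field_simps)
    finally show ?thesis unfolding r_def .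
  qed
  have l1: "(\<lambda>n. LINT x:{-real n..real n}|lborel. h (of_real x)) \<longlonglongrightarrow> (LINT x|lborel. h (of_real x))"
    unfolding set_lebesgue_integral_def
  proof (rule integral_dominated_convergence[where w = "\<lambda>x. cmod (h (of_real x))"])
    show "integrable lborel (\<lambda>x. cmod (h (of_real x)))" using ih by (rule integrable_norm)
    show "(\<lambda>x. h (of_real x)) \<in> borel_measurable lborel" using ih by (rule borel_measurable_integrable)
    then show "(\<lambda>x. indicat_real {- real i..real i} x *\<^sub>R h (complex_of_real x)) \<in> borel_measurable lborel" for i
      by measurable
    show "AE x in lborel. (\<lambda>i. indicat_real {- real i..real i} x *\<^sub>R h (complex_of_real x)) \<longlonglongrightarrow> h (of_real x)"
    proof (rule AE_I2)
      fix x :: real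
      obtain m where m: "\<bar>x\<bar> \<le> real m" using real_arch_simple by blast
      have "\<forall>\<^sub>F i in sequentially. indicat_real {- real i..real i} x *\<^sub>R h (complex_of_real x) = h (of_real x)"
        unfolding eventually_sequentially
      proof (intro exI[of _ m] allI impI)
        fix i assume "m \<le> i"
        then have "\<bar>x\<bar> \<le> real i" using m by (meson of_nat_le_iff order_trans)
        then show "indicat_real {- real i..real i} x *\<^sub>R h (complex_of_real x) = h (of_real x)" by (auto simp: indicator_def abs_le_iff)
      qed
      then show "(\<lambda>i. indicat_real {- real i..real i} x *\<^sub>R h (complex_of_real x)) \<longlonglongrightarrow> h (of_real x)"
        by (rule tendsto_eventually)
    qed
  qed (auto simp: indicator_def)
  have l2: "(\<lambda>n. (LINT x:{-real n..real n}|lborel. h (of_real x)) - c) \<longlonglongrightarrow> 0"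
  proof (rule Lim_null_comparison)
    show "\<forall>\<^sub>F n in sequentially. norm ((LINT x:{-real n..real n}|lborel. h (of_real x)) - c) \<le> 4 * K / (real n - cmod w)"
      using rect unfolding eventually_sequentially by blast
    show "(\<lambda>n. 4 * K / (real n - cmod w)) \<longlonglongrightarrow> 0" by real_asymp
  qed
  have "(LINT x|lborel. h (of_real x)) - c = 0"
    by (rule LIMSEQ_unique[OF tendsto_diff[OF l1 tendsto_const] l2])
  then show ?thesis unfolding h_def c_def by simp
qed

text \<open>Only linear growth of \<open>f\<close> is known, so \<open>f z * exp (\<i> pi z)\<close>
  need not decay in the half-plane. The square of \<open>csinc (d z)\<close> supplies decay of order
  two, which beats the linear growth by one power, and \<open>exp (2 \<i> d z)\<close> pays for its
  exponential growth. On the real line both factors have modulus at most 1, which lets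
  \<open>d\<close> tend to 0 under the integral.\<close>

lemma PW_Cauchy:
  assumes f: "f \<in> PW" and w: "Im w \<noteq> 0"
  shows "(LINT x|lborel. f (of_real x) * exp (\<i> * of_real pi * of_real x) / (of_real x - w))
       = (if Im w > 0 then 2 * of_real pi * \<i> * (f w * exp (\<i> * of_real pi * w)) else 0)"
proof -
  have hol: "f holomorphic_on UNIV" using f by (rule PW_entire)
  obtain K where K: "K > 0" "\<And>z. cmod (f z) \<le> K * (1 + cmod z) * exp (pi * \<bar>Im z\<bar>)"
    using PW_linear_growth[OF f] by blast
  obtain C where C: "C > 0" "\<And>z. cmod (csinc z) \<le> C * exp \<bar>Im z\<bar> / (1 + cmod z)"
    using csinc_bound by blast
  define d where "d = (\<lambda>n. inverse (real (Suc n)))"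
  have d: "d n > 0" "d n \<le> 1" for n unfolding d_def by (auto simp: field_simps)
  have dlim: "d \<longlonglongrightarrow> 0" unfolding d_def by (rule LIMSEQ_inverse_real_of_nat)
  define k where "k = (\<lambda>n z. f z * (csinc (of_real (d n) * z))\<^sup>2 * exp (\<i> * of_real (pi + 2 * d n) * z))"
  have holk: "k n holomorphic_on UNIV" for n
  proof -
    have "(\<lambda>z. csinc (of_real (d n) * z)) holomorphic_on UNIV"
      by (intro entire_compose[OF csinc_entire] holomorphic_intros)
    then show ?thesis unfolding k_def by (intro holomorphic_intros hol)
  qed
  have kb: "cmod (k n z) \<le> (K * C\<^sup>2 / (d n)\<^sup>2) / (1 + cmod z)" if z: "Im z \<ge> 0" for n z
  proof -
    have "d n * (1 + cmod z) \<le> 1 + d n * cmod z" using d[of n] by (simp add: algebra_simps)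
    then have s: "cmod (csinc (of_real (d n) * z)) \<le> C * exp (d n * Im z) / (d n * (1 + cmod z))"
      using C(2)[of "of_real (d n) * z"] d[of n] z C(1)
      by (elim order_trans) (auto simp: norm_mult intro!: divide_left_mono mult_pos_pos add_pos_nonneg)
    have "cmod (k n z) \<le> (K * (1 + cmod z) * exp (pi * Im z)) * (C * exp (d n * Im z) / (d n * (1 + cmod z)))\<^sup>2 * exp (- (pi + 2 * d n) * Im z)"
    proof -
      have 1: "cmod (f z) \<le> K * (1 + cmod z) * exp (pi * Im z)" using K(2)[of z] z by simp
      have 2: "(cmod (csinc (of_real (d n) * z)))\<^sup>2 \<le> (C * exp (d n * Im z) / (d n * (1 + cmod z)))\<^sup>2"
        using s by (intro power_mono) auto
      have 3: "cmod (exp (\<i> * of_real (pi + 2 * d n) * z)) = exp (- (pi + 2 * d n) * Im z)" by (simp add: algebra_simps)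
      show ?thesis unfolding k_def norm_mult norm_power 3[unfolded norm_mult]
        using 1 2 3 K(1) by (intro mult_mono mult_nonneg_nonneg) (auto simp: norm_mult)
    qed
    also have "\<dots> = K * (1 + cmod z) * (C / (d n * (1 + cmod z)))\<^sup>2 * (exp (pi * Im z) * (exp (d n * Im z))\<^sup>2 * exp (- (pi + 2 * d n) * Im z))"
      by (simp add: power_mult_distrib power_divide)
    also have "exp (pi * Im z) * (exp (d n * Im z))\<^sup>2 * exp (- (pi + 2 * d n) * Im z) = 1"
      by (simp add: power2_eq_square mult_exp_exp algebra_simps)
    also have "K * (1 + cmod z) * (C / (d n * (1 + cmod z)))\<^sup>2 * 1 = (K * C\<^sup>2 / (d n)\<^sup>2) / (1 + cmod z)"
    proof -
      have "1 + cmod z > 0" by (simp add: add_pos_nonneg)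
      then show ?thesis using d[of n] by (simp add: power_divide power_mult_distrib power2_eq_square)
    qed
    finally show ?thesis .
  qed
  have ck: "(LINT x|lborel. k n (of_real x) / (of_real x - w)) = (if Im w > 0 then 2 * of_real pi * \<i> * k n w else 0)" for n
    by (rule Cauchy_upper_halfplane[OF holk kb w])
  have klim: "(\<lambda>n. k n z) \<longlonglongrightarrow> f z * exp (\<i> * of_real pi * z)" for z
  proof -
    have c: "isCont csinc 0" using holomorphic_on_imp_continuous_on[OF csinc_entire] by (simp add: continuous_on_eq_continuous_at)
    have "(\<lambda>n. of_real (d n) * z) \<longlonglongrightarrow> 0" using tendsto_mult[OF tendsto_of_real[OF dlim] tendsto_const[of z]] by simp
    from isCont_tendsto_compose[OF c this] have a: "(\<lambda>n. csinc (of_real (d n) * z)) \<longlonglongrightarrow> csinc 0" .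
    have b: "(\<lambda>n. exp (\<i> * of_real (pi + 2 * d n) * z)) \<longlonglongrightarrow> exp (\<i> * of_real (pi + 2 * 0) * z)"
      by (intro tendsto_intros dlim)
    have "(\<lambda>n. k n z) \<longlonglongrightarrow> f z * (csinc 0)\<^sup>2 * exp (\<i> * of_real (pi + 2 * 0) * z)"
      unfolding k_def by (intro tendsto_mult tendsto_power tendsto_const a b)
    then show ?thesis by simp
  qed
  have "(\<lambda>n. LINT x|lborel. k n (of_real x) / (of_real x - w)) \<longlonglongrightarrow>
     (LINT x|lborel. f (of_real x) * exp (\<i> * of_real pi * of_real x) / (of_real x - w))"
  proof (rule integral_dominated_convergence[where w = "\<lambda>x. cmod (f (of_real x) / (of_real x - w))"])
    have [measurable]: "(\<lambda>x. f (complex_of_real x)) \<in> borel_measurable borel" using entire_measurable[OF hol] .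
    have [measurable]: "(\<lambda>x. k n (complex_of_real x)) \<in> borel_measurable borel" for n using entire_measurable[OF holk] .
    show "(\<lambda>x. f (of_real x) * exp (\<i> * of_real pi * of_real x) / (of_real x - w)) \<in> borel_measurable lborel"
      by measurable
    show "(\<lambda>x. k n (of_real x) / (of_real x - w)) \<in> borel_measurable lborel" for n by measurable
    show "integrable lborel (\<lambda>x. cmod (f (of_real x) / (of_real x - w)))"
      by (intro integrable_norm square_integrable_Cauchy PW_square_integrable f w)
    show "AE x in lborel. (\<lambda>n. k n (of_real x) / (of_real x - w)) \<longlonglongrightarrow> f (of_real x) * exp (\<i> * of_real pi * of_real x) / (of_real x - w)"
      using w by (intro AE_I2 tendsto_divide klim tendsto_const) (auto simp: complex_eq_iff)
    have "cmod (k n (of_real x)) \<le> cmod (f (of_real x))" for n x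
    proof -
      have "(cmod (csinc (of_real (d n) * of_real x)))\<^sup>2 \<le> 1"
        using csinc_real_le_1[of "d n * x"] by (simp add: power_le_one)
      then show ?thesis unfolding k_def norm_mult norm_power by (simp add: mult_left_le)
    qed
    then show "AE x in lborel. norm (k n (of_real x) / (of_real x - w)) \<le> cmod (f (of_real x) / (of_real x - w))" for n
      by (intro AE_I2) (auto simp: norm_divide intro!: divide_right_mono)
  qed
  then have "(\<lambda>n. (if Im w > 0 then 2 * of_real pi * \<i> * k n w else 0)) \<longlonglongrightarrow>
     (LINT x|lborel. f (of_real x) * exp (\<i> * of_real pi * of_real x) / (of_real x - w))" unfolding ck .
  moreover have "(\<lambda>n. (if Im w > 0 then 2 * of_real pi * \<i> * k n w else 0)) \<longlonglongrightarrow>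
      (if Im w > 0 then 2 * of_real pi * \<i> * (f w * exp (\<i> * of_real pi * w)) else 0)"
    by (cases "Im w > 0") (auto intro!: tendsto_intros klim)
  ultimately show ?thesis by (rule LIMSEQ_unique)
qed

lemma PW_reflect: "f \<in> PW \<Longrightarrow> (\<lambda>z. f (- z)) \<in> PW"
proof -
  assume f: "f \<in> PW"
  have "(\<lambda>z. f (- z)) holomorphic_on UNIV"
    by (intro entire_compose[OF PW_entire[OF f]] holomorphic_intros)
  moreover have "integrable lborel (\<lambda>x. (cmod (f (- of_real x)))\<^sup>2)"
    using lborel_integrable_real_affine[OF square_integrableD[OF PW_square_integrable[OF f]], of "-1" 0] by simp
  ultimately show ?thesis using f exp_type_reflect unfolding PW_def by auto
qed

text \<open>Writing the sine by exponentials splits the integral into two Cauchy integrals, one for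
  the upper half-plane and, after reflection, one for the lower. For either sign of
  \<open>Im w\<close> at most one of them contributes, and its exponential cancels against the
  coefficient.\<close>

lemma PW_reproducing_nonreal:
  assumes f: "f \<in> PW" and w: "Im w \<noteq> 0"
  shows "(LINT x|lborel. f (of_real x) * csinc (of_real pi * (of_real x - w))) = f w"
proof -
  define E where "E = (\<lambda>z. exp (\<i> * of_real pi * z))"
  have Em: "E (- z) * E z = 1" for z unfolding E_def by (simp add: mult_exp_exp)
  have I1: "(LINT x|lborel. f (of_real x) * E (of_real x) / (of_real x - w))
       = (if Im w > 0 then 2 * of_real pi * \<i> * (f w * E w) else 0)"
    using PW_Cauchy[OF f w] unfolding E_def .
  have "(LINT x|lborel. f (- of_real x) * E (of_real x) / (of_real x - (-w)))
       = (if Im (-w) > 0 then 2 * of_real pi * \<i> * (f (- (- w)) * E (-w)) else 0)"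
    using PW_Cauchy[OF PW_reflect[OF f], of "-w"] w unfolding E_def by simp
  also have "(LINT x|lborel. f (- of_real x) * E (of_real x) / (of_real x - (-w)))
     = (LINT x|lborel. f (of_real x) * E (- of_real x) / (- of_real x - (-w)))"
    using lborel_integral_real_affine[of "-1" "\<lambda>x. f (- of_real x) * E (of_real x) / (of_real x - (-w))" 0] by simp
  also have "\<dots> = (LINT x|lborel. - (f (of_real x) * E (- of_real x) / (of_real x - w)))"
  proof (intro Bochner_Integration.integral_cong refl)
    fix x :: real
    have "- of_real x - - w = - (of_real x - w)" by simp
    then show "f (of_real x) * E (- of_real x) / (- of_real x - - w) = - (f (of_real x) * E (- of_real x) / (of_real x - w))"
      by (metis divide_minus_right)
  qed
  also have "\<dots> = - (LINT x|lborel. f (of_real x) * E (- of_real x) / (of_real x - w))" by simp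
  finally have "- (LINT x|lborel. f (of_real x) * E (- of_real x) / (of_real x - w))
     = (if Im w < 0 then 2 * of_real pi * \<i> * (f w * E (-w)) else 0)" by simp
  note I2 = this[THEN minus_equation_iff[THEN iffD1], symmetric]
  have i: "integrable lborel (\<lambda>x. f (of_real x) * E (s * of_real x) / (of_real x - w))" if "s = 1 \<or> s = -1" for s
  proof (rule Bochner_Integration.integrable_bound)
    show "integrable lborel (\<lambda>x. f (of_real x) / (of_real x - w))"
      by (rule square_integrable_Cauchy[OF PW_square_integrable[OF f] w])
    have [measurable]: "(\<lambda>x. f (complex_of_real x)) \<in> borel_measurable borel" using entire_measurable[OF PW_entire[OF f]] .
    show "(\<lambda>x. f (of_real x) * E (s * of_real x) / (of_real x - w)) \<in> borel_measurable lborel"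
      unfolding E_def by measurable
    show "AE x in lborel. norm (f (of_real x) * E (s * of_real x) / (of_real x - w)) \<le> norm (f (of_real x) / (of_real x - w))"
      using that by (intro AE_I2) (auto simp: E_def norm_mult norm_divide)
  qed
  define h1 h2 where "h1 = (\<lambda>x. f (of_real x) * E (of_real x) / (of_real x - w))"
    and "h2 = (\<lambda>x. f (of_real x) * E (- of_real x) / (of_real x - w))"
  define c1 c2 where "c1 = E (-w) / (2 * \<i> * of_real pi)" and "c2 = E w / (2 * \<i> * of_real pi)"
  have i12: "integrable lborel h1" "integrable lborel h2"
    using i[of 1] i[of "-1"] unfolding h1_def h2_def by simp_all
  have "f (of_real x) * csinc (of_real pi * (of_real x - w)) =
c1 * h1 x - c2 * h2 x" for x
  proof -
    have nz: "of_real x - w \<noteq> 0" using of_real_minus_nonreal[OF w] .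
    have "csinc (of_real pi * (of_real x - w)) = (E (of_real x) * E (- w) - E (- of_real x) * E w) / (2 * \<i>) / (of_real pi * (of_real x - w))"
      using nz unfolding csinc_def sin_exp_eq E_def by (simp add: mult_exp_exp algebra_simps)
    then show ?thesis unfolding c1_def c2_def h1_def h2_def by (simp add: diff_divide_distrib right_diff_distrib mult_ac)
  qed
  then have "(LINT x|lborel. f (of_real x) * csinc (of_real pi * (of_real x - w))) = (LINT x|lborel. c1 * h1 x - c2 * h2 x)"
    by (intro Bochner_Integration.integral_cong refl)
  also have "\<dots> = c1 * integral\<^sup>L lborel h1 - c2 * integral\<^sup>L lborel h2"
    using i12 by (subst Bochner_Integration.integral_diff) simp_all
  also have "\<dots> = f w"
  proof (cases "Im w > 0")
    case True
    then show ?thesis using I1 I2 Em[of w] unfolding c1_def c2_def h1_def h2_def by (simp add: mult_ac)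
  next
    case False
    then show ?thesis using I1 I2 Em[of w] w unfolding c1_def c2_def h1_def h2_def by (simp add: mult_ac)
  qed
  finally show ?thesis .
qed

lemma csinc_kernel_bound:
  obtains C where "C > 0" "\<And>x w. cmod (csinc (of_real pi * (of_real x - w))) \<le> C * exp (pi * \<bar>Im w\<bar>) / sqrt (1 + (x - Re w)\<^sup>2)"
proof -
  obtain C where C: "C > 0" "\<And>z. cmod (csinc z) \<le> C * exp \<bar>Im z\<bar> / (1 + cmod z)"
    using csinc_bound by blast
  have "cmod (csinc (of_real pi * (of_real x - w))) \<le> C * exp (pi * \<bar>Im w\<bar>) / sqrt (1 + (x - Re w)\<^sup>2)" for x w
  proof -
    let ?z = "of_real pi * (of_real x - w)"
    have "\<bar>x - Re w\<bar> \<le> cmod (of_real x - w)" using abs_Re_le_cmod[of "of_real x - w"] by simp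
    also have "\<dots> \<le> pi * cmod (of_real x - w)" using pi_ge_two by (simp add: mult_le_cancel_right1)
    finally have "\<bar>x - Re w\<bar> \<le> cmod ?z" by (simp add: norm_mult)
    moreover have "sqrt (1 + (x - Re w)\<^sup>2) \<le> 1 + \<bar>x - Re w\<bar>" by (rule real_le_lsqrt) (auto simp: power2_sum)
    ultimately have "sqrt (1 + (x - Re w)\<^sup>2) \<le> 1 + cmod ?z" by linarith
    then have "C * exp \<bar>Im ?z\<bar> / (1 + cmod ?z) \<le> C * exp \<bar>Im ?z\<bar> / sqrt (1 + (x - Re w)\<^sup>2)"
      using C(1) by (intro divide_left_mono mult_pos_pos) (auto simp: add_pos_nonneg)
    moreover have "\<bar>Im ?z\<bar> = pi * \<bar>Im w\<bar>" by (simp add: abs_mult)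
    ultimately show ?thesis using C(2)[of ?z] by simp
  qed
  then show ?thesis using that C(1) by blast
qed

lemma csinc_kernel_measurable: "(\<lambda>x. csinc (of_real pi * (of_real x - w))) \<in> borel_measurable borel"
proof -
  have "(\<lambda>z. csinc (of_real pi * (z - w))) holomorphic_on UNIV"
    by (intro entire_compose[OF csinc_entire] holomorphic_intros)
  then show ?thesis using entire_measurable by blast
qed

text \<open>Translation by \<open>Re w\<close> reduces to a majorant centred at 0, which is why the
  norm bound depends on \<open>w\<close> through \<open>Im w\<close> alone.\<close>

lemma csinc_kernel_square_integrable:
  obtains C where "C > 0" "\<And>w. square_integrable (\<lambda>x. csinc (of_real pi * (of_real x - w)))"
    "\<And>w. sqrt (LINT x|lborel. (cmod (csinc (of_real pi * (of_real x - w))))\<^sup>2) \<le> C * exp (pi * \<bar>Im w\<bar>)"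
proof -
  obtain C where C: "C > 0" "\<And>x w. cmod (csinc (of_real pi * (of_real x - w))) \<le> C * exp (pi * \<bar>Im w\<bar>) / sqrt (1 + (x - Re w)\<^sup>2)"
    using csinc_kernel_bound by blast
  define J where "J = (LINT x|lborel. 1 / (1 + (x::real)\<^sup>2))"
  have J: "J \<ge> 0" unfolding J_def by (intro integral_nonneg_AE) (auto simp: add_nonneg_nonneg)
  have *: "square_integrable (\<lambda>x. csinc (of_real pi * (of_real x - w))) \<and>
     sqrt (LINT x|lborel. (cmod (csinc (of_real pi * (of_real x - w))))\<^sup>2) \<le> (C * sqrt (J + 1)) * exp (pi * \<bar>Im w\<bar>)" for w
  proof
    let ?u = "\<lambda>x. csinc (of_real pi * (of_real (x + Re w) - w))"
    have m: "?u \<in> borel_measurable borel"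
      using csinc_kernel_measurable[of "w - of_real (Re w)"] by (simp add: algebra_simps)
    have b: "cmod (?u x) \<le> C * exp (pi * \<bar>Im w\<bar>) / sqrt (1 + x\<^sup>2)" for x
      using C(2)[of "x + Re w" w] by simp
    note s = square_integrable_by_decay[OF m b, folded J_def]
    show "square_integrable (\<lambda>x. csinc (of_real pi * (of_real x - w)))"
      using lborel_integrable_real_affine[OF square_integrableD[OF s(1)], of 1 "- Re w"] csinc_kernel_measurable[of w]
      unfolding square_integrable_def by simp
    have "(LINT x|lborel. (cmod (csinc (of_real pi * (of_real x - w))))\<^sup>2) = (LINT x|lborel. (cmod (?u x))\<^sup>2)"
      using lborel_integral_real_affine[of 1 "\<lambda>x. (cmod (csinc (of_real pi * (of_real x - w))))\<^sup>2" "Re w"] by (simp add: add.commute)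
    also have "\<dots> \<le> (C * exp (pi * \<bar>Im w\<bar>))\<^sup>2 * J" by (rule s(2))
    also have "\<dots> \<le> (C * exp (pi * \<bar>Im w\<bar>))\<^sup>2 * (J + 1)" by (intro mult_left_mono) auto
    finally have "sqrt (LINT x|lborel. (cmod (csinc (of_real pi * (of_real x - w))))\<^sup>2) \<le> sqrt ((C * exp (pi * \<bar>Im w\<bar>))\<^sup>2 * (J + 1))"
      by (rule real_sqrt_le_mono)
    then show "sqrt (LINT x|lborel. (cmod (csinc (of_real pi * (of_real x - w))))\<^sup>2) \<le> (C * sqrt (J + 1)) * exp (pi * \<bar>Im w\<bar>)"
      using C(1) by (simp add: real_sqrt_mult mult_ac)
  qed
  show ?thesis using that[of "C * sqrt (J + 1)"] * C(1) J by simp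
qed

text \<open>The Cauchy integrals exclude real points; these are reached as limits of
  \<open>w + \<i> / (n + 1)\<close>, along which the kernels have a common square integrable
  majorant.\<close>

lemma PW_reproducing:
  assumes f: "f \<in> PW"
  shows "(LINT x|lborel. f (of_real x) * csinc (of_real pi * (of_real x - w))) = f w"
proof (cases "Im w = 0")
  case False
  then show ?thesis by (rule PW_reproducing_nonreal[OF f])
next
  case True
  obtain C where C: "C > 0" "\<And>x w. cmod (csinc (of_real pi * (of_real x - w))) \<le> C * exp (pi * \<bar>Im w\<bar>) / sqrt (1 + (x - Re w)\<^sup>2)"
    using csinc_kernel_bound by blast
  define W where "W = (\<lambda>n. w + \<i> * of_real (inverse (real (Suc n))))"
  have W: "Im (W n) \<noteq> 0" "\<bar>Im (W n)\<bar> \<le> 1" "Re (W n) = Re w" for n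
    unfolding W_def using True by (auto simp: field_simps)
  have Wl: "W \<longlonglongrightarrow> w"
    unfolding W_def using tendsto_add[OF tendsto_const[of w] tendsto_mult[OF tendsto_const[of \<i>] tendsto_of_real[OF LIMSEQ_inverse_real_of_nat]]] by simp
  have cf: "isCont f z" for z using holomorphic_on_imp_continuous_on[OF PW_entire[OF f]] by (simp add: continuous_on_eq_continuous_at)
  have cs: "isCont csinc z" for z using holomorphic_on_imp_continuous_on[OF csinc_entire] by (simp add: continuous_on_eq_continuous_at)
  have m: "(\<lambda>x. f (complex_of_real x)) \<in> borel_measurable borel" using entire_measurable[OF PW_entire[OF f]] .
  have "(\<lambda>n. LINT x|lborel. f (of_real x) * csinc (of_real pi * (of_real x - W n))) \<longlonglongrightarrow>
      (LINT x|lborel. f (of_real x) * csinc (of_real pi * (of_real x - w)))"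
  proof (rule integral_dominated_convergence[where w = "\<lambda>x. cmod (f (of_real x) * of_real (C * exp pi / sqrt (1 + (x - Re w)\<^sup>2)))"])
    note [measurable] = m csinc_kernel_measurable
    show "(\<lambda>x. f (of_real x) * csinc (of_real pi * (of_real x - w))) \<in> borel_measurable lborel" by measurable
    show "(\<lambda>x. f (of_real x) * csinc (of_real pi * (of_real x - W n))) \<in> borel_measurable lborel" for n by measurable
    show "integrable lborel (\<lambda>x. cmod (f (of_real x) * of_real (C * exp pi / sqrt (1 + (x - Re w)\<^sup>2))))"
    proof (intro integrable_norm square_integrable_mult PW_square_integrable f)
      have "square_integrable (\<lambda>x. complex_of_real (C * exp pi / sqrt (1 + x\<^sup>2)))"
        using C(1) by (intro square_integrable_by_decay(1)[where B = "C * exp pi"]) (auto simp: norm_divide norm_mult)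
      then show "square_integrable (\<lambda>x. complex_of_real (C * exp pi / sqrt (1 + (x - Re w)\<^sup>2)))"
        using lborel_integrable_real_affine[OF square_integrableD, of "\<lambda>x. complex_of_real (C * exp pi / sqrt (1 + x\<^sup>2))" 1 "- Re w"]
        unfolding square_integrable_def by simp
    qed
    show "AE x in lborel. (\<lambda>n. f (of_real x) * csinc (of_real pi * (of_real x - W n))) \<longlonglongrightarrow> f (of_real x) * csinc (of_real pi * (of_real x - w))"
      by (intro AE_I2 tendsto_mult tendsto_const isCont_tendsto_compose[OF cs] tendsto_diff Wl)
    show "AE x in lborel. norm (f (of_real x) * csinc (of_real pi * (of_real x - W n))) \<le> cmod (f (of_real x) * of_real (C * exp pi / sqrt (1 + (x - Re w)\<^sup>2)))" for n
    proof (rule AE_I2)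
      fix x :: real
      have "cmod (csinc (of_real pi * (of_real x - W n))) \<le> C * exp (pi * \<bar>Im (W n)\<bar>) / sqrt (1 + (x - Re w)\<^sup>2)"
        using C(2)[of x "W n"] W by simp
      also have "\<dots> \<le> C * exp pi / sqrt (1 + (x - Re w)\<^sup>2)"
        using C(1) W(2)[of n] by (intro divide_right_mono mult_left_mono) auto
      finally have "cmod (csinc (of_real pi * (of_real x - W n))) \<le> C * exp pi / sqrt (1 + (x - Re w)\<^sup>2)" .
      then show "norm (f (of_real x) * csinc (of_real pi * (of_real x - W n))) \<le> cmod (f (of_real x) * of_real (C * exp pi / sqrt (1 + (x - Re w)\<^sup>2)))"
        unfolding norm_mult using C(1) by (intro mult_left_mono) (auto simp: norm_mult norm_divide)
    qed
  qed
  then have "(\<lambda>n. f (W n)) \<longlonglongrightarrow> (LINT x|lborel. f (of_real x) * csinc (of_real pi * (of_real x - w)))"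
    using PW_reproducing_nonreal[OF f W(1)] by simp
  moreover have "(\<lambda>n. f (W n)) \<longlonglongrightarrow> f w" by (rule isCont_tendsto_compose[OF cf Wl])
  ultimately show ?thesis by (rule LIMSEQ_unique)
qed

text \<open>Cauchy-Schwarz in the reproducing formula. Norm convergence thereby becomes uniform
  convergence on horizontal strips, the source of completeness of the space and of the later
  estimate of mass near a point.\<close>

lemma PW_point_bound:
  obtains C where "C > 0" "\<And>f w. f \<in> PW \<Longrightarrow> cmod (f w) \<le> C * exp (pi * \<bar>Im w\<bar>) * pw_norm f"
proof -
  obtain C where C: "C > 0" "\<And>w. square_integrable (\<lambda>x. csinc (of_real pi * (of_real x - w)))"
    "\<And>w. sqrt (LINT x|lborel. (cmod (csinc (of_real pi * (of_real x - w))))\<^sup>2) \<le> C * exp (pi * \<bar>Im w\<bar>)"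
    using csinc_kernel_square_integrable by blast
  have "cmod (f w) \<le> C * exp (pi * \<bar>Im w\<bar>) * pw_norm f" if f: "f \<in> PW" for f w
  proof -
    have "cmod (f w) = cmod (LINT x|lborel. f (of_real x) * csinc (of_real pi * (of_real x - w)))"
      using PW_reproducing[OF f] by simp
    also have "\<dots> \<le> pw_norm f * sqrt (LINT x|lborel. (cmod (csinc (of_real pi * (of_real x - w))))\<^sup>2)"
      unfolding pw_norm_def by (rule square_integrable_Cauchy_Schwarz_norm[OF PW_square_integrable[OF f] C(2)])
    also have "\<dots> \<le> pw_norm f * (C * exp (pi * \<bar>Im w\<bar>))"
      by (intro mult_left_mono C(3)) (simp add: pw_norm_def integral_nonneg_AE)
    finally show ?thesis by (simp add: mult_ac)
  qed
  then show ?thesis using that C(1) by blast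
qed

subsection \<open>The Hilbert space structure of the Paley--Wiener space\<close>

lemma exp_type_of_bound:
  assumes "\<And>z. cmod (f z) \<le> K * exp (pi * \<bar>Im z\<bar>)"
  shows "exp_type_le_pi f"
  unfolding exp_type_le_pi_def
proof (intro allI impI exI)
  fix e :: real and z assume e: "e > 0"
  have K: "K \<ge> 0" using order_trans[OF norm_ge_zero assms[of 0]] by simp
  have "pi * \<bar>Im z\<bar> \<le> (pi + e) * cmod z" using e abs_Im_le_cmod[of z] by (intro mult_mono) auto
  then have "K * exp (pi * \<bar>Im z\<bar>) \<le> K * exp ((pi + e) * cmod z)" using K by (intro mult_left_mono) auto
  then show "cmod (f z) \<le> K * exp ((pi + e) * cmod z)" using assms[of z] by linarith
qed

text \<open>Together with \<open>PW_bound\<close> this trades the type condition, with its arbitrary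
  \<open>e\<close>, for a single bound of exact type \<open>pi\<close>, which behaves well under
  sums and limits.\<close>

lemma PW_I:
  "f holomorphic_on UNIV \<Longrightarrow> (\<And>z. cmod (f z) \<le> K * exp (pi * \<bar>Im z\<bar>))
    \<Longrightarrow> square_integrable (\<lambda>x. f (of_real x)) \<Longrightarrow> f \<in> PW"
  using exp_type_of_bound by (auto simp: PW_iff)

lemma PW_bound:
  assumes "f \<in> PW"
  obtains K where "K > 0" "\<And>z. cmod (f z) \<le> K * exp (pi * \<bar>Im z\<bar>)"
proof -
  obtain C where C: "C > 0" "\<And>f w. f \<in> PW \<Longrightarrow> cmod (f w) \<le> C * exp (pi * \<bar>Im w\<bar>) * pw_norm f"
    using PW_point_bound by blast
  have n: "pw_norm f \<ge> 0" by (simp add: pw_norm_def integral_nonneg_AE)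
  have "cmod (f z) \<le> (C * (pw_norm f + 1)) * exp (pi * \<bar>Im z\<bar>)" for z
  proof -
    have "C * exp (pi * \<bar>Im z\<bar>) * pw_norm f \<le> C * exp (pi * \<bar>Im z\<bar>) * (pw_norm f + 1)"
      using C(1) by (intro mult_left_mono) auto
    then show ?thesis using C(2)[OF assms, of z] by (simp add: mult_ac)
  qed
  then show ?thesis using that[of "C * (pw_norm f + 1)"] C(1) n by simp
qed

lemma PW_add: "f \<in> PW \<Longrightarrow> g \<in> PW \<Longrightarrow> (\<lambda>z. f z + g z) \<in> PW"
proof -
  assume f: "f \<in> PW" and g: "g \<in> PW"
  obtain K where K: "\<And>z. cmod (f z) \<le> K * exp (pi * \<bar>Im z\<bar>)" using PW_bound[OF f] by blast
  obtain L where L: "\<And>z. cmod (g z) \<le> L * exp (pi * \<bar>Im z\<bar>)" using PW_bound[OF g] by blast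
  show "(\<lambda>z. f z + g z) \<in> PW"
  proof (rule PW_I[where K = "K + L"])
    show "cmod (f z + g z) \<le> (K + L) * exp (pi * \<bar>Im z\<bar>)" for z
      using norm_triangle_mono[OF K[of z] L[of z]] by (simp add: distrib_right)
  qed (rule holomorphic_on_add[OF PW_entire[OF f] PW_entire[OF g]]
       square_integrable_add[OF PW_square_integrable[OF f] PW_square_integrable[OF g]])+
qed

lemma PW_cmult: "f \<in> PW \<Longrightarrow> (\<lambda>z. c * f z) \<in> PW"
proof -
  assume f: "f \<in> PW"
  obtain K where K: "\<And>z. cmod (f z) \<le> K * exp (pi * \<bar>Im z\<bar>)" using PW_bound[OF f] by blast
  show "(\<lambda>z. c * f z) \<in> PW"
  proof (rule PW_I[where K = "cmod c * K"])
    show "cmod (c * f z) \<le> cmod c * K * exp (pi * \<bar>Im z\<bar>)" for z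
      using mult_left_mono[OF K[of z] norm_ge_zero[of c]] by (simp add: norm_mult mult.assoc)
  qed (rule holomorphic_on_mult[OF holomorphic_on_const PW_entire[OF f]]
       square_integrable_cmult[OF PW_square_integrable[OF f]])+
qed

lemma PW_diff: "f \<in> PW \<Longrightarrow> g \<in> PW \<Longrightarrow> (\<lambda>z. f z - g z) \<in> PW"
  using PW_add[of f "\<lambda>z. (-1) * g z"] PW_cmult[of g "-1"] by simp

lemma PW_0: "(\<lambda>z. 0) \<in> PW"
  by (simp add: PW_def exp_type_le_pi_def) (metis mult_zero_left order_refl)

lemma PW_sum: "(\<And>i. i \<in> J \<Longrightarrow> F i \<in> PW) \<Longrightarrow> (\<lambda>z. \<Sum>i\<in>J. F i z) \<in> PW"
  by (induction J rule: infinite_finite_induct) (auto simp: PW_0 intro: PW_add)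

lemma pw_kernel_csinc: "pw_kernel l z = csinc (of_real pi * (z - cnj l))"
  by (simp add: pw_kernel_def csinc_def)

lemma pw_kernel_PW: "pw_kernel l \<in> PW"
proof -
  obtain C where C: "C > 0" "\<And>z. cmod (csinc z) \<le> C * exp \<bar>Im z\<bar> / (1 + cmod z)"
    using csinc_bound by blast
  obtain D where D: "\<And>w. square_integrable (\<lambda>x. csinc (of_real pi * (of_real x - w)))"
    using csinc_kernel_square_integrable by blast
  show ?thesis unfolding pw_kernel_csinc[abs_def]
  proof (rule PW_I[where K = "C * exp (pi * \<bar>Im l\<bar>)"])
    show "(\<lambda>z. csinc (of_real pi * (z - cnj l))) holomorphic_on UNIV"
      by (intro entire_compose[OF csinc_entire] holomorphic_intros)
    show "cmod (csinc (of_real pi * (z - cnj l))) \<le> C * exp (pi * \<bar>Im l\<bar>) * exp (pi * \<bar>Im z\<bar>)" for z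
    proof -
      let ?u = "of_real pi * (z - cnj l)"
      have "cmod (csinc ?u) \<le> C * exp \<bar>Im ?u\<bar> / (1 + cmod ?u)" by (rule C(2))
      also have "\<dots> \<le> C * exp \<bar>Im ?u\<bar> / 1" using C(1) by (intro divide_left_mono) (auto simp: add_pos_nonneg)
      also have "\<dots> \<le> C * exp (pi * \<bar>Im l\<bar> + pi * \<bar>Im z\<bar>)"
      proof -
        have "\<bar>Im ?u\<bar> = pi * \<bar>Im z + Im l\<bar>" by (simp add: abs_mult)
        also have "\<dots> \<le> pi * (\<bar>Im l\<bar> + \<bar>Im z\<bar>)" by (intro mult_left_mono) auto
        finally show ?thesis using C(1) by (simp add: algebra_simps)
      qed
      finally show ?thesis by (simp add: exp_add)
    qed
  qed (rule D)
qed

lemma pw_inner_kernel: "f \<in> PW \<Longrightarrow> pw_inner f (pw_kernel l) = f l"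
  unfolding pw_inner_def pw_kernel_csinc cnj_csinc using PW_reproducing[of f l] by simp

lemma pw_norm_nonneg: "pw_norm f \<ge> 0"
  by (simp add: pw_norm_def integral_nonneg_AE)

lemma pw_norm_sq: "(pw_norm f)\<^sup>2 = (LINT x|lborel. (cmod (f (of_real x)))\<^sup>2)"
  by (simp add: pw_norm_def integral_nonneg_AE)

lemma pw_inner_integrable:
  "f \<in> PW \<Longrightarrow> g \<in> PW \<Longrightarrow> integrable lborel (\<lambda>x. f (of_real x) * cnj (g (of_real x)))"
  by (intro square_integrable_mult square_integrable_cnj PW_square_integrable)

lemma pw_inner_add_left:
  "f \<in> PW \<Longrightarrow> g \<in> PW \<Longrightarrow> h \<in> PW \<Longrightarrow> pw_inner (\<lambda>z. f z + g z) h = pw_inner f h + pw_inner g h"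
  unfolding pw_inner_def by (simp add: distrib_right pw_inner_integrable)

lemma pw_inner_diff_left:
  "f \<in> PW \<Longrightarrow> g \<in> PW \<Longrightarrow> h \<in> PW \<Longrightarrow> pw_inner (\<lambda>z. f z - g z) h = pw_inner f h - pw_inner g h"
  unfolding pw_inner_def by (simp add: left_diff_distrib pw_inner_integrable)

lemma pw_inner_cmult_left: "pw_inner (\<lambda>z. c * f z) h = c * pw_inner f h"
  unfolding pw_inner_def by (simp add: mult.assoc)

lemma pw_inner_commute: "pw_inner g f = cnj (pw_inner f g)"
  unfolding pw_inner_def by (subst Bochner_Integration.integral_cnj[symmetric]) (simp add: mult.commute)

lemma pw_inner_self: "pw_inner f f = of_real ((pw_norm f)\<^sup>2)"
  unfolding pw_inner_def pw_norm_sq integral_complex_of_real[symmetric]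
  by (simp add: complex_norm_square[symmetric] del: of_real_power)

lemma pw_Cauchy_Schwarz: "f \<in> PW \<Longrightarrow> g \<in> PW \<Longrightarrow> cmod (pw_inner f g) \<le> pw_norm f * pw_norm g"
  unfolding pw_inner_def pw_norm_def
  using square_integrable_Cauchy_Schwarz_norm[OF PW_square_integrable square_integrable_cnj[OF PW_square_integrable]]
  by simp

lemma pw_norm_sq_add:
  assumes "f \<in> PW" "g \<in> PW"
  shows "(pw_norm (\<lambda>z. f z + g z))\<^sup>2 = (pw_norm f)\<^sup>2 + 2 * Re (pw_inner f g) + (pw_norm g)\<^sup>2"
proof -
  note fg = PW_add[OF assms]
  have "complex_of_real ((pw_norm (\<lambda>z. f z + g z))\<^sup>2) = pw_inner (\<lambda>z. f z + g z) (\<lambda>z. f z + g z)"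
    by (rule pw_inner_self[symmetric])
  also have "\<dots> = pw_inner f (\<lambda>z. f z + g z) + pw_inner g (\<lambda>z. f z + g z)"
    by (rule pw_inner_add_left) (use assms fg in auto)
  also have "pw_inner f (\<lambda>z. f z + g z) = pw_inner f f + pw_inner f g"
    using assms by (subst (1 2 3) pw_inner_commute) (simp add: pw_inner_add_left)
  also have "pw_inner g (\<lambda>z. f z + g z) = cnj (pw_inner f g) + pw_inner g g"
    using assms by (subst (1 3) pw_inner_commute) (simp add: pw_inner_add_left pw_inner_commute[of g f])
  finally have "complex_of_real ((pw_norm (\<lambda>z. f z + g z))\<^sup>2) =
     pw_inner f f + pw_inner f g + (cnj (pw_inner f g) + pw_inner g g)" .
  then have "Re (complex_of_real ((pw_norm (\<lambda>z. f z + g z))\<^sup>2)) =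
     Re (pw_inner f f + pw_inner f g + (cnj (pw_inner f g) + pw_inner g g))" by (rule arg_cong)
  then show ?thesis unfolding pw_inner_self by (simp del: of_real_power)
qed

lemma pw_norm_cmult: "pw_norm (\<lambda>z. c * f z) = cmod c * pw_norm f"
  unfolding pw_norm_def by (simp add: norm_mult power_mult_distrib real_sqrt_mult)

lemma pw_norm_sq_diff:
  assumes "f \<in> PW" "g \<in> PW"
  shows "(pw_norm (\<lambda>z. f z - g z))\<^sup>2 = (pw_norm f)\<^sup>2 - 2 * Re (pw_inner f g) + (pw_norm g)\<^sup>2"
proof -
  have "pw_inner f (\<lambda>z. (-1) * g z) = - pw_inner f g"
    using pw_inner_cmult_left[of "-1" g f] by (subst (1 2) pw_inner_commute) (metis complex_cnj_minus mult_minus1)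
  then show ?thesis
    using pw_norm_sq_add[OF assms(1) PW_cmult[OF assms(2), of "-1"]] pw_norm_cmult[of "-1" g] by simp
qed

lemma pw_norm_triangle:
  assumes "f \<in> PW" "g \<in> PW"
  shows "pw_norm (\<lambda>z. f z + g z) \<le> pw_norm f + pw_norm g"
proof (rule power2_le_imp_le)
  have "Re (pw_inner f g) \<le> pw_norm f * pw_norm g"
    using pw_Cauchy_Schwarz[OF assms] complex_Re_le_cmod order_trans by blast
  then show "(pw_norm (\<lambda>z. f z + g z))\<^sup>2 \<le> (pw_norm f + pw_norm g)\<^sup>2"
    unfolding pw_norm_sq_add[OF assms] by (simp add: power2_sum)
qed (simp add: pw_norm_nonneg)

lemma PW_norm_eq_0:
  assumes "f \<in> PW" "pw_norm f = 0"
  shows "f z = 0"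
  using PW_point_bound assms by (metis mult_zero_right norm_le_zero_iff)

text \<open>Made for quotients by a linear factor, which are dominated only outside a bounded
  interval; inside, compactness supplies a constant.\<close>

lemma square_integrable_locally:
  assumes h: "h holomorphic_on UNIV" and v: "square_integrable v"
    and le: "\<And>x. \<bar>x\<bar> > R \<Longrightarrow> cmod (h (of_real x)) \<le> cmod (v x)"
  shows "square_integrable (\<lambda>x. h (of_real x))"
proof -
  have "compact (h ` cball 0 \<bar>R\<bar>)"
    by (intro compact_continuous_image holomorphic_on_imp_continuous_on holomorphic_on_subset[OF h]) auto
  then obtain B where B: "\<And>z. z \<in> cball 0 \<bar>R\<bar> \<Longrightarrow> cmod (h z) \<le> B"
    by (metis bounded_iff compact_imp_bounded imageI)
  have B0: "B \<ge> 0" using order_trans[OF norm_ge_zero B[of 0]] by simp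
  \<comment> \<open>At least \<open>B\<close> on \<open>[-|R|, |R|]\<close>, yet of order
    \<open>1 / |x|\<close> at infinity and hence square integrable.\<close>
  define c where "c = (\<lambda>x::real. complex_of_real (B * sqrt (1 + R\<^sup>2) / sqrt (1 + x\<^sup>2)))"
  note [measurable] = square_integrable_measurable[OF v]
  have c: "square_integrable c" unfolding c_def
    using B0 by (intro square_integrable_by_decay(1)[where B = "B * sqrt (1 + R\<^sup>2)"]) (auto simp: norm_mult norm_divide)
  have v': "square_integrable (\<lambda>x. complex_of_real (cmod (v x)))"
    by (rule square_integrable_bound[OF v, of _ 1]) auto
  show ?thesis
  proof (rule square_integrable_bound[OF square_integrable_add[OF v' c], of _ 1])
    show "(\<lambda>x. h (complex_of_real x)) \<in> borel_measurable borel" using entire_measurable[OF h] .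
    fix x :: real
    have cx: "Re (c x) \<ge> 0" "c x = of_real (Re (c x))" unfolding c_def using B0 by auto
    have "cmod (of_real (cmod (v x)) + c x) = cmod (v x) + Re (c x)"
      using cx(1) by (subst cx(2)) (simp flip: of_real_add del: of_real_add)
    moreover have "cmod (h (of_real x)) \<le> cmod (v x) + Re (c x)"
    proof (cases "\<bar>x\<bar> > R")
      case True
      then show ?thesis using le[OF True] cx(1) by linarith
    next
      case False
      then have "\<bar>x\<bar> \<le> \<bar>R\<bar>" by linarith
      then have "x\<^sup>2 \<le> R\<^sup>2" by (metis power2_abs power2_le_iff_abs_le abs_ge_zero)
      then have "sqrt (1 + x\<^sup>2) \<le> sqrt (1 + R\<^sup>2)" by simp
      moreover have "sqrt (1 + x\<^sup>2) > 0" by (simp add: add_pos_nonneg)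
      ultimately have "B * 1 \<le> B * (sqrt (1 + R\<^sup>2) / sqrt (1 + x\<^sup>2))" using B0 by (intro mult_left_mono) auto
      then have "B \<le> Re (c x)" unfolding c_def by simp
      moreover have "cmod (h (of_real x)) \<le> B" using \<open>\<bar>x\<bar> \<le> \<bar>R\<bar>\<close> by (intro B) simp
      ultimately show ?thesis by (smt (verit) norm_ge_zero)
    qed
    ultimately show "cmod (h (of_real x)) \<le> 1 * cmod (of_real (cmod (v x)) + c x)" by simp
  qed
qed

lemma PW_divide:
  assumes f: "f \<in> PW" and h: "h holomorphic_on UNIV" and eq: "\<And>z. f z = (z - w) * h z"
  shows "h \<in> PW"
  unfolding PW_iff
proof (intro conjI h exp_type_divide[OF _ h eq] square_integrable_locally[OF h PW_square_integrable[OF f]])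
  show "exp_type_le_pi f" using f by (simp add: PW_def)
  fix x :: real assume "\<bar>x\<bar> > cmod w + 1"
  then have "1 \<le> cmod (of_real x - w)" using norm_triangle_ineq2[of "of_real x" w] by simp
  then show "cmod (h (of_real x)) \<le> cmod (f (of_real x))" unfolding eq norm_mult
    by (metis mult_le_cancel_right1 norm_ge_zero not_le)
qed

text \<open>A function bounded on the line need not be square integrable, but division by one of its
  zeros gains the missing factor \<open>1 / |x|\<close>. This is the situation of the extension
  \<open>D\<close>, for which boundedness on the line is what the estimates give.\<close>

lemma PW_divide_bounded:
  assumes D: "\<And>z. cmod (D z) \<le> K * exp (pi * \<bar>Im z\<bar>)" and h: "h holomorphic_on UNIV"
    and eq: "\<And>z. D z = (z - w) * h z"
  shows "h \<in> PW"
  unfolding PW_iff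
proof (intro conjI h exp_type_divide[OF _ h eq])
  show "exp_type_le_pi D" by (rule exp_type_of_bound[OF D])
  have K: "K \<ge> 0" using order_trans[OF norm_ge_zero D[of 0]] by simp
  define v where "v = (\<lambda>x::real. complex_of_real (4 * K / sqrt (1 + x\<^sup>2)))"
  show "square_integrable (\<lambda>x. h (of_real x))"
  proof (rule square_integrable_locally[OF h])
    show "square_integrable v" unfolding v_def
      using K by (intro square_integrable_by_decay(1)[where B = "4 * K"]) (auto simp: norm_mult norm_divide)
    fix x :: real assume x: "\<bar>x\<bar> > 2 * cmod w + 1"
    have d: "\<bar>x\<bar> / 2 \<le> cmod (of_real x - w)" using norm_triangle_ineq2[of "of_real x" w] x by simp
    have "\<bar>x\<bar> > 1" using x norm_ge_zero[of w] by linarith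
    have "sqrt (1 + x\<^sup>2) \<le> 1 + \<bar>x\<bar>" by (rule real_le_lsqrt) (auto simp: power2_sum)
    also have "\<dots> \<le> 4 * cmod (of_real x - w)" using d \<open>\<bar>x\<bar> > 1\<close> by linarith
    finally have s: "sqrt (1 + x\<^sup>2) \<le> 4 * cmod (of_real x - w)" .
    have s0: "sqrt (1 + x\<^sup>2) > 0" by (simp add: add_pos_nonneg)
    have "cmod (h (of_real x)) * sqrt (1 + x\<^sup>2) \<le> cmod (h (of_real x)) * (4 * cmod (of_real x - w))"
      using s by (intro mult_left_mono) auto
    also have "\<dots> = 4 * cmod (D (of_real x))" unfolding eq norm_mult by simp
    also have "\<dots> \<le> 4 * K" using D[of "of_real x"] by simp
    finally have "cmod (h (of_real x)) \<le> 4 * K / sqrt (1 + x\<^sup>2)" using s0 by (simp add: pos_le_divide_eq)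
    then show "cmod (h (of_real x)) \<le> cmod (v x)" unfolding v_def using K s0 by (simp add: norm_mult norm_divide)
  qed
qed

text \<open>The point bound turns a norm-Cauchy sequence into a locally uniformly convergent one, so
  the limit is entire with the right growth. Fatou's lemma along the sequence makes the difference
  square integrable and yields norm convergence.\<close>

lemma PW_complete:
  assumes u: "\<And>n. u n \<in> PW" and cau: "\<And>e. e > 0 \<Longrightarrow> \<exists>N. \<forall>m\<ge>N. \<forall>n\<ge>N. pw_norm (\<lambda>z. u m z - u n z) \<le> e"
  obtains f where "f \<in> PW" "(\<lambda>n. pw_norm (\<lambda>z. u n z - f z)) \<longlonglongrightarrow> 0"
proof -
  obtain C where C: "C > 0" "\<And>f w. f \<in> PW \<Longrightarrow> cmod (f w) \<le> C * exp (pi * \<bar>Im w\<bar>) * pw_norm f"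
    using PW_point_bound by blast
  have pt: "cmod (u m z - u n z) \<le> C * exp (pi * \<bar>Im z\<bar>) * pw_norm (\<lambda>z. u m z - u n z)" for m n z
    using C(2)[OF PW_diff[OF u[of m] u[of n]]] .
  have "Cauchy (\<lambda>n. u n z)" for z
  proof (rule metric_CauchyI)
    fix e :: real assume e: "e > 0"
    define B where "B = C * exp (pi * \<bar>Im z\<bar>)"
    have B: "B > 0" unfolding B_def using C(1) by simp
    obtain N where N: "\<And>m n. m \<ge> N \<Longrightarrow> n \<ge> N \<Longrightarrow> pw_norm (\<lambda>z. u m z - u n z) \<le> e / (2 * B)"
      using cau[of "e / (2 * B)"] e B by auto
    have "dist (u m z) (u n z) < e" if "m \<ge> N" "n \<ge> N" for m n
    proof -
      have "cmod (u m z - u n z) \<le> B * (e / (2 * B))"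
        using order_trans[OF pt[of m z n, folded B_def] mult_left_mono[OF N[OF that]]] B by simp
      also have "\<dots> < e" using B e by simp
      finally show ?thesis by (simp add: dist_norm)
    qed
    then show "\<exists>M. \<forall>m\<ge>M. \<forall>n\<ge>M. dist (u m z) (u n z) < e" by blast
  qed
  then have conv: "convergent (\<lambda>n. u n z)" for z by (rule Cauchy_convergent)
  define f where "f = (\<lambda>z. lim (\<lambda>n. u n z))"
  have lim: "(\<lambda>n. u n z) \<longlonglongrightarrow> f z" for z
    unfolding f_def using conv[of z] by (simp add: convergent_LIMSEQ_iff)
  have unif: "cmod (u n z - f z) \<le> C * exp (pi * \<bar>Im z\<bar>) * e"
    if N: "\<And>m n. m \<ge> N \<Longrightarrow> n \<ge> N \<Longrightarrow> pw_norm (\<lambda>z. u m z - u n z) \<le> e" "n \<ge> N" for n z e N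
  proof (rule tendsto_upperbound)
    show "(\<lambda>m. cmod (u n z - u m z)) \<longlonglongrightarrow> cmod (u n z - f z)" by (intro tendsto_intros lim)
    have "cmod (u n z - u m z) \<le> C * exp (pi * \<bar>Im z\<bar>) * e" if "m \<ge> N" for m
      using order_trans[OF pt[of n z m] mult_left_mono[OF N(1)[OF N(2) that]]] C(1) by simp
    then show "\<forall>\<^sub>F m in sequentially. cmod (u n z - u m z) \<le> C * exp (pi * \<bar>Im z\<bar>) * e"
      unfolding eventually_sequentially by blast
  qed simp
  have holf: "f holomorphic_on UNIV"
  proof (rule holomorphic_uniform_sequence[OF open_UNIV, of u])
    show "u n holomorphic_on UNIV" for n by (rule PW_entire[OF u])
    fix z :: complex
    have "uniform_limit (cball z 1) u f sequentially"
      unfolding uniform_limit_iff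
    proof (intro allI impI)
      fix e :: real assume e: "e > 0"
      define B where "B = C * exp (pi * (cmod z + 1))"
      have B: "B > 0" unfolding B_def using C(1) by simp
      obtain N where N: "\<And>m n. m \<ge> N \<Longrightarrow> n \<ge> N \<Longrightarrow> pw_norm (\<lambda>z. u m z - u n z) \<le> e / (2 * B)"
        using cau[of "e / (2 * B)"] e B by auto
      have "dist (u n w) (f w) < e" if n: "n \<ge> N" and w: "w \<in> cball z 1" for n w
      proof -
        have "cmod w \<le> cmod z + 1" using w norm_triangle_ineq2[of w z] by (simp add: dist_norm norm_minus_commute)
        then have "\<bar>Im w\<bar> \<le> cmod z + 1" using abs_Im_le_cmod[of w] by linarith
        then have "C * exp (pi * \<bar>Im w\<bar>) \<le> B" unfolding B_def using C(1) by simp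
        then have "C * exp (pi * \<bar>Im w\<bar>) * (e / (2 * B)) \<le> B * (e / (2 * B))"
          using e B by (intro mult_right_mono) auto
        also have "\<dots> < e" using B e by simp
        finally show ?thesis using unif[OF N n, where z = w] by (simp add: dist_norm)
      qed
      then show "\<forall>\<^sub>F n in sequentially. \<forall>w\<in>cball z 1. dist (u n w) (f w) < e"
        unfolding eventually_sequentially by blast
    qed
    then show "\<exists>d>0. cball z d \<subseteq> UNIV \<and> uniform_limit (cball z d) u f sequentially" by (intro exI[of _ 1]) auto
  qed
  have L2: "square_integrable (\<lambda>x. u n (of_real x) - f (of_real x)) \<and> pw_norm (\<lambda>z. u n z - f z) \<le> e"
    if N: "\<And>m n. m \<ge> N \<Longrightarrow> n \<ge> N \<Longrightarrow> pw_norm (\<lambda>z. u m z - u n z) \<le> e" "n \<ge> N" for n e N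
  proof -
    have e0: "e \<ge> 0" using N(1)[OF N(2) N(2)] pw_norm_nonneg order_trans by blast
    have [measurable]: "(\<lambda>x. u m (complex_of_real x)) \<in> borel_measurable borel" for m using entire_measurable[OF PW_entire[OF u]] .
    have [measurable]: "(\<lambda>x. f (complex_of_real x)) \<in> borel_measurable borel" using entire_measurable[OF holf] .
    let ?g = "\<lambda>m x. ennreal ((cmod (u n (of_real x) - u m (of_real x)))\<^sup>2)"
    have "(\<integral>\<^sup>+ x. ennreal ((cmod (u n (of_real x) - f (of_real x)))\<^sup>2) \<partial>lborel) = (\<integral>\<^sup>+ x. liminf (\<lambda>m. ?g m x) \<partial>lborel)"
    proof (intro nn_integral_cong)
      fix x :: real
      have "(\<lambda>m. ?g m x) \<longlonglongrightarrow> ennreal ((cmod (u n (of_real x) - f (of_real x)))\<^sup>2)"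
        by (intro tendsto_intros tendsto_ennrealI lim)
      then show "ennreal ((cmod (u n (of_real x) - f (of_real x)))\<^sup>2) = liminf (\<lambda>m. ?g m x)"
        by (intro lim_imp_Liminf[symmetric]) auto
    qed
    also have "\<dots> \<le> liminf (\<lambda>m. \<integral>\<^sup>+ x. ?g m x \<partial>lborel)" by (rule nn_integral_liminf) measurable
    also have "\<dots> \<le> ennreal (e\<^sup>2)"
    proof (rule Liminf_le)
      have "(\<integral>\<^sup>+ x. ?g m x \<partial>lborel) \<le> ennreal (e\<^sup>2)" if m: "m \<ge> N" for m
      proof -
        have "(\<integral>\<^sup>+ x. ?g m x \<partial>lborel) = ennreal ((pw_norm (\<lambda>z. u n z - u m z))\<^sup>2)"
          unfolding pw_norm_sq
          by (rule nn_integral_eq_integral) (use square_integrableD[OF PW_square_integrable[OF PW_diff[OF u[of n] u[of m]]]] in auto)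
        also have "\<dots> \<le> ennreal (e\<^sup>2)" using N(1)[OF N(2) m] pw_norm_nonneg by (intro ennreal_leI power_mono) auto
        finally show ?thesis .
      qed
      then show "\<forall>\<^sub>F m in sequentially. (\<integral>\<^sup>+ x. ?g m x \<partial>lborel) \<le> ennreal (e\<^sup>2)"
        unfolding eventually_sequentially by blast
    qed auto
    finally have nn: "(\<integral>\<^sup>+ x. ennreal ((cmod (u n (of_real x) - f (of_real x)))\<^sup>2) \<partial>lborel) \<le> ennreal (e\<^sup>2)" .
    have i: "integrable lborel (\<lambda>x. (cmod (u n (of_real x) - f (of_real x)))\<^sup>2)"
      by (rule integrableI_bounded) (use nn in \<open>auto simp: le_less_trans\<close>)
    have "ennreal (LINT x|lborel. (cmod (u n (of_real x) - f (of_real x)))\<^sup>2) \<le> ennreal (e\<^sup>2)"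
      using nn nn_integral_eq_integral[OF i] by simp
    then have "(pw_norm (\<lambda>z. u n z - f z))\<^sup>2 \<le> e\<^sup>2" unfolding pw_norm_sq by (simp add: ennreal_le_iff)
    then have "pw_norm (\<lambda>z. u n z - f z) \<le> e" using e0 by (rule power2_le_imp_le)
    moreover have "square_integrable (\<lambda>x. u n (of_real x) - f (of_real x))"
      unfolding square_integrable_def using i by simp
    ultimately show ?thesis by blast
  qed
  obtain N1 where N1: "\<And>m n. m \<ge> N1 \<Longrightarrow> n \<ge> N1 \<Longrightarrow> pw_norm (\<lambda>z. u m z - u n z) \<le> 1"
    using cau[of 1] by auto
  obtain K where K: "\<And>z. cmod (u N1 z) \<le> K * exp (pi * \<bar>Im z\<bar>)" using PW_bound[OF u] by blast
  have fPW: "f \<in> PW"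
  proof (rule PW_I[where K = "K + C"])
    have u1: "cmod (u N1 z - f z) \<le> C * exp (pi * \<bar>Im z\<bar>) * 1" for z
      by (rule unif[where N = N1]) (use N1 in auto)
    show "cmod (f z) \<le> (K + C) * exp (pi * \<bar>Im z\<bar>)" for z
      using u1[of z] K[of z] norm_triangle_ineq2[of "f z" "u N1 z"] by (simp add: norm_minus_commute algebra_simps)
    have "square_integrable (\<lambda>x. u N1 (of_real x) + (-1) * (u N1 (of_real x) - f (of_real x)))"
      using L2[OF N1 order_refl] PW_square_integrable[OF u[of N1]] by (intro square_integrable_add square_integrable_cmult) auto
    then show "square_integrable (\<lambda>x. f (of_real x))" by simp
  qed (rule holf)
  moreover have "(\<lambda>n. pw_norm (\<lambda>z. u n z - f z)) \<longlonglongrightarrow> 0"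
  proof (rule LIMSEQ_I)
    fix e :: real assume e: "e > 0"
    obtain N where N: "\<And>m n. m \<ge> N \<Longrightarrow> n \<ge> N \<Longrightarrow> pw_norm (\<lambda>z. u m z - u n z) \<le> e / 2"
      using cau[of "e / 2"] e by auto
    have "pw_norm (\<lambda>z. u n z - f z) < e" if "n \<ge> N" for n using L2[OF N that] e by linarith
    then show "\<exists>no. \<forall>n\<ge>no. norm (pw_norm (\<lambda>z. u n z - f z) - 0) < e" using pw_norm_nonneg by auto
  qed
  ultimately show ?thesis using that by blast
qed

section \<open>Linear combinations and the orthogonal complement\<close>

lemma lin_comb_PW: "(\<And>i. i \<in> I \<Longrightarrow> F i \<in> PW) \<Longrightarrow> h \<in> lin_comb F I \<Longrightarrow> h \<in> PW"
  unfolding lin_comb_def by (auto intro!: PW_sum PW_cmult)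

lemma lin_comb_0: "(\<lambda>z. 0) \<in> lin_comb F I"
  unfolding lin_comb_def by (auto intro!: exI[of _ "{}"])

lemma lin_comb_single: "i \<in> I \<Longrightarrow> (\<lambda>z. c * F i z) \<in> lin_comb F I"
  unfolding lin_comb_def by (auto intro!: exI[of _ "{i}"] exI[of _ "\<lambda>_. c"])

lemma lin_comb_cmult: "h \<in> lin_comb F I \<Longrightarrow> (\<lambda>z. a * h z) \<in> lin_comb F I"
proof -
  assume "h \<in> lin_comb F I"
  then obtain J c where J: "finite J" "J \<subseteq> I" "h = (\<lambda>z. \<Sum>j\<in>J. c j * F j z)" unfolding lin_comb_def by auto
  then have "(\<lambda>z. a * h z) = (\<lambda>z. \<Sum>j\<in>J. (a * c j) * F j z)" by (simp add: sum_distrib_left mult.assoc)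
  then show ?thesis using J(1,2) unfolding lin_comb_def
    by (intro CollectI exI[of _ J] exI[of _ "\<lambda>j. a * c j"]) auto
qed

lemma lin_comb_add:
  assumes "h \<in> lin_comb F I" "k \<in> lin_comb F I"
  shows "(\<lambda>z. h z + k z) \<in> lin_comb F I"
proof -
  obtain J c where J: "finite J" "J \<subseteq> I" "h = (\<lambda>z. \<Sum>j\<in>J. c j * F j z)"
    using assms(1) unfolding lin_comb_def by auto
  obtain L d where L: "finite L" "L \<subseteq> I" "k = (\<lambda>z. \<Sum>j\<in>L. d j * F j z)"
    using assms(2) unfolding lin_comb_def by auto
  define c' d' where "c' = (\<lambda>j. if j \<in> J then c j else 0)" and "d' = (\<lambda>j. if j \<in> L then d j else 0)"
  have "h z + k z = (\<Sum>j\<in>J \<union> L. (c' j + d' j) * F j z)" for z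
  proof -
    have "h z = (\<Sum>j\<in>J \<union> L. c' j * F j z)" unfolding J(3)
      by (rule sum.mono_neutral_cong_left) (auto simp: c'_def J L)
    moreover have "k z = (\<Sum>j\<in>J \<union> L. d' j * F j z)" unfolding L(3)
      by (rule sum.mono_neutral_cong_left) (auto simp: d'_def J L)
    ultimately show ?thesis by (simp add: distrib_right sum.distrib)
  qed
  then show ?thesis using J L unfolding lin_comb_def
    by (intro CollectI exI[of _ "J \<union> L"] exI[of _ "\<lambda>j. c' j + d' j"]) auto
qed

lemma pw_parallelogram:
  assumes "f \<in> PW" "g \<in> PW"
  shows "(pw_norm (\<lambda>z. f z - g z))\<^sup>2 = 2 * (pw_norm f)\<^sup>2 + 2 * (pw_norm g)\<^sup>2 - (pw_norm (\<lambda>z. f z + g z))\<^sup>2"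
  using pw_norm_sq_add[OF assms] pw_norm_sq_diff[OF assms] by simp

text \<open>The projection theorem for the closed span: the residuals of a minimising sequence form
  a Cauchy sequence by the parallelogram law, and their limit \<open>f\<close> has norm at least the
  distance \<open>e\<close>. Orthogonality is the first variation of the minimum in the direction
  \<open>F i\<close>.\<close>

lemma orthogonal_if_not_complete:
  assumes F: "\<And>i. i \<in> I \<Longrightarrow> F i \<in> PW" and nc: "\<not> complete_PW F I"
  obtains f where "f \<in> PW" "pw_norm f > 0" "\<And>i. i \<in> I \<Longrightarrow> pw_inner f (F i) = 0"
proof -
  obtain h e where h: "h \<in> PW" "e > 0" "\<And>v. v \<in> lin_comb F I \<Longrightarrow> pw_norm (\<lambda>z. h z - v z) \<ge> e"
    using nc unfolding complete_PW_def by (meson not_le)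
  define V where "V = lin_comb F I"
  have VPW: "v \<in> PW" if "v \<in> V" for v
    by (rule lin_comb_PW[of I F]) (use F that in \<open>simp_all add: V_def\<close>)
  define D where "D = (\<lambda>v. (pw_norm (\<lambda>z. h z - v z))\<^sup>2) ` V"
  define d where "d = Inf D"
  have Dne: "D \<noteq> {}" unfolding D_def V_def using lin_comb_0 by blast
  have bdd: "bdd_below D" unfolding D_def by (rule bdd_belowI[of _ 0]) auto
  have dle: "d \<le> (pw_norm (\<lambda>z. h z - v z))\<^sup>2" if "v \<in> V" for v
    unfolding d_def using bdd that by (intro cInf_lower) (auto simp: D_def)
  have "\<exists>v\<in>V. (pw_norm (\<lambda>z. h z - v z))\<^sup>2 < d + inverse (real (Suc n))" for n
  proof -
    have "Inf D < d + inverse (real (Suc n))" unfolding d_def by simp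
    then show ?thesis using cInf_lessD[OF Dne] unfolding D_def by blast
  qed
  then obtain v where v: "\<And>n. v n \<in> V" "\<And>n. (pw_norm (\<lambda>z. h z - v n z))\<^sup>2 < d + inverse (real (Suc n))" by metis
  define u where "u = (\<lambda>n z. h z - v n z)"
  have u: "u n \<in> PW" for n unfolding u_def by (intro PW_diff h VPW v)
  have un: "(pw_norm (u n))\<^sup>2 < d + inverse (real (Suc n))" for n using v(2) unfolding u_def .
  have uc: "(pw_norm (\<lambda>z. u m z - u n z))\<^sup>2 \<le> 2 * inverse (real (Suc m)) + 2 * inverse (real (Suc n))" for m n
  proof -
    \<comment> \<open>The midpoint of two approximants is again admissible, so the sum of two
      residuals has squared norm at least \<open>4 * d\<close> and the parallelogram law makes their
      difference small.\<close>
    have mid: "(\<lambda>z. (1/2) * (v m z + v n z)) \<in> V"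
      using v(1)[of m] v(1)[of n] unfolding V_def by (intro lin_comb_cmult lin_comb_add)
    have eq: "(\<lambda>z. u m z + u n z) = (\<lambda>z. 2 * (h z - (1/2) * (v m z + v n z)))" unfolding u_def by (auto simp: algebra_simps)
    have "4 * d \<le> 4 * (pw_norm (\<lambda>z. h z - (1/2) * (v m z + v n z)))\<^sup>2" using dle[OF mid] by simp
    also have "\<dots> = (pw_norm (\<lambda>z. u m z + u n z))\<^sup>2" unfolding eq pw_norm_cmult by (simp add: power_mult_distrib)
    finally show ?thesis using pw_parallelogram[OF u[of m] u[of n]] un[of m] un[of n] by linarith
  qed
  obtain f where f: "f \<in> PW" "(\<lambda>n. pw_norm (\<lambda>z. u n z - f z)) \<longlonglongrightarrow> 0"
  proof (rule PW_complete[OF u])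
    fix e :: real assume e: "e > 0"
    obtain N where N: "inverse (real (Suc N)) < e\<^sup>2 / 4" using reals_Archimedean[of "e\<^sup>2 / 4"] e by auto
    have "pw_norm (\<lambda>z. u m z - u n z) \<le> e" if "m \<ge> N" "n \<ge> N" for m n
    proof (rule power2_le_imp_le)
      have "inverse (real (Suc m)) \<le> inverse (real (Suc N))" "inverse (real (Suc n)) \<le> inverse (real (Suc N))"
        using that by (auto intro!: le_imp_inverse_le)
      then show "(pw_norm (\<lambda>z. u m z - u n z))\<^sup>2 \<le> e\<^sup>2" using uc[of m n] N by linarith
    qed (use e in auto)
    then show "\<exists>N. \<forall>m\<ge>N. \<forall>n\<ge>N. pw_norm (\<lambda>z. u m z - u n z) \<le> e" by blast
  qed
  have fpos: "pw_norm f > 0"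
  proof -
    have "e \<le> pw_norm (\<lambda>z. u n z - f z) + pw_norm f" for n
      using h(3)[OF v(1)[of n, unfolded V_def]] pw_norm_triangle[OF PW_diff[OF u[of n] f(1)] f(1)] unfolding u_def by simp
    then have "e \<le> 0 + pw_norm f"
      by (intro LIMSEQ_le_const[OF tendsto_add[OF f(2) tendsto_const]]) auto
    then show ?thesis using h(2) by simp
  qed
  have orth: "pw_inner f (F i) = 0" if i: "i \<in> I" for i
  proof -
    define a where "a = pw_inner f (F i)"
    \<comment> \<open>A near-optimal step along \<open>F i\<close>; the summand 1 avoids division by
      a vanishing norm and still gives a contradiction unless \<open>a\<close> is 0.\<close>
    define c where "c = of_real (1 / ((pw_norm (F i))\<^sup>2 + 1)) * a"
    have cF: "(\<lambda>z. c * F i z) \<in> PW" using F[OF i] by (rule PW_cmult)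
    have "2 * Re (pw_inner (u n) (\<lambda>z. c * F i z)) \<le> (pw_norm (\<lambda>z. c * F i z))\<^sup>2 + inverse (real (Suc n))" for n
    proof -
      have "(\<lambda>z. v n z + c * F i z) \<in> V" using v(1)[of n] unfolding V_def by (intro lin_comb_add lin_comb_single i)
      from dle[OF this] have "d \<le> (pw_norm (\<lambda>z. u n z - c * F i z))\<^sup>2" unfolding u_def by (simp add: algebra_simps)
      then show ?thesis using pw_norm_sq_diff[OF u[of n] cF] un[of n] by linarith
    qed
    moreover have "(\<lambda>n. pw_inner (u n) (\<lambda>z. c * F i z)) \<longlonglongrightarrow> pw_inner f (\<lambda>z. c * F i z)"
    proof (rule LIM_zero_cancel, rule Lim_null_comparison)
      show "(\<lambda>n. pw_norm (\<lambda>z. u n z - f z) * pw_norm (\<lambda>z. c * F i z)) \<longlonglongrightarrow> 0"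
        using tendsto_mult[OF f(2) tendsto_const[of "pw_norm (\<lambda>z. c * F i z)"]] by simp
      show "\<forall>\<^sub>F n in sequentially. norm (pw_inner (u n) (\<lambda>z. c * F i z) - pw_inner f (\<lambda>z. c * F i z))
          \<le> pw_norm (\<lambda>z. u n z - f z) * pw_norm (\<lambda>z. c * F i z)"
        using pw_Cauchy_Schwarz[OF PW_diff[OF u f(1)] cF] pw_inner_diff_left[OF u f(1) cF] by (auto intro!: always_eventually)
    qed
    moreover have "(\<lambda>n. (pw_norm (\<lambda>z. c * F i z))\<^sup>2 + inverse (real (Suc n))) \<longlonglongrightarrow> (pw_norm (\<lambda>z. c * F i z))\<^sup>2 + 0"
      by (intro tendsto_add tendsto_const LIMSEQ_inverse_real_of_nat)
    ultimately have "2 * Re (pw_inner f (\<lambda>z. c * F i z)) \<le> (pw_norm (\<lambda>z. c * F i z))\<^sup>2 + 0"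
      by (intro LIMSEQ_le[OF tendsto_mult[OF tendsto_const tendsto_Re]]) auto
    moreover have "pw_inner f (\<lambda>z. c * F i z) = cnj c * a"
      unfolding a_def by (subst (1 2) pw_inner_commute) (simp add: pw_inner_cmult_left)
    moreover have "cnj c * a = of_real ((cmod a)\<^sup>2 / ((pw_norm (F i))\<^sup>2 + 1))"
      unfolding c_def using complex_norm_square[of a] by (simp add: mult.commute)
    ultimately have "2 * ((cmod a)\<^sup>2 / ((pw_norm (F i))\<^sup>2 + 1)) \<le> (pw_norm (\<lambda>z. c * F i z))\<^sup>2"
      by (simp del: of_real_power)
    also have "\<dots> = (cmod c)\<^sup>2 * (pw_norm (F i))\<^sup>2" unfolding pw_norm_cmult by (simp add: power_mult_distrib)
    also have "(cmod c)\<^sup>2 = (cmod a)\<^sup>2 / ((pw_norm (F i))\<^sup>2 + 1)\<^sup>2" unfolding c_def norm_mult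
      by (simp add: power_divide power_mult_distrib add_nonneg_nonneg del: of_real_divide of_real_add)
    finally have q: "2 * ((cmod a)\<^sup>2 / ((pw_norm (F i))\<^sup>2 + 1)) \<le> (cmod a)\<^sup>2 / ((pw_norm (F i))\<^sup>2 + 1)\<^sup>2 * (pw_norm (F i))\<^sup>2" .
    define Q where "Q = (pw_norm (F i))\<^sup>2 + 1"
    have Q: "Q \<ge> 1" unfolding Q_def by simp
    have "2 * ((cmod a)\<^sup>2 / Q) \<le> (cmod a)\<^sup>2 / Q\<^sup>2 * (Q - 1)" using q unfolding Q_def by simp
    then have "2 * (cmod a)\<^sup>2 * Q \<le> (cmod a)\<^sup>2 * (Q - 1)" using Q by (simp add: field_simps power2_eq_square)
    moreover have "(cmod a)\<^sup>2 * (Q - 1) \<le> (cmod a)\<^sup>2 * Q" by (intro mult_left_mono) auto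
    ultimately have "(cmod a)\<^sup>2 * Q \<le> 0" by linarith
    then have "(cmod a)\<^sup>2 \<le> 0" using Q by (simp add: mult_le_0_iff)
    then show ?thesis unfolding a_def by simp
  qed
  show ?thesis by (rule that[OF f(1) fpos orth])
qed

text \<open>By the reproducing property, vanishing on \<open>L\<close> is orthogonality to every
  kernel of the system, and then no combination approximates \<open>f\<close> better than 0
  does.\<close>

lemma complete_kernels_vanishing:
  assumes c: "complete_PW pw_kernel L" and f: "f \<in> PW" and z: "\<And>l. l \<in> L \<Longrightarrow> f l = 0"
  shows "f z = 0"
proof -
  have orth: "pw_inner f h = 0" if hl: "h \<in> lin_comb pw_kernel L" for h
  proof -
    obtain J a where J: "finite J" "J \<subseteq> L" "h = (\<lambda>z. \<Sum>j\<in>J. a j * pw_kernel j z)" using hl unfolding lin_comb_def by auto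
    have "pw_inner (\<lambda>z. \<Sum>j\<in>J. a j * pw_kernel j z) f = 0" using J(1,2)
    proof (induction J rule: finite_induct)
      case empty then show ?case by (simp add: pw_inner_def)
    next
      case (insert j J)
      have "pw_inner (pw_kernel j) f = 0" using pw_inner_kernel[OF f, of j] z insert pw_inner_commute[of "pw_kernel j" f] by simp
      then show ?case using insert pw_inner_add_left[OF PW_cmult[OF pw_kernel_PW] PW_sum[of J "\<lambda>j z. a j * pw_kernel j z"] f, of "a j" j]
        by (simp add: pw_inner_cmult_left PW_cmult pw_kernel_PW)
    qed
    then show ?thesis using J(3) pw_inner_commute[of f h] by simp
  qed
  have "pw_norm f = 0"
  proof (rule ccontr)
    assume "pw_norm f \<noteq> 0"
    then have n: "pw_norm f > 0" using pw_norm_nonneg[of f] by simp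
    obtain h where h: "h \<in> lin_comb pw_kernel L" "pw_norm (\<lambda>z. f z - h z) < pw_norm f"
      using c f n unfolding complete_PW_def by blast
    have hP: "h \<in> PW" using lin_comb_PW[OF pw_kernel_PW h(1)] .
    have "pw_inner (\<lambda>z. f z - h z) f = pw_inner f f"
      using pw_inner_diff_left[OF f hP f] orth[OF h(1)] pw_inner_commute[of h f] by simp
    then have "(pw_norm f)\<^sup>2 \<le> pw_norm (\<lambda>z. f z - h z) * pw_norm f"
      using pw_Cauchy_Schwarz[OF PW_diff[OF f hP] f] unfolding pw_inner_self by (simp del: of_real_power)
    also have "\<dots> < pw_norm f * pw_norm f" using h(2) n by simp
    finally show False by (simp add: power2_eq_square)
  qed
  then show ?thesis by (rule PW_norm_eq_0[OF f])
qed

text \<open>Cauchy's estimate on discs of radius \<open>r/2\<close> dominates the difference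
  quotients at \<open>w0\<close> by \<open>2 \<psi> / r\<close>, so dominated convergence along
  sequences permits differentiation under the integral.\<close>

lemma holomorphic_dominated_integral:
  fixes \<phi> :: "real \<Rightarrow> complex \<Rightarrow> complex"
  assumes S: "open S" and hol: "\<And>x. \<phi> x holomorphic_on S"
    and meas: "\<And>w. w \<in> S \<Longrightarrow> (\<lambda>x. \<phi> x w) \<in> borel_measurable borel"
    and dom: "\<And>w0. w0 \<in> S \<Longrightarrow> \<exists>r>0. \<exists>\<psi>. cball w0 r \<subseteq> S \<and> integrable lborel \<psi> \<and> (\<forall>x. \<forall>w\<in>cball w0 r. cmod (\<phi> x w) \<le> \<psi> x)"
  shows "(\<lambda>w. LINT x|lborel. \<phi> x w) holomorphic_on S"
proof -
  have "\<exists>D. ((\<lambda>w. LINT x|lborel. \<phi> x w) has_field_derivative D) (at w0)" if w0: "w0 \<in> S" for w0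
  proof -
    obtain r \<psi> where r: "r > 0" "cball w0 r \<subseteq> S" "integrable lborel \<psi>" "\<And>x w. w \<in> cball w0 r \<Longrightarrow> cmod (\<phi> x w) \<le> \<psi> x"
      using dom[OF w0] by blast
    have int: "integrable lborel (\<lambda>x. \<phi> x w)" if w: "w \<in> cball w0 r" for w
    proof (rule Bochner_Integration.integrable_bound[OF r(3)])
      show "(\<lambda>x. \<phi> x w) \<in> borel_measurable lborel" using meas[of w] w r(2) by auto
      show "AE x in lborel. norm (\<phi> x w) \<le> norm (\<psi> x)"
        using order_trans[OF r(4)[OF w] abs_ge_self] by (intro AE_I2) simp
    qed
    define q where "q = (\<lambda>w x. (\<phi> x w - \<phi> x w0) / (w - w0))"
    have qb: "cmod (q w x) \<le> 2 * \<psi> x / r" if w: "w \<in> ball w0 (r/2)" "w \<noteq> w0" for w x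
    proof -
      have "cmod (\<phi> x w - \<phi> x w0) \<le> (2 * \<psi> x / r) * cmod (w - w0)"
      proof (rule field_differentiable_bound[where S = "ball w0 (r/2)" and f' = "deriv (\<phi> x)"])
        fix z assume z: "z \<in> ball w0 (r/2)"
        have sub: "y \<in> cball w0 r" if "y \<in> cball z (r/2)" for y
          using dist_triangle[of w0 y z] z that by (simp add: dist_commute)
        have subS: "cball z (r/2) \<subseteq> S" using sub r(2) by blast
        then have zS: "z \<in> S" using r(1) by auto
        show "(\<phi> x has_field_derivative deriv (\<phi> x) z) (at z within ball w0 (r/2))"
          using holomorphic_derivI[OF hol S zS] by (rule has_field_derivative_at_within)
        have "cmod ((deriv ^^ 1) (\<phi> x) z) \<le> fact 1 * \<psi> x / (r/2) ^ 1"
        proof (rule Cauchy_inequality)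
          show "\<phi> x holomorphic_on ball z (r/2)"
            by (rule holomorphic_on_subset[OF hol]) (use subS ball_subset_cball in blast)
          show "continuous_on (cball z (r/2)) (\<phi> x)"
            by (rule holomorphic_on_imp_continuous_on[OF holomorphic_on_subset[OF hol subS]])
          fix y assume "cmod (z - y) = r/2"
          then have "y \<in> cball z (r/2)" by (simp add: dist_norm)
          then show "cmod (\<phi> x y) \<le> \<psi> x" using r(4) sub by blast
        qed (use r in auto)
        then show "cmod (deriv (\<phi> x) z) \<le> 2 * \<psi> x / r" by (simp add: mult.commute)
      qed (use w r in auto)
      then show ?thesis unfolding q_def norm_divide using w by (simp add: divide_le_eq)
    qed
    have "((\<lambda>w. LINT x|lborel. q w x) \<longlongrightarrow> (LINT x|lborel. deriv (\<phi> x) w0)) (at w0)"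
      unfolding tendsto_at_iff_sequentially
    proof (intro allI impI)
      fix X assume X: "\<forall>i. X i \<in> UNIV - {w0}" "X \<longlonglongrightarrow> w0"
      obtain N where N: "\<And>n. n \<ge> N \<Longrightarrow> X n \<in> ball w0 (r/2)"
        using X(2) r(1) unfolding lim_sequentially by (metis half_gt_zero mem_ball dist_commute)
      have Xb: "X (n + N) \<in> ball w0 (r/2)" for n using N by simp
      have XS: "X (n + N) \<in> S" "X (n + N) \<in> cball w0 r" for n
        using Xb[of n] r(1,2) by auto
      have lim: "(\<lambda>n. q (X (n + N)) x) \<longlonglongrightarrow> deriv (\<phi> x) w0" for x
      proof -
        have "((\<lambda>w. q w x) \<longlongrightarrow> deriv (\<phi> x) w0) (at w0)"
          using holomorphic_derivI[OF hol[of x] S w0] unfolding q_def has_field_derivative_iff .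
        then have "((\<lambda>w. q w x) \<circ> X) \<longlonglongrightarrow> deriv (\<phi> x) w0" using X unfolding tendsto_at_iff_sequentially by blast
        then show ?thesis unfolding o_def by (rule LIMSEQ_ignore_initial_segment)
      qed
      have m: "q (X (n + N)) \<in> borel_measurable borel" for n
        using meas[OF XS(1)[of n]] meas[OF w0] unfolding q_def by measurable
      have "(\<lambda>n. LINT x|lborel. q (X (n + N)) x) \<longlonglongrightarrow> (LINT x|lborel. deriv (\<phi> x) w0)"
      proof (rule integral_dominated_convergence[where w = "\<lambda>x. 2 * \<psi> x / r"])
        show "(\<lambda>x. deriv (\<phi> x) w0) \<in> borel_measurable lborel"
          using borel_measurable_LIMSEQ_metric[OF m lim] by simp
        show "integrable lborel (\<lambda>x. 2 * \<psi> x / r)" using r(3) by simp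
        show "AE x in lborel. norm (q (X (n + N)) x) \<le> 2 * \<psi> x / r" for n using qb[OF Xb[of n]] X(1) by auto
      qed (use m lim in auto)
      then show "((\<lambda>w. LINT x|lborel. q w x) \<circ> X) \<longlonglongrightarrow> (LINT x|lborel. deriv (\<phi> x) w0)"
        unfolding o_def by (rule LIMSEQ_offset)
    qed
    moreover have "\<forall>\<^sub>F w in at w0. (LINT x|lborel. q w x) = ((LINT x|lborel. \<phi> x w) - (LINT x|lborel. \<phi> x w0)) / (w - w0)"
      unfolding eventually_at
    proof (intro exI[of _ r] conjI ballI impI r(1))
      fix w assume "w \<in> UNIV" "w \<noteq> w0 \<and> dist w w0 < r"
      then have "w \<in> cball w0 r" "w0 \<in> cball w0 r" using r(1) by (auto simp: dist_commute)
      then show "(LINT x|lborel. q w x) = ((LINT x|lborel. \<phi> x w) - (LINT x|lborel. \<phi> x w0)) / (w - w0)"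
        using int unfolding q_def by simp
    qed
    ultimately have "((\<lambda>w. LINT x|lborel. \<phi> x w) has_field_derivative (LINT x|lborel. deriv (\<phi> x) w0)) (at w0)"
      unfolding has_field_derivative_iff by (rule Lim_transform_eventually)
    then show ?thesis by blast
  qed
  then show ?thesis
    by (metis field_differentiable_def field_differentiable_at_within holomorphic_on_def)
qed

subsection \<open>A function in the orthogonal complement of the mixed system\<close>

text \<open>Biorthogonality enters as interpolation: by the reproducing property it says that
  \<open>g l\<close> is 1 at \<open>l\<close> and 0 at the other nodes. The second node
  \<open>l1\<close> provides a zero of \<open>D\<close> that can be divided out.\<close>

locale mixed_complement =
  fixes L1 L2 :: "complex set" and g :: "complex \<Rightarrow> complex \<Rightarrow> complex"
    and f :: "complex \<Rightarrow> complex" and l0 l1 :: complex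
  assumes complete: "complete_PW pw_kernel (L1 \<union> L2)"
    and g_PW: "\<And>l. l \<in> L1 \<union> L2 \<Longrightarrow> g l \<in> PW"
    and g_val: "\<And>l m. l \<in> L1 \<union> L2 \<Longrightarrow> m \<in> L1 \<union> L2 \<Longrightarrow> g l m = (if l = m then 1 else 0)"
    and disj: "L1 \<inter> L2 = {}"
    and f_PW: "f \<in> PW" and f_pos: "pw_norm f > 0"
    and f_L2: "\<And>l. l \<in> L2 \<Longrightarrow> f l = 0"
    and f_L1: "\<And>l. l \<in> L1 \<Longrightarrow> pw_inner f (g l) = 0"
    and l0: "l0 \<in> L1" and l1: "l1 \<in> L1 \<union> L2" "l1 \<noteq> l0"
begin

text \<open>Up to a constant this is the generating function of the nodes with its zero at
  \<open>l0\<close> divided out. Unlike that function it lies in \<open>PW\<close>.\<close>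

definition G :: "complex \<Rightarrow> complex" where "G = g l0"

definition A :: "complex \<Rightarrow> complex" where
  "A w = (LINT x|lborel. G (of_real x) * cnj (f (of_real x)) / (of_real x - w))"

definition \<beta> :: "complex \<Rightarrow> complex" where
  "\<beta> w = (LINT x|lborel. of_real ((cmod (f (of_real x)))\<^sup>2) / (of_real x - w))"

lemma G_PW: "G \<in> PW" unfolding G_def using g_PW l0 by auto

lemma G_l0: "G l0 = 1" and G_zero: "l \<in> L1 \<union> L2 - {l0} \<Longrightarrow> G l = 0"
  unfolding G_def using g_val[of l0] l0 by auto

lemma eq_0_if_vanishes_on_nodes:
  assumes "h \<in> PW" "\<And>l. l \<in> L1 \<union> L2 \<Longrightarrow> h l = 0"
  shows "h z = 0"
  by (rule complete_kernels_vanishing[OF complete assms])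

lemma expand_in_one_node:
  assumes h: "h \<in> PW" and m: "m \<in> L1 \<union> L2" and z: "\<And>l. l \<in> L1 \<union> L2 - {m} \<Longrightarrow> h l = 0"
  shows "h z = h m * g m z"
proof -
  have "h z - h m * g m z = 0"
  proof (rule eq_0_if_vanishes_on_nodes[of "\<lambda>z. h z - h m * g m z"])
    show "(\<lambda>z. h z - h m * g m z) \<in> PW" by (intro PW_diff PW_cmult h g_PW m)
    show "h l - h m * g m l = 0" if "l \<in> L1 \<union> L2" for l
      using z[of l] g_val[OF m that] that by (cases "l = m") auto
  qed
  then show ?thesis by simp
qed

lemma expand_in_two_nodes:
  assumes h: "h \<in> PW" and m: "m \<in> L1 \<union> L2" "m \<noteq> l0" and z: "\<And>l. l \<in> L1 \<union> L2 - {l0, m} \<Longrightarrow> h l = 0"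
  shows "h z = h l0 * G z + h m * g m z"
proof -
  have l0': "l0 \<in> L1 \<union> L2" using l0 by simp
  have "h z - (h l0 * g l0 z + h m * g m z) = 0"
  proof (rule eq_0_if_vanishes_on_nodes[of "\<lambda>z. h z - (h l0 * g l0 z + h m * g m z)"])
    show "(\<lambda>z. h z - (h l0 * g l0 z + h m * g m z)) \<in> PW" by (intro PW_diff PW_add PW_cmult h g_PW m l0')
    show "h l - (h l0 * g l0 l + h m * g m l) = 0" if "l \<in> L1 \<union> L2" for l
      using z[of l] g_val[OF m(1) that] g_val[OF l0' that] that m(2) by (cases "l = m"; cases "l = l0") auto
  qed
  then show ?thesis unfolding G_def by simp
qed

text \<open>If \<open>h\<close> vanished at every node but \<open>l0\<close>, it would be a multiple
  of \<open>G\<close>, and \<open>G z = (z - w) * h z\<close> would force \<open>G\<close> to vanish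
  away from \<open>l0\<close>. Hence \<open>h\<close> is nonzero at some other node, and as
  \<open>G\<close> vanishes there, that node is \<open>w\<close>. Location and simplicity of the
  zero come out together.\<close>

lemma G_zeros:
  assumes h: "h holomorphic_on UNIV" and eq: "\<And>z. G z = (z - w) * h z"
  shows "w \<in> L1 \<union> L2 - {l0} \<and> h w \<noteq> 0"
proof -
  have hP: "h \<in> PW" by (rule PW_divide[OF G_PW h eq])
  have "\<exists>l\<in>L1 \<union> L2 - {l0}. h l \<noteq> 0"
  proof (rule ccontr)
    assume "\<not> (\<exists>l\<in>L1 \<union> L2 - {l0}. h l \<noteq> 0)"
    then have hz: "h z = h l0 * G z" for z
      unfolding G_def using expand_in_one_node[OF hP, of l0] l0 by blast
    define c where "c = h l0"
    have c0: "(l0 - w) * c = 1" using eq[of l0] G_l0 unfolding c_def by simp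
    have "G z = 0" if "z \<noteq> l0" for z
    proof -
      have "G z * (1 - (z - w) * c) = 0" using eq[of z] hz[of z] unfolding c_def by (simp add: algebra_simps)
      \<comment> \<open>This affine factor vanishes at \<open>l0\<close> and, as \<open>c\<close> is
        nonzero, nowhere else.\<close>
      moreover have "1 - (z - w) * c = (l0 - z) * c" using c0 by (simp add: algebra_simps)
      moreover have "c \<noteq> 0" using c0 by auto
      ultimately show ?thesis using that by auto
    qed
    then have "\<forall>\<^sub>F z in at l0. G z = 0" by (auto simp: eventually_at_filter)
    then have "(G \<longlongrightarrow> 0) (at l0)" by (rule tendsto_eventually)
    moreover have "isCont G l0"
      using holomorphic_on_imp_continuous_on[OF PW_entire[OF G_PW]] by (simp add: continuous_on_eq_continuous_at)
    then have "(G \<longlongrightarrow> G l0) (at l0)" by (simp add: isCont_def)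
    ultimately have "G l0 = 0" using tendsto_unique trivial_limit_at by blast
    then show False using G_l0 by simp
  qed
  then obtain l where l: "l \<in> L1 \<union> L2 - {l0}" "h l \<noteq> 0" by blast
  then have "(l - w) * h l = 0" using eq[of l] G_zero by simp
  then have "l = w" using l(2) by simp
  then show ?thesis using l by simp
qed

text \<open>The quotient vanishes at all nodes but \<open>l0\<close> and \<open>l\<close>, hence is
  a combination of \<open>G\<close> and \<open>g l\<close>; both are orthogonal to \<open>f\<close>
  because \<open>l0\<close> and \<open>l\<close> lie in \<open>L1\<close>.\<close>

lemma orth_quotient:
  assumes l: "l \<in> L1 - {l0}" and h: "h holomorphic_on UNIV" and eq: "\<And>z. G z = (z - l) * h z"
  shows "pw_inner h f = 0"
proof -
  have hP: "h \<in> PW" by (rule PW_divide[OF G_PW h eq])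
  have z: "h m = 0" if m: "m \<in> L1 \<union> L2 - {l0, l}" for m
  proof -
    have "(m - l) * h m = 0" using eq[of m] G_zero[of m] m by auto
    then show ?thesis using m by auto
  qed
  have ll: "l \<in> L1 \<union> L2" "l \<noteq> l0" using l by auto
  have "h = (\<lambda>z. h l0 * G z + h l * g l z)" using expand_in_two_nodes[OF hP ll z] by blast
  then have "pw_inner h f = pw_inner (\<lambda>z. h l0 * G z + h l * g l z) f" by simp
  also have "\<dots> = h l0 * pw_inner G f + h l * pw_inner (g l) f"
    using pw_inner_add_left[OF PW_cmult[OF G_PW] PW_cmult[OF g_PW[OF ll(1)]] f_PW] by (simp add: pw_inner_cmult_left)
  also have "\<dots> = 0" using f_L1[OF l0] f_L1[of l] l pw_inner_commute[of G f] pw_inner_commute[of "g l" f] unfolding G_def by simp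
  finally show ?thesis .
qed

lemma fG_meas [measurable]:
  "(\<lambda>x. f (complex_of_real x)) \<in> borel_measurable borel" "(\<lambda>x. G (complex_of_real x)) \<in> borel_measurable borel"
  using entire_measurable[OF PW_entire[OF f_PW]] entire_measurable[OF PW_entire[OF G_PW]] by auto

lemma cnj_meas [measurable]: "(\<lambda>x. cnj (f (complex_of_real x))) \<in> borel_measurable borel"
  using square_integrable_measurable[OF square_integrable_cnj[OF PW_square_integrable[OF f_PW]]] .

lemma ff_integrable: "integrable lborel (\<lambda>x. complex_of_real ((cmod (f (of_real x)))\<^sup>2))"
  using square_integrableD[OF PW_square_integrable[OF f_PW]] by (simp del: of_real_power)

lemma Gf_integrable: "integrable lborel (\<lambda>x. G (of_real x) * cnj (f (of_real x)))"
  by (rule pw_inner_integrable[OF G_PW f_PW])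

lemma Cauchy_integrable:
  assumes i: "integrable lborel \<mu>" and w: "Im w \<noteq> 0"
  shows "integrable lborel (\<lambda>x. \<mu> x / (complex_of_real x - w))"
    and "cmod (LINT x|lborel. \<mu> x / (complex_of_real x - w)) \<le> (LINT x|lborel. cmod (\<mu> x)) / \<bar>Im w\<bar>"
proof -
  have b: "cmod (\<mu> x / (complex_of_real x - w)) \<le> cmod (\<mu> x) / \<bar>Im w\<bar>" for x
    unfolding norm_divide using w abs_Im_le_cmod[of "of_real x - w"] of_real_minus_nonreal[OF w, of x]
    by (intro divide_left_mono) auto
  have i2: "integrable lborel (\<lambda>x. cmod (\<mu> x) / \<bar>Im w\<bar>)" using i by simp
  show 1: "integrable lborel (\<lambda>x. \<mu> x / (complex_of_real x - w))"
  proof (rule Bochner_Integration.integrable_bound[OF i2])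
    show "(\<lambda>x. \<mu> x / (complex_of_real x - w)) \<in> borel_measurable lborel" using borel_measurable_integrable[OF i] by measurable
    show "AE x in lborel. norm (\<mu> x / (complex_of_real x - w)) \<le> norm (cmod (\<mu> x) / \<bar>Im w\<bar>)" using b by simp
  qed
  have "cmod (LINT x|lborel. \<mu> x / (complex_of_real x - w)) \<le> (LINT x|lborel. cmod (\<mu> x) / \<bar>Im w\<bar>)"
    by (rule Bochner_Integration.integral_norm_bound_integral[OF 1 i2]) (rule b)
  then show "cmod (LINT x|lborel. \<mu> x / (complex_of_real x - w)) \<le> (LINT x|lborel. cmod (\<mu> x)) / \<bar>Im w\<bar>" by simp
qed

lemma A_bound: obtains K where "K > 0" "\<And>w. Im w \<noteq> 0 \<Longrightarrow> cmod (A w) \<le> K / \<bar>Im w\<bar>"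
proof -
  define K where "K = (LINT x|lborel. cmod (G (of_real x) * cnj (f (of_real x)))) + 1"
  have "K > 0" unfolding K_def by (intro add_nonneg_pos integral_nonneg_AE) auto
  moreover have "cmod (A w) \<le> K / \<bar>Im w\<bar>" if w: "Im w \<noteq> 0" for w
    using order_trans[OF Cauchy_integrable(2)[OF Gf_integrable w]] unfolding A_def K_def
    by (rule order_trans) (auto intro!: divide_right_mono)
  ultimately show ?thesis using that by blast
qed

lemma \<beta>_bound: "Im w \<noteq> 0 \<Longrightarrow> cmod (\<beta> w) \<le> (pw_norm f)\<^sup>2 / \<bar>Im w\<bar>"
  using Cauchy_integrable(2)[OF ff_integrable] unfolding \<beta>_def pw_norm_sq by (simp del: of_real_power)

text \<open>\<open>D\<close> is the entire extension of \<open>f * A - G * \<beta>\<close>: the numerator \<open>N x w\<close> vanishes at \<open>w = x\<close>, so that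
the integrand has no singularity.\<close>

definition N :: "real \<Rightarrow> complex \<Rightarrow> complex" where
  "N x w = G (of_real x) * f w - G w * f (of_real x)"

definition k :: "real \<Rightarrow> complex \<Rightarrow> complex" where
  "k x w = (if w = of_real x then - deriv (N x) (of_real x) else N x w / (of_real x - w))"

definition D :: "complex \<Rightarrow> complex" where
  "D w = (LINT x|lborel. k x w * cnj (f (of_real x)))"

lemma N_entire: "N x holomorphic_on UNIV"
  unfolding N_def[abs_def] by (intro holomorphic_intros PW_entire f_PW G_PW)

lemma k_entire: "k x holomorphic_on UNIV"
proof (rule pole_theorem_0[of "\<lambda>w. - N x w" UNIV "of_real x"])
  show "(\<lambda>w. - N x w) holomorphic_on UNIV" by (intro holomorphic_intros N_entire)
  have "N x field_differentiable (at (of_real x))"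
    using holomorphic_on_imp_differentiable_at[OF N_entire open_UNIV] by auto
  then show "k x (of_real x) = deriv (\<lambda>w. - N x w) (of_real x)" by (simp add: k_def deriv_minus)
  fix w assume "w \<in> UNIV - {complex_of_real x}"
  then show "- N x w = (w - of_real x) * k x w" by (auto simp: k_def field_simps)
qed (auto simp: N_def)

lemma k_meas: "(\<lambda>x. k x w) \<in> borel_measurable borel"
proof -
  have "(\<lambda>x. k x w) = (\<lambda>x. if x = Re w \<and> Im w = 0 then k (Re w) w else N x w / (of_real x - w))"
  proof
    fix x
    show "k x w = (if x = Re w \<and> Im w = 0 then k (Re w) w else N x w / (of_real x - w))"
      by (auto simp: k_def complex_eq_iff)
  qed
  moreover have "(\<lambda>x. if x = Re w \<and> Im w = 0 then k (Re w) w else N x w / (of_real x - w)) \<in> borel_measurable borel"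
    unfolding N_def by measurable
  ultimately show ?thesis by simp
qed

lemma D_entire: "D holomorphic_on UNIV"
  unfolding D_def[abs_def]
proof (rule holomorphic_dominated_integral[OF open_UNIV])
  show "(\<lambda>w. k x w * cnj (f (of_real x))) holomorphic_on UNIV" for x by (intro holomorphic_intros k_entire)
  show "(\<lambda>x. k x w * cnj (f (of_real x))) \<in> borel_measurable borel" for w using k_meas by measurable
  fix w0 :: complex
  have cb: "\<exists>B. \<forall>w\<in>cball w0 3. cmod (h w) \<le> B" if "h \<in> PW" for h
  proof -
    have "compact (h ` cball w0 3)"
      by (intro compact_continuous_image holomorphic_on_imp_continuous_on holomorphic_on_subset[OF PW_entire[OF that]]) auto
    then show ?thesis by (metis bounded_iff compact_imp_bounded imageI)
  qed
  obtain Bf where Bf: "\<And>w. w \<in> cball w0 3 \<Longrightarrow> cmod (f w) \<le> Bf" using cb[OF f_PW] by blast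
  obtain Bg where Bg: "\<And>w. w \<in> cball w0 3 \<Longrightarrow> cmod (G w) \<le> Bg" using cb[OF G_PW] by blast
  define b where "b = (\<lambda>x. cmod (G (of_real x)) * Bf + Bg * cmod (f (of_real x)))"
  have Nb: "cmod (N x w) \<le> b x" if "w \<in> cball w0 3" for x w
  proof -
    have "cmod (N x w) \<le> cmod (G (of_real x)) * cmod (f w) + cmod (G w) * cmod (f (of_real x))"
      unfolding N_def by (metis norm_mult norm_triangle_ineq4)
    also have "\<dots> \<le> b x" unfolding b_def using Bf[OF that] Bg[OF that] order_trans[OF norm_ge_zero Bg[OF that]]
      by (intro add_mono mult_mono) auto
    finally show ?thesis .
  qed
  have far: "cmod (k x w) \<le> b x" if w: "w \<in> cball w0 3" "cmod (of_real x - w) \<ge> 1" for x w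
  proof -
    have "cmod (k x w) = cmod (N x w) / cmod (of_real x - w)" using w(2) by (auto simp: k_def norm_divide)
    also have "\<dots> \<le> b x / 1" using Nb[OF w(1)] w(2) order_trans[OF norm_ge_zero Nb[OF w(1)]] by (intro frac_le) auto
    finally show ?thesis by simp
  qed
  \<comment> \<open>For \<open>x\<close> close to \<open>w0\<close> the denominator gives no bound.
    The maximum principle carries one over from the circle of radius 3 about \<open>w0\<close>,
    which stays at distance at least 1 from \<open>x\<close>.\<close>
  have kb: "cmod (k x w) \<le> b x" if w: "w \<in> cball w0 1" for x w
  proof (cases "cmod (of_real x - w0) > 2")
    case True
    have "cmod (of_real x - w) \<ge> 1"
      using True w norm_triangle_ineq[of "of_real x - w" "w - w0"] by (simp add: dist_norm norm_minus_commute)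
    then show ?thesis using w by (intro far) auto
  next
    case False
    show ?thesis
    proof (rule maximum_modulus_frontier[of "k x" "cball w0 3"])
      fix u assume "u \<in> frontier (cball w0 3)"
      then have u: "cmod (w0 - u) = 3" by (simp add: dist_norm)
      have "cmod (of_real x - u) \<ge> 1"
        using False u norm_triangle_ineq[of "w0 - of_real x" "of_real x - u"] by (simp add: norm_minus_commute)
      then show "cmod (k x u) \<le> b x" using u by (intro far) (auto simp: dist_norm)
    qed (use w in \<open>auto intro!: holomorphic_on_imp_continuous_on holomorphic_on_subset[OF k_entire]\<close>)
  qed
  show "\<exists>r>0. \<exists>\<psi>. cball w0 r \<subseteq> UNIV \<and> integrable lborel \<psi> \<and> (\<forall>x. \<forall>w\<in>cball w0 r. cmod (k x w * cnj (f (of_real x))) \<le> \<psi> x)"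
  proof (intro exI[of _ 1] exI[of _ "\<lambda>x. b x * cmod (f (of_real x))"] conjI allI ballI)
    have "integrable lborel (\<lambda>x. Bf * cmod (G (of_real x) * cnj (f (of_real x))) + Bg * cmod (complex_of_real ((cmod (f (of_real x)))\<^sup>2)))"
      by (intro Bochner_Integration.integrable_add integrable_mult_right integrable_norm Gf_integrable ff_integrable)
    moreover have "Bf * cmod (G (of_real x) * cnj (f (of_real x))) + Bg * cmod (complex_of_real ((cmod (f (of_real x)))\<^sup>2)) = b x * cmod (f (of_real x))" for x
      unfolding b_def by (simp add: norm_mult power2_eq_square algebra_simps)
    ultimately show "integrable lborel (\<lambda>x. b x * cmod (f (of_real x)))" by simp
    fix x w assume "w \<in> cball w0 1"
    then show "cmod (k x w * cnj (f (of_real x))) \<le> b x * cmod (f (of_real x))"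
      using mult_right_mono[OF kb norm_ge_zero] by (simp add: norm_mult)
  qed auto
qed

lemma D_nonreal:
  assumes w: "Im w \<noteq> 0"
  shows "D w = f w * A w - G w * \<beta> w"
proof -
  have "k x w * cnj (f (of_real x)) = f w * (G (of_real x) * cnj (f (of_real x)) / (of_real x - w))
     - G w * (of_real ((cmod (f (of_real x)))\<^sup>2) / (of_real x - w))" for x
  proof -
    have "w \<noteq> of_real x" using w by auto
    then have "k x w = (G (of_real x) * f w - G w * f (of_real x)) / (of_real x - w)" by (simp add: k_def N_def)
    then show ?thesis unfolding complex_norm_square by (simp add: diff_divide_distrib right_diff_distrib mult_ac)
  qed
  then have "D w = (LINT x|lborel. f w * (G (of_real x) * cnj (f (of_real x)) / (of_real x - w))
     - G w * (of_real ((cmod (f (of_real x)))\<^sup>2) / (of_real x - w)))" unfolding D_def by simp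
  also have "\<dots> = f w * A w - G w * \<beta> w" unfolding A_def \<beta>_def
    using Cauchy_integrable(1)[OF Gf_integrable w] Cauchy_integrable(1)[OF ff_integrable w]
    by (simp only: Bochner_Integration.integral_diff integrable_mult_right integral_mult_right_zero)
  finally show ?thesis .
qed

text \<open>Off the line the estimate of the Cauchy transforms loses a factor
  \<open>1 / |Im w|\<close>. Near the line \<open>(z - u)^2 - 4\<close> repairs this: on the circle
  of radius 2 about \<open>u = Re w\<close> its modulus is \<open>4 |Im z|\<close>, while at
  \<open>w\<close> it is at least 4, so the maximum principle transports the bound inwards.\<close>

lemma D_bound: obtains K where "\<And>w. cmod (D w) \<le> K * exp (pi * \<bar>Im w\<bar>)"
proof -
  obtain Kf where Kf: "Kf > 0" "\<And>z. cmod (f z) \<le> Kf * exp (pi * \<bar>Im z\<bar>)" using PW_bound[OF f_PW] by blast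
  obtain Kg where Kg: "Kg > 0" "\<And>z. cmod (G z) \<le> Kg * exp (pi * \<bar>Im z\<bar>)" using PW_bound[OF G_PW] by blast
  obtain KA where KA: "KA > 0" "\<And>w. Im w \<noteq> 0 \<Longrightarrow> cmod (A w) \<le> KA / \<bar>Im w\<bar>" using A_bound by blast
  define K where "K = Kf * KA + Kg * (pw_norm f)\<^sup>2"
  have K: "K > 0" unfolding K_def using Kf(1) KA(1) Kg(1) f_pos by (simp add: add_pos_pos)
  have off: "cmod (D w) \<le> K * exp (pi * \<bar>Im w\<bar>) / \<bar>Im w\<bar>" if w: "Im w \<noteq> 0" for w
  proof -
    have "cmod (D w) \<le> cmod (f w) * cmod (A w) + cmod (G w) * cmod (\<beta> w)"
      unfolding D_nonreal[OF w] by (metis norm_mult norm_triangle_ineq4)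
    also have "\<dots> \<le> (Kf * exp (pi * \<bar>Im w\<bar>)) * (KA / \<bar>Im w\<bar>) + (Kg * exp (pi * \<bar>Im w\<bar>)) * ((pw_norm f)\<^sup>2 / \<bar>Im w\<bar>)"
      using Kf Kg KA(2)[OF w] \<beta>_bound[OF w] by (intro add_mono mult_mono) auto
    also have "\<dots> = K * exp (pi * \<bar>Im w\<bar>) / \<bar>Im w\<bar>" unfolding K_def by (simp add: field_simps add_divide_distrib)
    finally show ?thesis .
  qed
  have "cmod (D w) \<le> (K * exp (pi * 2)) * exp (pi * \<bar>Im w\<bar>)" for w
  proof (cases "\<bar>Im w\<bar> \<ge> 1")
    case True
    have "cmod (D w) \<le> K * exp (pi * \<bar>Im w\<bar>) / \<bar>Im w\<bar>" using True by (intro off) auto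
    also have "\<dots> \<le> K * exp (pi * \<bar>Im w\<bar>) / 1" using True K by (intro divide_left_mono) auto
    also have "\<dots> \<le> (K * exp (pi * 2)) * exp (pi * \<bar>Im w\<bar>)" using K by simp
    finally show ?thesis .
  next
    case False
    define u where "u = complex_of_real (Re w)"
    define E where "E = (\<lambda>z. D z * ((z - u)\<^sup>2 - 4))"
    have "cmod (E w) \<le> 4 * (K * exp (pi * 2))"
    proof (rule maximum_modulus_frontier[of E "cball u 2"])
      fix z assume "z \<in> frontier (cball u 2)"
      then have z: "cmod (z - u) = 2" by (simp add: dist_norm norm_minus_commute)
      define s where "s = z - u"
      have s: "s * cnj s = 4" using z complex_norm_square[of s] unfolding s_def by simp
      have "s\<^sup>2 - 4 = s * (s - cnj s)" using s by (simp add: power2_eq_square algebra_simps)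
      also have "cmod \<dots> = 2 * (2 * \<bar>Im s\<bar>)" using z unfolding norm_mult s_def[symmetric] complex_diff_cnj by (simp add: norm_mult)
      finally have m: "cmod ((z - u)\<^sup>2 - 4) = 4 * \<bar>Im z\<bar>" unfolding s_def u_def by simp
      show "cmod (E z) \<le> 4 * (K * exp (pi * 2))"
      proof (cases "Im z = 0")
        case True
        then show ?thesis unfolding E_def norm_mult m using K by simp
      next
        case False
        have "\<bar>Im z\<bar> \<le> 2" using abs_Im_le_cmod[of "z - u"] z unfolding u_def by simp
        then have "exp (pi * \<bar>Im z\<bar>) \<le> exp (pi * 2)" by simp
        then have "cmod (D z) \<le> K * exp (pi * 2) / \<bar>Im z\<bar>"
          using off[OF False] K by (elim order_trans) (auto intro!: divide_right_mono)
        then show ?thesis unfolding E_def norm_mult m using False by (simp add: field_simps)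
      qed
    next
      show "E holomorphic_on interior (cball u 2)" unfolding E_def
        by (intro holomorphic_intros holomorphic_on_subset[OF D_entire]) auto
      show "continuous_on (closure (cball u 2)) E" unfolding E_def
        by (intro holomorphic_on_imp_continuous_on holomorphic_intros holomorphic_on_subset[OF D_entire]) auto
      have "cmod (u - w) = \<bar>Im w\<bar>" unfolding u_def by (simp add: cmod_def)
      then show "w \<in> cball u 2" using False by (simp add: dist_norm)
    qed simp
    moreover have "cmod ((w - u)\<^sup>2 - 4) \<ge> 4"
    proof -
      have "w - u = \<i> * of_real (Im w)" unfolding u_def by (simp add: complex_eq_iff)
      then have "(w - u)\<^sup>2 - 4 = - of_real ((Im w)\<^sup>2 + 4)" by (simp add: power_mult_distrib)
      then have "cmod ((w - u)\<^sup>2 - 4) = (Im w)\<^sup>2 + 4"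
        by (metis norm_minus_cancel norm_of_real abs_of_nonneg add_nonneg_nonneg zero_le_numeral zero_le_power2)
      then show ?thesis by simp
    qed
    ultimately have "cmod (D w) * 4 \<le> 4 * (K * exp (pi * 2))"
      unfolding E_def norm_mult by (meson mult_left_mono norm_ge_zero order_trans)
    then have "cmod (D w) \<le> K * exp (pi * 2) * 1" by simp
    also have "\<dots> \<le> (K * exp (pi * 2)) * exp (pi * \<bar>Im w\<bar>)" using K by (intro mult_left_mono) auto
    finally show ?thesis .
  qed
  then show ?thesis using that by blast
qed

text \<open>At a zero of \<open>G\<close> only the term with \<open>f w\<close> is left in the
  numerator. Working with the integral for \<open>D\<close> itself covers real \<open>w\<close> as
  well, where the formula through \<open>A\<close> and \<open>\<beta>\<close> does not
  apply.\<close>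

lemma D_at_zero:
  assumes h: "h holomorphic_on UNIV" and eq: "\<And>z. G z = (z - w) * h z"
  shows "D w = f w * pw_inner h f"
proof -
  have [measurable]: "(\<lambda>x. h (complex_of_real x)) \<in> borel_measurable borel" using entire_measurable[OF h] .
  have Gw: "G w = 0" using eq[of w] by simp
  have "D w = (LINT x|lborel. f w * (h (of_real x) * cnj (f (of_real x))))"
    unfolding D_def
  proof (rule integral_cong_AE)
    show "AE x in lborel. k x w * cnj (f (of_real x)) = f w * (h (of_real x) * cnj (f (of_real x)))"
      using AE_lborel_singleton[of "Re w"]
    proof eventually_elim
      case (elim x)
      then have "w \<noteq> of_real x" by auto
      then have "k x w = h (of_real x) * f w" unfolding k_def N_def Gw eq[of "of_real x"] by simp
      then show ?case by simp
    qed
  qed (use k_meas in measurable)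
  then show ?thesis unfolding pw_inner_def by simp
qed

lemma D_vanish:
  assumes l: "l \<in> L1 \<union> L2 - {l0}"
  shows "D l = 0"
proof -
  obtain h where h: "h holomorphic_on UNIV" "\<And>z. G z = (z - l) * h z"
    using entire_divide[OF PW_entire[OF G_PW], of l] G_zero[OF l] by blast
  have "f l = 0 \<or> pw_inner h f = 0" using l f_L2 orth_quotient[OF _ h] by blast
  then show ?thesis using D_at_zero[OF h] by auto
qed

text \<open>Dividing \<open>D\<close> by its zero \<open>l1\<close> puts it in \<open>PW\<close>,
  where two-node interpolation leaves a combination of \<open>G\<close> and \<open>g l1\<close>.
  Multiplying back by \<open>z - l1\<close> turns \<open>g l1\<close> into a multiple of
  \<open>(z - l0) * G z\<close>, so the cofactor of \<open>G\<close> has degree at most one.\<close>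

lemma D_affine: obtains a b where "\<And>z. D z = G z * (a + b * z)"
proof -
  obtain K where K: "\<And>w. cmod (D w) \<le> K * exp (pi * \<bar>Im w\<bar>)" using D_bound by blast
  have l1': "l1 \<in> L1 \<union> L2 - {l0}" using l1 by simp
  obtain h where h: "h holomorphic_on UNIV" "\<And>z. D z = (z - l1) * h z"
    using entire_divide[OF D_entire D_vanish[OF l1']] by blast
  have hP: "h \<in> PW" by (rule PW_divide_bounded[OF K h])
  have hz: "h m = 0" if m: "m \<in> L1 \<union> L2 - {l0, l1}" for m
  proof -
    have "(m - l1) * h m = 0" using h(2)[of m] D_vanish[of m] m by auto
    then show ?thesis using m by auto
  qed
  have hexp: "h z = h l0 * G z + h l1 * g l1 z" for z by (rule expand_in_two_nodes[OF hP l1 hz])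
  obtain h1 where h1: "h1 holomorphic_on UNIV" "\<And>z. G z = (z - l1) * h1 z"
    using entire_divide[OF PW_entire[OF G_PW] G_zero[OF l1']] by blast
  have h1P: "h1 \<in> PW" by (rule PW_divide[OF G_PW h1])
  have h1n: "h1 l1 \<noteq> 0" using G_zeros[OF h1] by simp
  \<comment> \<open>This is \<open>(z - l0) * G z / (z - l1)\<close>, written so that membership in
    \<open>PW\<close> is visible. It moves the missing zero from \<open>l0\<close> to
    \<open>l1\<close> and is therefore a multiple of \<open>g l1\<close>.\<close>
  define q where "q = (\<lambda>z. G z + (l1 - l0) * h1 z)"
  have qeq: "q z = (z - l0) * h1 z" for z unfolding q_def h1(2)[of z] by (simp add: algebra_simps)
  have qP: "q \<in> PW" unfolding q_def by (intro PW_add PW_cmult G_PW h1P)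
  have qz: "q z = q l1 * g l1 z" for z
  proof (rule expand_in_one_node[OF qP l1(1)])
    fix m assume m: "m \<in> L1 \<union> L2 - {l1}"
    show "q m = 0"
    proof (cases "m = l0")
      case True then show ?thesis by (simp add: qeq)
    next
      case False
      then have "(m - l1) * h1 m = 0" using h1(2)[of m] G_zero[of m] m by auto
      then show ?thesis using m by (auto simp: qeq)
    qed
  qed
  have q1: "q l1 \<noteq> 0" using h1n l1(2) by (simp add: qeq)
  have g1: "(z - l1) * g l1 z = (z - l0) * G z / q l1" for z
  proof -
    have "q l1 * ((z - l1) * g l1 z) = (z - l1) * q z" using qz[of z] by simp
    also have "\<dots> = (z - l0) * G z" unfolding qeq h1(2)[of z] by simp
    finally show ?thesis using q1 by (simp add: field_simps)
  qed
  have "D z = G z * ((- l1 * h l0 - l0 * h l1 / q l1) + (h l0 + h l1 / q l1) * z)" for z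
  proof -
    have "D z = h l0 * (z - l1) * G z + h l1 * ((z - l1) * g l1 z)" unfolding h(2)[of z] hexp[of z] by (simp add: algebra_simps)
    also have "\<dots> = G z * ((- l1 * h l0 - l0 * h l1 / q l1) + (h l0 + h l1 / q l1) * z)"
      unfolding g1 by (simp add: algebra_simps diff_divide_distrib)
    finally show ?thesis .
  qed
  then show ?thesis using that by blast
qed

end

subsection \<open>Zeros that do not come from \<open>\<Lambda>2\<close>\<close>

lemma Cauchy_transform_holomorphic:
  assumes i: "integrable lborel \<mu>"
  shows "(\<lambda>w. LINT x|lborel. \<mu> x / (complex_of_real x - w)) holomorphic_on {w. Im w \<noteq> 0}"
proof (rule holomorphic_dominated_integral)
  show "open {w. Im w \<noteq> 0}" by (intro open_Collect_neq continuous_intros)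
  show "(\<lambda>w. \<mu> x / (complex_of_real x - w)) holomorphic_on {w. Im w \<noteq> 0}" for x
    by (intro holomorphic_intros) auto
  show "(\<lambda>x. \<mu> x / (complex_of_real x - w)) \<in> borel_measurable borel" for w
    using borel_measurable_integrable[OF i] by measurable
  fix w0 assume "w0 \<in> {w. Im w \<noteq> 0}"
  then have w0: "Im w0 \<noteq> 0" by simp
  define r where "r = \<bar>Im w0\<bar> / 2"
  have r: "r > 0" unfolding r_def using w0 by simp
  have b: "r \<le> \<bar>Im w\<bar>" if "w \<in> cball w0 r" for w
    using abs_Im_le_cmod[of "w0 - w"] that unfolding r_def by (simp add: dist_norm)
  show "\<exists>r>0. \<exists>\<psi>. cball w0 r \<subseteq> {w. Im w \<noteq> 0} \<and> integrable lborel \<psi> \<and> (\<forall>x. \<forall>w\<in>cball w0 r. cmod (\<mu> x / (complex_of_real x - w)) \<le> \<psi> x)"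
  proof (intro exI[of _ r] exI[of _ "\<lambda>x. cmod (\<mu> x) / r"] conjI allI ballI r)
    show "cball w0 r \<subseteq> {w. Im w \<noteq> 0}" using b r by fastforce
    show "integrable lborel (\<lambda>x. cmod (\<mu> x) / r)" using i by simp
    fix x w assume "w \<in> cball w0 r"
    from b[OF this] have "r \<le> cmod (complex_of_real x - w)" using abs_Im_le_cmod[of "of_real x - w"] by simp
    then show "cmod (\<mu> x / (complex_of_real x - w)) \<le> cmod (\<mu> x) / r"
      unfolding norm_divide using r by (intro divide_left_mono mult_pos_pos) auto
  qed
qed

lemma tail_integral_small:
  fixes p :: "real \<Rightarrow> real"
  assumes i: "integrable lborel p" and e: "e > 0"
  obtains M where "M > 0" "\<bar>LINT x|lborel. indicator {x. \<bar>x\<bar> > M} x * p x\<bar> < e"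
proof -
  have "(\<lambda>n. LINT x|lborel. indicator {x. \<bar>x\<bar> > real n} x * p x) \<longlonglongrightarrow> (LINT x|(lborel::real measure). 0)"
  proof (rule integral_dominated_convergence[where w = "\<lambda>x. \<bar>p x\<bar>"])
    note [measurable] = borel_measurable_integrable[OF i]
    show "(\<lambda>x. indicator {x. \<bar>x\<bar> > real n} x * p x) \<in> borel_measurable lborel" for n by measurable
    show "AE x in lborel. (\<lambda>n. indicator {x. \<bar>x\<bar> > real n} x * p x) \<longlonglongrightarrow> 0"
    proof (rule AE_I2)
      fix x :: real
      obtain m where m: "\<bar>x\<bar> \<le> real m" using real_arch_simple by blast
      have "indicator {x. \<bar>x\<bar> > real n} x * p x = 0" if "n \<ge> m" for n
        using m that order_trans[of "\<bar>x\<bar>" "real m" "real n"] by (simp add: indicator_def)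
      then have "\<forall>\<^sub>F n in sequentially. indicator {x. \<bar>x\<bar> > real n} x * p x = 0"
        unfolding eventually_sequentially by blast
      then show "(\<lambda>n. indicator {x. \<bar>x\<bar> > real n} x * p x) \<longlonglongrightarrow> 0" by (rule tendsto_eventually)
    qed
  qed (use i in \<open>auto simp: indicator_def\<close>)
  then have "(\<lambda>n. LINT x|lborel. indicator {x. \<bar>x\<bar> > real n} x * p x) \<longlonglongrightarrow> 0" by simp
  from LIMSEQ_D[OF this e] obtain N where N: "\<And>n. n \<ge> N \<Longrightarrow> \<bar>LINT x|lborel. indicator {x. \<bar>x\<bar> > real n} x * p x\<bar> < e"
    by auto
  show ?thesis using that[of "real (Suc N)"] N[of "Suc N"] by auto
qed

text \<open>A Riemann-Lebesgue type argument in the reproducing formula: the tail of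
  \<open>f\<close> is small in norm, and against the remaining bounded piece the kernel decays as
  \<open>Re z\<close> moves away. A strip rather than the line is treated so that Cauchy estimates
  reach the derivative.\<close>

lemma PW_decay:
  assumes f: "f \<in> PW" and e: "e > 0"
  obtains R where "R > 0" "\<And>z. \<bar>Im z\<bar> \<le> 1 \<Longrightarrow> \<bar>Re z\<bar> \<ge> R \<Longrightarrow> cmod (f z) \<le> e"
proof -
  obtain C where C: "C > 0" "\<And>x w. cmod (csinc (of_real pi * (of_real x - w))) \<le> C * exp (pi * \<bar>Im w\<bar>) / sqrt (1 + (x - Re w)\<^sup>2)"
    using csinc_kernel_bound by blast
  obtain C2 where C2: "C2 > 0" "\<And>w. square_integrable (\<lambda>x. csinc (of_real pi * (of_real x - w)))"
    "\<And>w. sqrt (LINT x|lborel. (cmod (csinc (of_real pi * (of_real x - w))))\<^sup>2) \<le> C2 * exp (pi * \<bar>Im w\<bar>)"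
    using csinc_kernel_square_integrable by blast
  have sq: "square_integrable (\<lambda>x. f (of_real x))" by (rule PW_square_integrable[OF f])
  note [measurable] = square_integrable_measurable[OF sq] csinc_kernel_measurable
  define e2 where "e2 = e / (2 * (C2 * exp pi))"
  have e2: "e2 > 0" unfolding e2_def using e C2(1) by simp
  obtain M where M: "M > 0" "\<bar>LINT x|lborel. indicator {x. \<bar>x\<bar> > M} x * (cmod (f (of_real x)))\<^sup>2\<bar> < e2\<^sup>2"
    using tail_integral_small[OF square_integrableD[OF sq], of "e2\<^sup>2"] e2 by (metis zero_less_power)
  define u1 u2 where "u1 = (\<lambda>x. of_real (indicator {x. \<bar>x\<bar> > M} x) * f (complex_of_real x))"
    and "u2 = (\<lambda>x. of_real (indicator {x. \<bar>x\<bar> \<le> M} x) * f (complex_of_real x))"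
  have u12: "f (of_real x) = u1 x + u2 x" for x unfolding u1_def u2_def by (auto simp: indicator_def)
  have s1: "square_integrable u1"
    by (rule square_integrable_bound[OF sq, of _ 1]) (auto simp: u1_def indicator_def)
  have s2: "square_integrable u2"
    by (rule square_integrable_bound[OF sq, of _ 1]) (auto simp: u2_def indicator_def)
  have n1: "sqrt (LINT x|lborel. (cmod (u1 x))\<^sup>2) \<le> e2"
  proof -
    have "(cmod (u1 x))\<^sup>2 = indicator {x. \<bar>x\<bar> > M} x * (cmod (f (of_real x)))\<^sup>2" for x unfolding u1_def by (auto simp: indicator_def)
    then have "(LINT x|lborel. (cmod (u1 x))\<^sup>2) \<le> e2\<^sup>2" using M(2) by simp
    then show ?thesis using e2 by (metis real_sqrt_le_mono real_sqrt_unique less_imp_le)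
  qed
  have i2: "integrable lborel (\<lambda>x. cmod (u2 x))"
  proof (rule Bochner_Integration.integrable_bound)
    show "integrable lborel (\<lambda>x. indicator {-M..M} x * (1::real) + (cmod (f (of_real x)))\<^sup>2)"
      using square_integrableD[OF sq] by (intro Bochner_Integration.integrable_add) (auto intro!: integrable_real_indicator simp: emeasure_lborel_Icc_eq)
    show "(\<lambda>x. cmod (u2 x)) \<in> borel_measurable lborel" unfolding u2_def by measurable
    have le: "t \<le> 1 + t\<^sup>2" for t :: real using zero_le_power2[of "t - 1/2"] by (simp add: power2_eq_square algebra_simps)
    show "AE x in lborel. norm (cmod (u2 x)) \<le> norm (indicator {-M..M} x * (1::real) + (cmod (f (of_real x)))\<^sup>2)"
      using le by (auto simp: u2_def indicator_def abs_le_iff)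
  qed
  define I where "I = (LINT x|lborel. cmod (u2 x))"
  have I0: "I \<ge> 0" unfolding I_def by (intro integral_nonneg_AE) auto
  define R where "R = M + 1 + 2 * I * C * exp pi / e"
  have main: "cmod (f z) \<le> e" if z: "\<bar>Im z\<bar> \<le> 1" "\<bar>Re z\<bar> \<ge> R" for z
  proof -
    let ?K = "\<lambda>x. csinc (of_real pi * (of_real x - z))"
    have ex: "exp (pi * \<bar>Im z\<bar>) \<le> exp pi" using z(1) by simp
    have "f z = (LINT x|lborel. f (of_real x) * ?K x)" using PW_reproducing[OF f] by simp
    also have "\<dots> = (LINT x|lborel. u1 x * ?K x + u2 x * ?K x)" unfolding u12 by (simp add: distrib_right)
    also have "\<dots> = (LINT x|lborel. u1 x * ?K x) + (LINT x|lborel. u2 x * ?K x)"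
      by (intro Bochner_Integration.integral_add square_integrable_mult s1 s2 C2)
    finally have "cmod (f z) \<le> cmod (LINT x|lborel. u1 x * ?K x) + cmod (LINT x|lborel. u2 x * ?K x)"
      by (simp add: norm_triangle_ineq)
    moreover have "cmod (LINT x|lborel. u1 x * ?K x) \<le> e / 2"
    proof -
      have "cmod (LINT x|lborel. u1 x * ?K x) \<le> e2 * (C2 * exp (pi * \<bar>Im z\<bar>))"
        using square_integrable_Cauchy_Schwarz_norm[OF s1 C2(2)[of z]] mult_mono[OF n1 C2(3)[of z]] e2
        by (auto elim!: order_trans simp: integral_nonneg_AE)
      also have "\<dots> \<le> e2 * (C2 * exp pi)" using e2 C2(1) ex by (intro mult_left_mono) auto
      also have "\<dots> = e / 2" unfolding e2_def using C2(1) by simp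
      finally show ?thesis .
    qed
    moreover have "cmod (LINT x|lborel. u2 x * ?K x) \<le> e / 2"
    proof -
      define s where "s = \<bar>Re z\<bar> - M"
      have t0: "2 * I * C * exp pi / e \<ge> 0" using I0 C(1) e by simp
      have s: "s \<ge> 1" "s \<ge> 2 * I * C * exp pi / e" using z(2) t0 unfolding s_def R_def by linarith+
      have "cmod (u2 x * ?K x) \<le> cmod (u2 x) * (C * exp pi / s)" for x
      proof (cases "\<bar>x\<bar> \<le> M")
        case True
        have "s \<le> \<bar>x - Re z\<bar>" using True unfolding s_def by linarith
        then have "s\<^sup>2 \<le> (x - Re z)\<^sup>2" using power_mono[of s "\<bar>x - Re z\<bar>" 2] s(1) by simp
        then have "s \<le> sqrt (1 + (x - Re z)\<^sup>2)" by (intro real_le_rsqrt) simp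
        then have "C * exp (pi * \<bar>Im z\<bar>) / sqrt (1 + (x - Re z)\<^sup>2) \<le> C * exp pi / s"
          using s(1) C(1) ex by (intro frac_le mult_left_mono) auto
        then have "cmod (?K x) \<le> C * exp pi / s" using C(2)[of x z] by linarith
        then show ?thesis unfolding norm_mult by (intro mult_left_mono) auto
      next
        case False
        then show ?thesis unfolding u2_def by simp
      qed
      then have "cmod (LINT x|lborel. u2 x * ?K x) \<le> (LINT x|lborel. cmod (u2 x) * (C * exp pi / s))"
        using i2 by (intro Bochner_Integration.integral_norm_bound_integral square_integrable_mult s2 C2 integrable_mult_left) auto
      also have "\<dots> = I * (C * exp pi / s)" unfolding I_def by (rule integral_mult_left_zero)
      also have "\<dots> \<le> e / 2" using s e by (simp add: field_simps)
      finally show ?thesis .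
    qed
    ultimately show ?thesis by simp
  qed
  have "R > 0" unfolding R_def using M(1) I0 C(1) e by (intro add_pos_nonneg) auto
  then show ?thesis using that main by blast
qed

text \<open>The endpoints are equally far from \<open>w\<close>, so the real parts of the logarithms
  cancel and only a difference of arguments remains. The bound is thus free of \<open>Im w\<close>,
  as decay of \<open>\<beta>\<close> uniformly up to the line requires.\<close>

lemma integral_Cauchy_kernel_bound:
  assumes "Im w \<noteq> 0"
  shows "cmod (integral {Re w - 1..Re w + 1} (\<lambda>x. 1 / (complex_of_real x - w))) \<le> 2 * pi"
proof -
  define a b where "a = complex_of_real (Re w - 1) - w" and "b = complex_of_real (Re w + 1) - w"
  have "((\<lambda>x. 1 / (complex_of_real x - w)) has_integral (Ln b - Ln a)) {Re w - 1..Re w + 1}"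
    unfolding a_def b_def
  proof (rule fundamental_theorem_of_calculus)
    fix x :: real
    have "complex_of_real x - w \<notin> \<real>\<^sub>\<le>\<^sub>0" using assms by (auto simp: complex_nonpos_Reals_iff)
    then have "((\<lambda>z. Ln (z - w)) has_field_derivative 1 / (complex_of_real x - w)) (at (of_real x))"
      by (auto intro!: derivative_eq_intros simp: inverse_eq_divide)
    from has_vector_derivative_real_field[OF this, of "{Re w - 1..Re w + 1}"]
    show "((\<lambda>x. Ln (complex_of_real x - w)) has_vector_derivative 1 / (complex_of_real x - w)) (at x within {Re w - 1..Re w + 1})"
      by (simp add: o_def)
  qed simp
  then have I: "integral {Re w - 1..Re w + 1} (\<lambda>x. 1 / (complex_of_real x - w)) = Ln b - Ln a" by (rule integral_unique)
  have ab: "a \<noteq> 0" "b \<noteq> 0" unfolding a_def b_def using assms by (auto simp: complex_eq_iff)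
  have "cmod a = cmod b" unfolding a_def b_def by (simp add: cmod_def)
  then have "Re (Ln b - Ln a) = 0" using ab by simp
  then have "cmod (Ln b - Ln a) = \<bar>Im (Ln b) - Im (Ln a)\<bar>" by (simp add: cmod_def)
  also have "\<dots> \<le> 2 * pi" using mpi_less_Im_Ln[OF ab(1)] Im_Ln_le_pi[OF ab(1)] mpi_less_Im_Ln[OF ab(2)] Im_Ln_le_pi[OF ab(2)] by linarith
  finally show ?thesis unfolding I .
qed

section \<open>Bounds for \<beta> near the real line and at infinity\<close>

context mixed_complement
begin

lemma \<beta>_holomorphic: "\<beta> holomorphic_on {w. Im w \<noteq> 0}"
  unfolding \<beta>_def[abs_def] by (rule Cauchy_transform_holomorphic[OF ff_integrable])

lemma A_holomorphic: "A holomorphic_on {w. Im w \<noteq> 0}"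
  unfolding A_def[abs_def] by (rule Cauchy_transform_holomorphic[OF Gf_integrable])

text \<open>Nothing cancels in the imaginary part: its integrand is \<open>Im w\<close> times
  \<open>|f|^2 / |x - w|^2\<close>. The inequality
  \<open>|x - w|^2 <= 2 (1 + x^2) (1 + |w|^2)\<close> then separates the variables.\<close>

lemma \<beta>_lower: obtains \<kappa> where "\<kappa> > 0" "\<And>w. Im w \<noteq> 0 \<Longrightarrow> \<kappa> * \<bar>Im w\<bar> / (1 + (cmod w)\<^sup>2) \<le> cmod (\<beta> w)"
proof -
  let ?p = "\<lambda>x. (cmod (f (complex_of_real x)))\<^sup>2"
  have ip: "integrable lborel ?p" by (rule square_integrableD[OF PW_square_integrable[OF f_PW]])
  have iq: "integrable lborel (\<lambda>x. ?p x / (1 + x\<^sup>2))"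
  proof (rule Bochner_Integration.integrable_bound[OF ip])
    show "AE x in lborel. norm (?p x / (1 + x\<^sup>2)) \<le> norm (?p x)"
      by (intro AE_I2) (auto simp: divide_le_eq mult_le_cancel_left1 add_pos_nonneg mult_left_le_one_le intro!: order_trans[OF _ mult_left_mono[of 1]])
  qed measurable
  define \<kappa> where "\<kappa> = (LINT x|lborel. ?p x / (1 + x\<^sup>2)) / 2"
  have nn: "AE x in lborel. 0 \<le> ?p x / (1 + x\<^sup>2)" by (auto simp: add_nonneg_nonneg)
  have "\<kappa> \<ge> 0" unfolding \<kappa>_def using nn by (simp add: integral_nonneg_AE)
  moreover have "\<kappa> \<noteq> 0"
  proof
    assume "\<kappa> = 0"
    then have "AE x in lborel. ?p x / (1 + x\<^sup>2) = 0"
      using integral_nonneg_eq_0_iff_AE[OF iq nn] unfolding \<kappa>_def by simp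
    then have "AE x in lborel. ?p x = 0"
    proof eventually_elim
      case (elim x)
      have "1 + x\<^sup>2 > 0" by (simp add: add_pos_nonneg)
      then show ?case using elim by auto
    qed
    then have "(LINT x|lborel. ?p x) = 0" by (intro integral_eq_zero_AE)
    then show False using f_pos unfolding pw_norm_def by simp
  qed
  ultimately have k: "\<kappa> > 0" by simp
  have "\<kappa> * \<bar>Im w\<bar> / (1 + (cmod w)\<^sup>2) \<le> cmod (\<beta> w)" if w: "Im w \<noteq> 0" for w
  proof -
    define W where "W = 1 + (cmod w)\<^sup>2"
    have W: "W > 0" unfolding W_def by (simp add: add_pos_nonneg)
    let ?q = "\<lambda>x. ?p x / (cmod (of_real x - w))\<^sup>2"
    have im: "Im (of_real (?p x) / (of_real x - w)) = Im w * ?q x" for x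
      unfolding cmod_power2[of "of_real x - w"] by (simp add: Im_divide power2_eq_square mult_ac)
    have i1: "integrable lborel (\<lambda>x. complex_of_real (?p x) / (of_real x - w))"
      by (rule Cauchy_integrable(1)[OF ff_integrable w])
    have "integrable lborel (\<lambda>x. Im (of_real (?p x) / (of_real x - w)))" using i1 by (rule integrable_Im)
    then have "integrable lborel (\<lambda>x. (1 / Im w) * (Im w * ?q x))" unfolding im by (rule integrable_mult_right)
    then have i2: "integrable lborel ?q" using w by (simp add: field_simps)
    have "Im (\<beta> w) = Im w * (LINT x|lborel. ?q x)"
    proof -
      have "Im (\<beta> w) = (LINT x|lborel. Im (of_real (?p x) / (of_real x - w)))"
        unfolding \<beta>_def by (rule integral_Im[OF i1, symmetric])
      also have "\<dots> = (LINT x|lborel. Im w * ?q x)" unfolding im ..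
      also have "\<dots> = Im w * (LINT x|lborel. ?q x)" by (rule integral_mult_right_zero)
      finally show ?thesis .
    qed
    moreover have "(LINT x|lborel. ?q x) \<ge> \<kappa> / W"
    proof -
      have "\<kappa> / W = (LINT x|lborel. (?p x / (1 + x\<^sup>2)) / (2 * W))"
        unfolding \<kappa>_def by (subst integral_divide_zero) simp
      also have "\<dots> \<le> (LINT x|lborel. ?q x)"
      proof (rule integral_mono)
        show "integrable lborel (\<lambda>x. (?p x / (1 + x\<^sup>2)) / (2 * W))" by (intro integrable_divide_zero iq)
        fix x :: real
        have "cmod (of_real x - w) \<le> \<bar>x\<bar> + cmod w" using norm_triangle_ineq4[of "of_real x" w] by simp
        then have "(cmod (of_real x - w))\<^sup>2 \<le> (\<bar>x\<bar> + cmod w)\<^sup>2" by (intro power_mono) auto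
        also have "\<dots> \<le> 2 * x\<^sup>2 + 2 * (cmod w)\<^sup>2" using sum_squares_bound[of "\<bar>x\<bar>" "cmod w"] by (simp add: power2_sum)
        also have "\<dots> \<le> (1 + x\<^sup>2) * (2 * W)" unfolding W_def by (simp add: algebra_simps)
        finally have le: "(cmod (of_real x - w))\<^sup>2 \<le> (1 + x\<^sup>2) * (2 * W)" .
        have "cmod (of_real x - w) > 0" using of_real_minus_nonreal[OF w] by simp
        then have "?p x / ((1 + x\<^sup>2) * (2 * W)) \<le> ?q x" using le by (intro divide_left_mono mult_pos_pos) (auto simp: W add_pos_nonneg)
        then show "(?p x / (1 + x\<^sup>2)) / (2 * W) \<le> ?q x" by simp
      qed (rule i2)
      finally show ?thesis .
    qed
    moreover have "\<kappa> / W \<ge> 0" using k W by simp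
    ultimately have "\<bar>Im w\<bar> * (\<kappa> / W) \<le> \<bar>Im (\<beta> w)\<bar>"
      unfolding \<open>Im (\<beta> w) = _\<close> abs_mult by (intro mult_left_mono) linarith+
    also have "\<dots> \<le> cmod (\<beta> w)" by (rule abs_Im_le_cmod)
    finally show ?thesis unfolding W_def by (simp add: mult.commute)
  qed
  then show ?thesis using that k by blast
qed

text \<open>Decay in the strip makes the derivative small far out, by Cauchy's estimate on unit
  circles. The Lipschitz constant is wanted for \<open>|f|^2\<close>, the density of
  \<open>\<beta>\<close>, to control the singular part of its Cauchy integral.\<close>

lemma f_Lipschitz:
  assumes e: "e > 0"
  obtains R where "R > 0" "\<And>x. \<bar>x\<bar> \<ge> R \<Longrightarrow> cmod (f (of_real x)) \<le> e"
    "\<And>x y. \<bar>y\<bar> \<ge> R \<Longrightarrow> \<bar>x - y\<bar> \<le> 1 \<Longrightarrow> \<bar>(cmod (f (of_real x)))\<^sup>2 - (cmod (f (of_real y)))\<^sup>2\<bar> \<le> 2 * e\<^sup>2 * \<bar>x - y\<bar>"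
proof -
  obtain R where R: "R > 0" "\<And>z. \<bar>Im z\<bar> \<le> 1 \<Longrightarrow> \<bar>Re z\<bar> \<ge> R \<Longrightarrow> cmod (f z) \<le> e"
    using PW_decay[OF f_PW e] by blast
  have d: "cmod (deriv f (of_real x)) \<le> e" if "\<bar>x\<bar> \<ge> R + 1" for x
  proof -
    have "cmod ((deriv ^^ 1) f (of_real x)) \<le> fact 1 * e / 1 ^ 1"
    proof (rule Cauchy_inequality)
      fix z assume z: "cmod (of_real x - z) = 1"
      have "\<bar>Im z\<bar> \<le> 1" using abs_Im_le_cmod[of "of_real x - z"] z by simp
      moreover have "\<bar>x - Re z\<bar> \<le> 1" using abs_Re_le_cmod[of "of_real x - z"] z by simp
      then have "\<bar>Re z\<bar> \<ge> R" using that by linarith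
      ultimately show "cmod (f z) \<le> e" by (rule R(2))
    qed (auto intro!: holomorphic_on_imp_continuous_on holomorphic_on_subset[OF PW_entire[OF f_PW]])
    then show ?thesis by simp
  qed
  show ?thesis
  proof (rule that[of "R + 2"])
    show "R + 2 > 0" using R by simp
    show small: "cmod (f (of_real x)) \<le> e" if "\<bar>x\<bar> \<ge> R + 2" for x using R(2)[of "of_real x"] that by simp
    fix x y assume y: "\<bar>y\<bar> \<ge> R + 2" and xy: "\<bar>x - y\<bar> \<le> 1"
    have seg: "z = of_real (Re z) \<and> \<bar>Re z\<bar> \<ge> R + 1" if z: "z \<in> closed_segment (complex_of_real y) (of_real x)" for z
    proof -
      obtain u where u: "0 \<le> u" "u \<le> 1" "z = (1 - u) *\<^sub>R complex_of_real y + u *\<^sub>R of_real x"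
        using z unfolding closed_segment_def by auto
      then have zz: "z = of_real (y + u * (x - y))" by (simp add: scaleR_conv_of_real algebra_simps)
      have "\<bar>u * (x - y)\<bar> \<le> 1 * 1" unfolding abs_mult using u xy by (intro mult_mono) auto
      then show ?thesis using y unfolding zz by auto
    qed
    have "cmod (f (of_real x) - f (of_real y)) \<le> e * cmod (complex_of_real x - of_real y)"
    proof (rule field_differentiable_bound[of "closed_segment (complex_of_real y) (of_real x)" f "deriv f"])
      show "(f has_field_derivative deriv f z) (at z within closed_segment (complex_of_real y) (of_real x))" for z
        using holomorphic_derivI[OF PW_entire[OF f_PW] open_UNIV] has_field_derivative_at_within by blast
      show "cmod (deriv f z) \<le> e" if "z \<in> closed_segment (complex_of_real y) (of_real x)" for z
        using seg[OF that] d by metis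
    qed auto
    then have 1: "cmod (f (of_real x) - f (of_real y)) \<le> e * \<bar>x - y\<bar>" by (metis norm_of_real of_real_diff)
    have fx: "cmod (f (of_real x)) \<le> e" using R(2)[of "of_real x"] y xy by (auto simp: abs_if split: if_splits)
    have fy: "cmod (f (of_real y)) \<le> e" using small[OF y] .
    have "\<bar>(cmod (f (of_real x)))\<^sup>2 - (cmod (f (of_real y)))\<^sup>2\<bar>
       = \<bar>cmod (f (of_real x)) - cmod (f (of_real y))\<bar> * (cmod (f (of_real x)) + cmod (f (of_real y)))"
    proof -
      have "(cmod (f (of_real x)))\<^sup>2 - (cmod (f (of_real y)))\<^sup>2
        = (cmod (f (of_real x)) - cmod (f (of_real y))) * (cmod (f (of_real x)) + cmod (f (of_real y)))"
        by (simp add: power2_eq_square algebra_simps)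
      then show ?thesis by (simp add: abs_mult)
    qed
    also have "\<dots> \<le> (e * \<bar>x - y\<bar>) * (e + e)"
      using order_trans[OF norm_triangle_ineq3 1] fx fy e by (intro mult_mono) auto
    finally show "\<bar>(cmod (f (of_real x)))\<^sup>2 - (cmod (f (of_real y)))\<^sup>2\<bar> \<le> 2 * e\<^sup>2 * \<bar>x - y\<bar>"
      by (simp add: power2_eq_square mult_ac)
  qed
qed

text \<open>The trivial bound blows up at the line, so for large \<open>|Re w|\<close> the integral
  is split at distance 1 from \<open>Re w\<close>. Outside, either the density has little mass or
  the kernel is small. Inside, subtracting the density at \<open>Re w\<close> leaves a Lipschitz
  quotient, and the subtracted constant meets the bounded integral of the kernel.\<close>

lemma \<beta>_decay:
  assumes e: "e > 0"
  obtains R where "R > 0" "\<And>w. Im w \<noteq> 0 \<Longrightarrow> cmod w \<ge> R \<Longrightarrow> cmod (\<beta> w) \<le> e"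
proof -
  let ?p = "\<lambda>x. (cmod (f (complex_of_real x)))\<^sup>2"
  have ip: "integrable lborel ?p" by (rule square_integrableD[OF PW_square_integrable[OF f_PW]])
  \<comment> \<open>The near part costs \<open>4 \<delta>^2\<close> for the Lipschitz term and at
    most \<open>8 \<delta>^2\<close> for the kernel, together below \<open>e / 2\<close>.\<close>
  define \<delta> where "\<delta> = sqrt (e / 40)"
  have \<delta>: "\<delta> > 0" "\<delta>\<^sup>2 = e / 40" unfolding \<delta>_def using e by auto
  obtain R1 where R1: "R1 > 0" "\<And>x. \<bar>x\<bar> \<ge> R1 \<Longrightarrow> cmod (f (of_real x)) \<le> \<delta>"
    "\<And>x y. \<bar>y\<bar> \<ge> R1 \<Longrightarrow> \<bar>x - y\<bar> \<le> 1 \<Longrightarrow> \<bar>?p x - ?p y\<bar> \<le> 2 * \<delta>\<^sup>2 * \<bar>x - y\<bar>"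
    using f_Lipschitz[OF \<delta>(1)] by blast
  obtain M where M: "M > 0" "\<bar>LINT x|lborel. indicator {x. \<bar>x\<bar> > M} x * ?p x\<bar> < e / 4"
    using tail_integral_small[OF ip, of "e / 4"] e by auto
  define \<eta> where "\<eta> = (pw_norm f)\<^sup>2"
  have \<eta>: "\<eta> = (LINT x|lborel. ?p x)" unfolding \<eta>_def by (rule pw_norm_sq)
  have \<eta>2: "\<eta> > 0" unfolding \<eta>_def using f_pos by simp
  define U where "U = R1 + M + 4 * \<eta> / e"
  have t0: "4 * \<eta> / e > 0" using e \<eta>2 by simp
  have near: "cmod (\<beta> w) \<le> e" if w: "Im w \<noteq> 0" and u: "\<bar>Re w\<bar> \<ge> U" for w
  proof -
    let ?J = "{Re w - 1..Re w + 1}"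
    let ?q = "\<lambda>x. of_real (?p x) / (complex_of_real x - w)"
    have iq: "integrable lborel ?q" by (rule Cauchy_integrable(1)[OF ff_integrable w])
    have iJ: "integrable lborel (\<lambda>x. indicator ?J x *\<^sub>R ?q x)" "integrable lborel (\<lambda>x. indicator (-?J) x *\<^sub>R ?q x)"
      by (intro integrable_mult_indicator iq; simp)+
    have split: "\<beta> w = (LINT x|lborel. indicator ?J x *\<^sub>R ?q x) + (LINT x|lborel. indicator (-?J) x *\<^sub>R ?q x)"
    proof -
      have "\<beta> w = (LINT x|lborel. indicator ?J x *\<^sub>R ?q x + indicator (-?J) x *\<^sub>R ?q x)"
        unfolding \<beta>_def by (intro Bochner_Integration.integral_cong refl) (auto simp: indicator_def)
      then show ?thesis using iJ by simp
    qed
    have far: "cmod (LINT x|lborel. indicator (-?J) x *\<^sub>R ?q x) \<le> e / 2"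
    proof -
      define s where "s = \<bar>Re w\<bar> - M"
      have s: "s > 0" "s \<ge> 4 * \<eta> / e" using u R1(1) t0 unfolding U_def s_def by linarith+
      have i1: "integrable lborel (\<lambda>x. indicator {x. \<bar>x\<bar> > M} x * ?p x)"
        using integrable_mult_indicator[OF _ ip, of "{x. \<bar>x\<bar> > M}"] by simp
      have "cmod (LINT x|lborel. indicator (-?J) x *\<^sub>R ?q x) \<le> (LINT x|lborel. indicator {x. \<bar>x\<bar> > M} x * ?p x + ?p x / s)"
      proof (rule Bochner_Integration.integral_norm_bound_integral)
        show "integrable lborel (\<lambda>x. indicator {x. \<bar>x\<bar> > M} x * ?p x + ?p x / s)" using i1 ip by simp
        fix x :: real
        show "cmod (indicator (-?J) x *\<^sub>R ?q x) \<le> indicator {x. \<bar>x\<bar> > M} x * ?p x + ?p x / s"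
        proof (cases "x \<in> ?J")
          case True
          then show ?thesis using s by (simp add: indicator_def)
        next
          case False
          have d: "cmod (complex_of_real x - w) \<ge> \<bar>x - Re w\<bar>" using abs_Re_le_cmod[of "of_real x - w"] by simp
          have n: "cmod (indicator (-?J) x *\<^sub>R ?q x) = ?p x / cmod (complex_of_real x - w)" using False by (simp add: norm_divide del: of_real_power)
          show ?thesis
          proof (cases "\<bar>x\<bar> > M")
            case True
            have "1 \<le> cmod (complex_of_real x - w)" using False d by auto
            then have "?p x / cmod (complex_of_real x - w) \<le> ?p x / 1" by (intro divide_left_mono) auto
            moreover have "?p x / s \<ge> 0" using s by simp
            ultimately show ?thesis unfolding n using True by (simp add: indicator_def)
          next
            case False
            have "s \<le> cmod (complex_of_real x - w)" using False d unfolding s_def by linarith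
            then have "?p x / cmod (complex_of_real x - w) \<le> ?p x / s" using s by (intro divide_left_mono mult_pos_pos) auto
            then show ?thesis unfolding n using False by (simp add: indicator_def)
          qed
        qed
      qed (rule iJ)
      also have "\<dots> = (LINT x|lborel. indicator {x. \<bar>x\<bar> > M} x * ?p x) + \<eta> / s" using i1 ip \<eta> by simp
      also have "\<dots> \<le> e / 4 + e / 4"
      proof (rule add_mono)
        show "\<eta> / s \<le> e / 4" using s e by (simp add: field_simps)
      qed (use M(2) in linarith)
      finally show ?thesis by simp
    qed
    have nearJ: "cmod (LINT x|lborel. indicator ?J x *\<^sub>R ?q x) \<le> e / 2"
    proof -
      define p0 where "p0 = ?p (Re w)"
      have Rw: "\<bar>Re w\<bar> \<ge> R1" using u M(1) t0 unfolding U_def by linarith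
      have ck: "continuous_on ?J (\<lambda>x. 1 / (complex_of_real x - w))" using w by (intro continuous_intros) auto
      have cp: "continuous_on ?J (\<lambda>x. complex_of_real (?p x))"
        by (intro continuous_intros continuous_on_compose2[OF holomorphic_on_imp_continuous_on[OF PW_entire[OF f_PW]]]) auto
      have "(LINT x|lborel. indicator ?J x *\<^sub>R ?q x) = integral ?J ?q"
        using set_borel_integral_eq_integral(2)[of ?J ?q] iJ(1) unfolding set_integrable_def set_lebesgue_integral_def by simp
      also have "\<dots> = integral ?J (\<lambda>x. (of_real (?p x) - of_real p0) * (1 / (complex_of_real x - w)) + of_real p0 * (1 / (complex_of_real x - w)))"
        by (intro Henstock_Kurzweil_Integration.integral_cong) (simp add: left_diff_distrib diff_divide_distrib)
      also have "\<dots> = integral ?J (\<lambda>x. (of_real (?p x) - of_real p0) * (1 / (complex_of_real x - w))) + of_real p0 * integral ?J (\<lambda>x. 1 / (complex_of_real x - w))"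
      proof -
        have ia: "(\<lambda>x. (of_real (?p x) - of_real p0) * (1 / (complex_of_real x - w))) integrable_on ?J"
          by (intro integrable_continuous_real continuous_on_mult continuous_on_diff ck cp continuous_on_const)
        have ib: "(\<lambda>x. of_real p0 * (1 / (complex_of_real x - w))) integrable_on ?J"
          by (intro integrable_continuous_real continuous_on_mult ck continuous_on_const)
        show ?thesis unfolding Henstock_Kurzweil_Integration.integral_add[OF ia ib]
          by (simp only: Henstock_Kurzweil_Integration.integral_mult_right)
      qed
      finally have "cmod (LINT x|lborel. indicator ?J x *\<^sub>R ?q x) \<le>
         cmod (integral ?J (\<lambda>x. (of_real (?p x) - of_real p0) * (1 / (complex_of_real x - w)))) + p0 * cmod (integral ?J (\<lambda>x. 1 / (complex_of_real x - w)))"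
        using norm_triangle_ineq by (metis (no_types, lifting) abs_of_nonneg norm_mult norm_of_real p0_def zero_le_power2)
      moreover have "cmod (integral ?J (\<lambda>x. (of_real (?p x) - of_real p0) * (1 / (complex_of_real x - w)))) \<le> integral ?J (\<lambda>x. 2 * \<delta>\<^sup>2)"
      proof (rule Henstock_Kurzweil_Integration.integral_norm_bound_integral)
        fix x assume x: "x \<in> ?J"
        have nz: "cmod (complex_of_real x - w) > 0" using of_real_minus_nonreal[OF w] by simp
        have "\<bar>?p x - p0\<bar> \<le> 2 * \<delta>\<^sup>2 * \<bar>x - Re w\<bar>" unfolding p0_def using x by (intro R1(3)[OF Rw]) auto
        also have "\<dots> \<le> 2 * \<delta>\<^sup>2 * cmod (complex_of_real x - w)"
          using abs_Re_le_cmod[of "of_real x - w"] by (intro mult_left_mono) auto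
        finally have "\<bar>?p x - p0\<bar> / cmod (complex_of_real x - w) \<le> 2 * \<delta>\<^sup>2" using nz by (simp add: divide_le_eq)
        then show "cmod ((of_real (?p x) - of_real p0) * (1 / (complex_of_real x - w))) \<le> 2 * \<delta>\<^sup>2"
          by (simp add: norm_mult norm_divide flip: of_real_diff of_real_power)
      next
        show "(\<lambda>x. (of_real (?p x) - of_real p0) * (1 / (complex_of_real x - w))) integrable_on ?J"
          by (intro integrable_continuous_real continuous_on_mult continuous_on_diff ck cp continuous_on_const)
      qed (intro integrable_continuous_real continuous_on_const)
      moreover have "integral ?J (\<lambda>x. 2 * \<delta>\<^sup>2) = 4 * \<delta>\<^sup>2" by simp
      moreover have "p0 * cmod (integral ?J (\<lambda>x. 1 / (complex_of_real x - w))) \<le> \<delta>\<^sup>2 * (2 * pi)"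
        unfolding p0_def using R1(2)[OF Rw] by (intro mult_mono integral_Cauchy_kernel_bound[OF w] power_mono) auto
      moreover have "\<delta>\<^sup>2 * (2 * pi) \<le> \<delta>\<^sup>2 * 8" using pi_less_4 by (intro mult_left_mono) auto
      ultimately show ?thesis using \<delta>(2) e by linarith
    qed
    show ?thesis unfolding split using norm_triangle_mono[OF nearJ far] by simp
  qed
  define R where "R = U + \<eta> / e + 1"
  have U: "U > 0" unfolding U_def using R1(1) M(1) t0 by linarith
  have "cmod (\<beta> w) \<le> e" if w: "Im w \<noteq> 0" "cmod w \<ge> R" for w
  proof (cases "\<bar>Re w\<bar> \<ge> U")
    case True
    then show ?thesis by (rule near[OF w(1)])
  next
    case False
    have "\<bar>Im w\<bar> \<ge> \<eta> / e" using w(2) False cmod_le[of w] unfolding R_def by linarith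
    then have "\<eta> / \<bar>Im w\<bar> \<le> e" using w(1) e \<eta>2 by (simp add: field_simps)
    then show ?thesis using \<beta>_bound[OF w(1)] unfolding \<eta>_def by linarith
  qed
  moreover have "R > 0" unfolding R_def using U \<eta>2 e by (simp add: add_pos_pos)
  ultimately show ?thesis using that by blast
qed

end

section \<open>Zeros of f with positive excess as zeros of P + \<beta>\<close>

locale mixed_complement_affine = mixed_complement +
  fixes a b :: complex
  assumes D_eq: "\<And>z. D z = G z * (a + b * z)"
begin

lemma main_identity: "Im w \<noteq> 0 \<Longrightarrow> f w * A w = G w * (a + b * w + \<beta> w)"
  using D_nonreal[of w] D_eq[of w] by (simp add: algebra_simps)

lemma affine_lower:
  assumes ab: "\<not> (a = 0 \<and> b = 0)"
  obtains \<kappa> R where "\<kappa> > 0" "R > 0"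
    "\<And>w. Im w \<noteq> 0 \<Longrightarrow> cmod w \<ge> R \<Longrightarrow> \<kappa> \<le> cmod (a + b * w + \<beta> w)"
proof (cases "b = 0")
  case True
  then have a: "cmod a / 2 > 0" using ab by simp
  obtain R where R: "R > 0" "\<And>w. Im w \<noteq> 0 \<Longrightarrow> cmod w \<ge> R \<Longrightarrow> cmod (\<beta> w) \<le> cmod a / 2"
    using \<beta>_decay[OF a] by blast
  have "cmod a / 2 \<le> cmod (a + b * w + \<beta> w)" if "Im w \<noteq> 0" "cmod w \<ge> R" for w
    using R(2)[OF that] norm_triangle_ineq2[of a "- \<beta> w"] True by simp
  then show ?thesis using that[of "cmod a / 2" R] a R(1) by blast
next
  case False
  obtain R where R: "R > 0" "\<And>w. Im w \<noteq> 0 \<Longrightarrow> cmod w \<ge> R \<Longrightarrow> cmod (\<beta> w) \<le> 1"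
    using \<beta>_decay[of 1] by auto
  define R' where "R' = R + (cmod a + 2) / cmod b"
  have "1 \<le> cmod (a + b * w + \<beta> w)" if w: "Im w \<noteq> 0" "cmod w \<ge> R'" for w
  proof -
    have "(cmod a + 2) / cmod b \<ge> 0" by (intro divide_nonneg_nonneg) auto
    then have r: "cmod w \<ge> R" "cmod w \<ge> (cmod a + 2) / cmod b" using w(2) R(1) unfolding R'_def by linarith+
    then have "cmod b * cmod w \<ge> cmod a + 2" using False by (simp add: field_simps)
    moreover have "cmod (b * w) - cmod (- a - \<beta> w) \<le> cmod (a + b * w + \<beta> w)"
      using norm_triangle_ineq2[of "b * w" "- a - \<beta> w"] by (simp add: algebra_simps)
    moreover have "cmod (- a - \<beta> w) \<le> cmod a + 1" using R(2)[OF w(1) r(1)] norm_triangle_ineq4[of "- a" "\<beta> w"] by simp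
    ultimately show ?thesis by (simp add: norm_mult)
  qed
  moreover have "R' > 0" unfolding R'_def using R(1) False by (intro add_pos_nonneg) auto
  ultimately show ?thesis using that[of 1 R'] by auto
qed

text \<open>One lower bound for both cases of \<open>P\<close>: Jensen's inequality tolerates the
  loss of powers of \<open>|w|\<close>, and the factor \<open>|Im w|\<close> is what
  \<open>\<beta>\<close> alone can guarantee.\<close>

lemma ratio_lower:
  obtains \<kappa> R where "\<kappa> > 0" "R > 0"
    "\<And>w. Im w \<noteq> 0 \<Longrightarrow> cmod w \<ge> R \<Longrightarrow> \<kappa> * \<bar>Im w\<bar> / (1 + (cmod w)\<^sup>2) \<le> cmod (a + b * w + \<beta> w)"
proof (cases "a = 0 \<and> b = 0")
  case True
  obtain \<kappa> where "\<kappa> > 0" "\<And>w. Im w \<noteq> 0 \<Longrightarrow> \<kappa> * \<bar>Im w\<bar> / (1 + (cmod w)\<^sup>2) \<le> cmod (\<beta> w)"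
    using \<beta>_lower by blast
  then show ?thesis using that[of \<kappa> 1] True by simp
next
  case False
  obtain \<kappa> R where k: "\<kappa> > 0" "R > 0" "\<And>w. Im w \<noteq> 0 \<Longrightarrow> cmod w \<ge> R \<Longrightarrow> \<kappa> \<le> cmod (a + b * w + \<beta> w)"
    using affine_lower[OF False] by blast
  have "\<kappa> * \<bar>Im w\<bar> / (1 + (cmod w)\<^sup>2) \<le> cmod (a + b * w + \<beta> w)" if "Im w \<noteq> 0" "cmod w \<ge> R" for w
  proof -
    have "\<bar>Im w\<bar> \<le> 1 + (cmod w)\<^sup>2" using abs_Im_le_cmod[of w] zero_le_power2[of "cmod w - 1/2"]
      by (simp add: power2_eq_square algebra_simps)
    then have "\<kappa> * \<bar>Im w\<bar> \<le> \<kappa> * (1 + (cmod w)\<^sup>2)" using k(1) by (intro mult_left_mono) auto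
    then have "\<kappa> * \<bar>Im w\<bar> / (1 + (cmod w)\<^sup>2) \<le> \<kappa>" by (simp add: divide_le_eq add_pos_nonneg)
    then show ?thesis using k(3)[OF that] by linarith
  qed
  then show ?thesis using that k by blast
qed

text \<open>The multiplicity \<open>m\<close> of a zero \<open>t\<close> of \<open>f\<close> that is left after the simple zero of \<open>G\<close> at \<open>t \<in> L2\<close> is cancelled.\<close>

definition excess :: "complex \<Rightarrow> nat \<Rightarrow> nat" where
  "excess t m = (if t \<in> L2 then m - 1 else m)"

lemma A_zero:
  assumes l: "l \<in> L1 - {l0}" and im: "Im l \<noteq> 0"
  shows "A l = 0"
proof -
  obtain h where h: "h holomorphic_on UNIV" "\<And>z. G z = (z - l) * h z"
    using entire_divide[OF PW_entire[OF G_PW], of l] G_zero[of l] l by blast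
  have "A l = pw_inner h f" unfolding A_def pw_inner_def
  proof (intro Bochner_Integration.integral_cong refl)
    fix x :: real
    show "G (of_real x) * cnj (f (of_real x)) / (of_real x - l) = h (of_real x) * cnj (f (of_real x))"
      using of_real_minus_nonreal[OF im, of x] unfolding h(2)[of "of_real x"] by simp
  qed
  then show ?thesis using orth_quotient[OF l h] by simp
qed

text \<open>If \<open>G t\<close> is nonzero the identity at \<open>t\<close> suffices. Otherwise
  one factor \<open>w - t\<close> is cancelled near \<open>t\<close>, and the left side still
  vanishes there: through a further zero of \<open>f\<close>, or, when \<open>m = 1\<close>, because
  positive excess keeps \<open>t\<close> out of \<open>L2\<close>, so that \<open>t\<close> lies in
  \<open>L1\<close> and \<open>A t = 0\<close>.\<close>

lemma nonreal_zero:
  assumes f2: "f2 holomorphic_on UNIV" "\<And>z. f z = (z - t) ^ m * f2 z"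
    and n: "excess t m \<ge> 1" and t: "Im t \<noteq> 0"
  shows "a + b * t + \<beta> t = 0"
proof -
  have m: "m \<ge> 1" using n unfolding excess_def by (auto split: if_splits)
  have ft: "f t = 0" using f2(2)[of t] m by simp
  show ?thesis
  proof (cases "G t = 0")
    case False
    then show ?thesis using main_identity[OF t] ft by simp
  next
    case True
    then obtain h where h: "h holomorphic_on UNIV" "\<And>z. G z = (z - t) * h z"
      using entire_divide[OF PW_entire[OF G_PW]] by blast
    have tL: "t \<in> L1 \<union> L2 - {l0}" and ht: "h t \<noteq> 0" using G_zeros[OF h] by auto
    define F1 F2 where "F1 = (\<lambda>w. (w - t) ^ (m - 1) * f2 w * A w)" and "F2 = (\<lambda>w. h w * (a + b * w + \<beta> w))"
    have S: "open {w. Im w \<noteq> 0}" by (intro open_Collect_neq continuous_intros)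
    have "F1 holomorphic_on {w. Im w \<noteq> 0}" unfolding F1_def
      by (intro holomorphic_intros A_holomorphic holomorphic_on_subset[OF f2(1)]) auto
    from holomorphic_on_imp_continuous_on[OF this] have c1: "isCont F1 t" using t by (simp add: continuous_on_eq_continuous_at[OF S])
    have "F2 holomorphic_on {w. Im w \<noteq> 0}" unfolding F2_def
      by (intro holomorphic_intros \<beta>_holomorphic holomorphic_on_subset[OF h(1)]) auto
    from holomorphic_on_imp_continuous_on[OF this] have c2: "isCont F2 t" using t by (simp add: continuous_on_eq_continuous_at[OF S])
    have ev: "\<forall>\<^sub>F w in at t. F2 w = F1 w"
    proof -
      have "\<forall>\<^sub>F w in at t. w \<in> {w. Im w \<noteq> 0}" using S t by (intro eventually_at_in_open') auto
      moreover have "\<forall>\<^sub>F w in at t. w \<noteq> t" by (simp add: eventually_at_filter)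
      ultimately show ?thesis
      proof eventually_elim
        case (elim w)
        have "(w - t) * F1 w = (w - t) ^ Suc (m - 1) * f2 w * A w" unfolding F1_def by simp
        also have "\<dots> = f w * A w" using m f2(2)[of w] by simp
        also have "\<dots> = (w - t) * F2 w" using main_identity[of w] elim h(2)[of w] unfolding F2_def by (simp add: mult.assoc)
        finally show ?case using elim by simp
      qed
    qed
    have "(F1 \<longlongrightarrow> F2 t) (at t)" using Lim_transform_eventually[OF c2[unfolded isCont_def] ev] .
    from tendsto_unique[OF trivial_limit_at c1[unfolded isCont_def] this] have "F1 t = F2 t" .
    moreover have "F1 t = 0"
    proof (cases "m = 1")
      case True
      then have "t \<notin> L2" using n unfolding excess_def by (auto split: if_splits)
      then have "A t = 0" using tL t by (intro A_zero) auto
      then show ?thesis unfolding F1_def by simp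
    next
      case False
      then show ?thesis using m unfolding F1_def by simp
    qed
    ultimately show ?thesis using ht unfolding F2_def by simp
  qed
qed

text \<open>On the vertical line through \<open>t\<close> one has \<open>|x - t| <= |x - w|\<close>,
  which makes the estimate uniform as \<open>w\<close> descends to the real point
  \<open>t\<close>.\<close>

lemma Cauchy_divided:
  assumes t: "Im t = 0" and u: "square_integrable u" and v: "square_integrable v" and w: "Im w \<noteq> 0" "Re w = Re t"
  shows "cmod (LINT x|lborel. u x * v x * ((of_real x - t) / (of_real x - w))) \<le> (LINT x|lborel. cmod (u x * v x))"
    and "integrable lborel (\<lambda>x. u x * v x * ((of_real x - t) / (of_real x - w)))"
proof -
  note [measurable] = square_integrable_measurable[OF u] square_integrable_measurable[OF v]
  have b: "cmod (u x * v x * ((of_real x - t) / (of_real x - w))) \<le> cmod (u x * v x)" for x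
  proof -
    have "(cmod (of_real x - t))\<^sup>2 \<le> (cmod (of_real x - w))\<^sup>2" using t w unfolding cmod_power2 by simp
    then have "cmod (of_real x - t) \<le> cmod (of_real x - w)" by (rule power2_le_imp_le) simp
    then have "cmod ((of_real x - t) / (of_real x - w)) \<le> 1" using of_real_minus_nonreal[OF w(1), of x] by (simp add: norm_divide)
    then show ?thesis unfolding norm_mult[of "u x * v x"] by (intro mult_left_le) auto
  qed
  have i: "integrable lborel (\<lambda>x. cmod (u x * v x))" by (intro integrable_norm square_integrable_mult u v)
  show i2: "integrable lborel (\<lambda>x. u x * v x * ((of_real x - t) / (of_real x - w)))"
  proof (rule Bochner_Integration.integrable_bound[OF i])
    show "(\<lambda>x. u x * v x * ((of_real x - t) / (of_real x - w))) \<in> borel_measurable lborel" by measurable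
  qed (use b in auto)
  show "cmod (LINT x|lborel. u x * v x * ((of_real x - t) / (of_real x - w))) \<le> (LINT x|lborel. cmod (u x * v x))"
    by (rule Bochner_Integration.integral_norm_bound_integral[OF i2 i]) (rule b)
qed

text \<open>A real zero \<open>t\<close> of \<open>f\<close> gives \<open>cnj (f x)\<close> the
  factor \<open>x - t\<close>, which absorbs the singularity of the kernel.\<close>

lemma real_zero_A:
  assumes hf: "hf \<in> PW" "\<And>z. f z = (z - t) * hf z" and t: "Im t = 0"
  obtains K where "\<And>v. v > 0 \<Longrightarrow> cmod (A (t + \<i> * of_real v)) \<le> K"
proof -
  let ?u = "\<lambda>x. G (complex_of_real x)" and ?v = "\<lambda>x. cnj (hf (complex_of_real x))"
  have u: "square_integrable ?u" by (rule PW_square_integrable[OF G_PW])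
  have v: "square_integrable ?v" by (rule square_integrable_cnj[OF PW_square_integrable[OF hf(1)]])
  have tt: "cnj t = t" using t by (simp add: complex_eq_iff)
  have "cmod (A (t + \<i> * of_real v)) \<le> (LINT x|lborel. cmod (?u x * ?v x))" if "v > 0" for v
  proof -
    let ?w = "t + \<i> * of_real v"
    have "A ?w = (LINT x|lborel. ?u x * ?v x * ((of_real x - t) / (of_real x - ?w)))"
      unfolding A_def by (intro Bochner_Integration.integral_cong refl) (simp add: hf(2) tt)
    then show ?thesis using Cauchy_divided(1)[OF t u v, of ?w] that t by simp
  qed
  then show ?thesis using that by blast
qed

text \<open>Here \<open>G\<close> vanishes at \<open>t\<close> as well, and
  \<open>(x - t)^2 / (x - w) = (x - t) + (w - t) (x - t) / (x - w)\<close>. The first term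
  integrates to the inner product of \<open>G / (z - t)\<close> with \<open>f\<close>, which is 0 on
  \<open>L1\<close>; the factor \<open>w - t\<close> of the second is the gain of
  \<open>v\<close>.\<close>

lemma real_zero_A_L1:
  assumes hf: "hf \<in> PW" "\<And>z. f z = (z - t) * hf z" and t: "Im t = 0" and tL: "t \<in> L1 - {l0}"
  obtains K where "\<And>v. v > 0 \<Longrightarrow> cmod (A (t + \<i> * of_real v)) \<le> K * v"
proof -
  obtain h where h: "h holomorphic_on UNIV" "\<And>z. G z = (z - t) * h z"
    using entire_divide[OF PW_entire[OF G_PW], of t] G_zero[of t] tL by blast
  have hP: "h \<in> PW" by (rule PW_divide[OF G_PW h])
  let ?u = "\<lambda>x. h (complex_of_real x)" and ?v = "\<lambda>x. cnj (hf (complex_of_real x))"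
  have u: "square_integrable ?u" by (rule PW_square_integrable[OF hP])
  have v: "square_integrable ?v" by (rule square_integrable_cnj[OF PW_square_integrable[OF hf(1)]])
  have tt: "cnj t = t" using t by (simp add: complex_eq_iff)
  have "cmod (A (t + \<i> * of_real v)) \<le> (LINT x|lborel. cmod (?u x * ?v x)) * v" if v0: "v > 0" for v
  proof -
    let ?w = "t + \<i> * of_real v"
    have w: "Im ?w \<noteq> 0" "Re ?w = Re t" using v0 t by auto
    have "A ?w = (LINT x|lborel. ?u x * cnj (f (of_real x)) + (?w - t) * (?u x * ?v x * ((of_real x - t) / (of_real x - ?w))))"
      unfolding A_def
    proof (intro Bochner_Integration.integral_cong refl)
      fix x :: real
      have nz: "of_real x - ?w \<noteq> 0" using of_real_minus_nonreal[OF w(1), of x] .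
      have "(of_real x - t) * (of_real x - t) / (of_real x - ?w) = (of_real x - t) + (?w - t) * ((of_real x - t) / (of_real x - ?w))"
        using nz by (simp add: field_simps)
      then have "?u x * ?v x * ((of_real x - t) * (of_real x - t) / (of_real x - ?w)) = ?u x * ?v x * ((of_real x - t) + (?w - t) * ((of_real x - t) / (of_real x - ?w)))"
        by (rule arg_cong)
      then show "G (of_real x) * cnj (f (of_real x)) / (of_real x - ?w) =
        ?u x * cnj (f (of_real x)) + (?w - t) * (?u x * ?v x * ((of_real x - t) / (of_real x - ?w)))"
        unfolding h(2)[of "of_real x"] hf(2)[of "of_real x"] complex_cnj_mult complex_cnj_diff tt complex_cnj_complex_of_real
        by (simp add: distrib_left mult_ac)
    qed
    also have "\<dots> = pw_inner h f + (?w - t) * (LINT x|lborel. ?u x * ?v x * ((of_real x - t) / (of_real x - ?w)))"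
      unfolding pw_inner_def using pw_inner_integrable[OF hP f_PW] Cauchy_divided(2)[OF t u v w]
      by (simp only: Bochner_Integration.integral_add integrable_mult_right integral_mult_right_zero)
    also have "pw_inner h f = 0" by (rule orth_quotient[OF tL h])
    finally have "cmod (A ?w) = v * cmod (LINT x|lborel. ?u x * ?v x * ((of_real x - t) / (of_real x - ?w)))"
      using v0 by (simp add: norm_mult)
    also have "\<dots> \<le> v * (LINT x|lborel. cmod (?u x * ?v x))"
      using v0 by (intro mult_left_mono Cauchy_divided(1)[OF t u v w]) auto
    finally show ?thesis by (simp add: mult.commute)
  qed
  then show ?thesis using that by blast
qed

text \<open>The expansion used for \<open>A\<close> on \<open>L1\<close>, now for
  \<open>|f|^2\<close>: the boundary value of \<open>\<beta>\<close> at \<open>t\<close> is the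
  inner product of \<open>f\<close> with \<open>f / (z - t)\<close>.\<close>

lemma real_zero_\<beta>:
  assumes hf: "hf \<in> PW" "\<And>z. f z = (z - t) * hf z" and t: "Im t = 0"
  obtains K where "\<And>v. v > 0 \<Longrightarrow> cmod (\<beta> (t + \<i> * of_real v) - pw_inner f hf) \<le> K * v"
proof -
  let ?u = "\<lambda>x. hf (complex_of_real x)" and ?v = "\<lambda>x. cnj (hf (complex_of_real x))"
  have u: "square_integrable ?u" by (rule PW_square_integrable[OF hf(1)])
  have v: "square_integrable ?v" by (rule square_integrable_cnj[OF u])
  have tt: "cnj t = t" using t by (simp add: complex_eq_iff)
  have "cmod (\<beta> (t + \<i> * of_real v) - pw_inner f hf) \<le> (LINT x|lborel. cmod (?u x * ?v x)) * v" if v0: "v > 0" for v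
  proof -
    let ?w = "t + \<i> * of_real v"
    have w: "Im ?w \<noteq> 0" "Re ?w = Re t" using v0 t by auto
    have "\<beta> ?w = (LINT x|lborel. f (of_real x) * ?v x + (?w - t) * (?u x * ?v x * ((of_real x - t) / (of_real x - ?w))))"
      unfolding \<beta>_def
    proof (intro Bochner_Integration.integral_cong refl)
      fix x :: real
      have nz: "of_real x - ?w \<noteq> 0" using of_real_minus_nonreal[OF w(1), of x] .
      have "(of_real x - t) * (of_real x - t) / (of_real x - ?w) = (of_real x - t) + (?w - t) * ((of_real x - t) / (of_real x - ?w))"
        using nz by (simp add: field_simps)
      then have "?u x * ?v x * ((of_real x - t) * (of_real x - t) / (of_real x - ?w)) = ?u x * ?v x * ((of_real x - t) + (?w - t) * ((of_real x - t) / (of_real x - ?w)))"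
        by (rule arg_cong)
      then show "of_real ((cmod (f (of_real x)))\<^sup>2) / (of_real x - ?w) =
        f (of_real x) * ?v x + (?w - t) * (?u x * ?v x * ((of_real x - t) / (of_real x - ?w)))"
        unfolding complex_norm_square hf(2)[of "of_real x"] complex_cnj_mult complex_cnj_diff tt complex_cnj_complex_of_real
        by (simp add: distrib_left mult_ac)
    qed
    also have "\<dots> = pw_inner f hf + (?w - t) * (LINT x|lborel. ?u x * ?v x * ((of_real x - t) / (of_real x - ?w)))"
      unfolding pw_inner_def using pw_inner_integrable[OF f_PW hf(1)] Cauchy_divided(2)[OF t u v w]
      by (simp only: Bochner_Integration.integral_add integrable_mult_right integral_mult_right_zero)
    finally have "cmod (\<beta> ?w - pw_inner f hf) = v * cmod (LINT x|lborel. ?u x * ?v x * ((of_real x - t) / (of_real x - ?w)))"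
      using v0 by (simp add: norm_mult)
    also have "\<dots> \<le> v * (LINT x|lborel. cmod (?u x * ?v x))"
      using v0 by (intro mult_left_mono Cauchy_divided(1)[OF t u v w]) auto
    finally show ?thesis by (simp add: mult.commute)
  qed
  then show ?thesis using that by blast
qed

text \<open>Orders in \<open>v\<close> are counted along the vertical segment in the identity
  \<open>f w * A w = G w * (a + b * w + \<beta> w)\<close>. On \<open>L2\<close> the zero of
  \<open>G\<close> takes one order away, which is the 1 subtracted in \<open>excess\<close>; on
  \<open>L1\<close> it also takes one, but the vanishing of \<open>A\<close> gives it back.\<close>

lemma real_zero_bound:
  assumes f2: "f2 holomorphic_on UNIV" "\<And>z. f z = (z - t) ^ m * f2 z"
    and n: "excess t m \<ge> 1" and t: "Im t = 0"
  obtains K d where "d > 0" "\<And>v. 0 < v \<Longrightarrow> v < d \<Longrightarrow>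
      cmod (a + b * (t + \<i> * of_real v) + \<beta> (t + \<i> * of_real v)) \<le> K * v ^ excess t m"
proof -
  note concl = that
  have m: "m \<ge> 1" using n unfolding excess_def by (auto split: if_splits)
  have ft: "f t = 0" using f2(2)[of t] m by simp
  obtain hf where hf0: "hf holomorphic_on UNIV" "\<And>z. f z = (z - t) * hf z"
    using entire_divide[OF PW_entire[OF f_PW] ft] by blast
  have hf: "hf \<in> PW" by (rule PW_divide[OF f_PW hf0])
  have "compact (f2 ` cball t 1)"
    by (intro compact_continuous_image holomorphic_on_imp_continuous_on holomorphic_on_subset[OF f2(1)]) auto
  then obtain B where B: "\<And>z. z \<in> cball t 1 \<Longrightarrow> cmod (f2 z) \<le> B"
    by (metis bounded_iff compact_imp_bounded imageI)
  have B0: "B \<ge> 0" using order_trans[OF norm_ge_zero B[of t]] by simp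
  have fb: "cmod (f (t + \<i> * of_real v)) \<le> v ^ m * B" if "0 < v" "v < 1" for v
  proof -
    have "cmod (f2 (t + \<i> * of_real v)) \<le> B" using that by (intro B) (simp add: dist_norm norm_mult)
    then show ?thesis using that f2(2)[of "t + \<i> * of_real v"] by (simp add: norm_mult norm_power mult_left_mono)
  qed
  have cont_lower: "\<exists>c>0. \<exists>d>0. \<forall>v. 0 < v \<and> v < d \<longrightarrow> c \<le> cmod (h (t + \<i> * of_real v))"
    if h: "h holomorphic_on UNIV" "h t \<noteq> 0" for h
  proof -
    have "isCont h t" using holomorphic_on_imp_continuous_on[OF h(1)] by (simp add: continuous_on_eq_continuous_at)
    then obtain d where d: "d > 0" "\<And>z. dist z t < d \<Longrightarrow> dist (h z) (h t) < cmod (h t) / 2"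
      using h(2) unfolding continuous_at_eps_delta by (metis half_gt_zero zero_less_norm_iff)
    have "cmod (h t) / 2 \<le> cmod (h (t + \<i> * of_real v))" if "0 < v" "v < d" for v
      using d(2)[of "t + \<i> * of_real v"] that norm_triangle_ineq2[of "h t" "h (t + \<i> * of_real v)"]
      by (simp add: dist_norm norm_mult norm_minus_commute)
    then show ?thesis using h(2) d(1) by (intro exI[of _ "cmod (h t) / 2"] conjI exI[of _ d]) auto
  qed
  \<comment> \<open>The pair \<open>i\<close>, \<open>j\<close> is 0, 0 if \<open>G t\<close> is
    nonzero, 0, 1 on \<open>L2\<close> and 1, 1 on \<open>L1\<close>.\<close>
  have comb: ?thesis if A: "\<And>v. v > 0 \<Longrightarrow> cmod (A (t + \<i> * of_real v)) \<le> KA * v ^ i"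
     and Gl: "c > 0" "d > 0" "\<And>v. 0 < v \<Longrightarrow> v < d \<Longrightarrow> c * v ^ j \<le> cmod (G (t + \<i> * of_real v))"
     and ij: "m + i = excess t m + j" for KA i c d j
  proof (rule concl[of "min d 1" "B * KA / c"])
    show "min d 1 > 0" using Gl(2) by simp
    fix v :: real assume v: "0 < v" "v < min d 1"
    let ?w = "t + \<i> * of_real v"
    let ?P = "a + b * ?w + \<beta> ?w"
    have "cmod ?P * (c * v ^ j) \<le> cmod ?P * cmod (G ?w)" using v Gl(3)[of v] by (intro mult_left_mono) auto
    also have "\<dots> = cmod (f ?w) * cmod (A ?w)" using main_identity[of ?w] v t by (simp flip: norm_mult add: mult.commute)
    also have "\<dots> \<le> (v ^ m * B) * (KA * v ^ i)" using fb[of v] A[of v] v B0 by (intro mult_mono) auto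
    also have "\<dots> = B * KA * v ^ (m + i)" by (simp add: power_add)
    also have "\<dots> = B * KA * (v ^ excess t m * v ^ j)" unfolding ij by (simp add: power_add)
    finally have "(cmod ?P * c) * v ^ j \<le> (B * KA * v ^ excess t m) * v ^ j" by (simp add: mult_ac)
    then have "cmod ?P * c \<le> B * KA * v ^ excess t m" using v by (simp add: mult_le_cancel_right)
    then show "cmod ?P \<le> B * KA / c * v ^ excess t m" using Gl(1) by (simp add: field_simps)
  qed
  show ?thesis
  proof (cases "G t = 0")
    case False
    have "t \<notin> L2"
    proof
      assume "t \<in> L2"
      then have "t \<in> L1 \<union> L2 - {l0}" using l0 disj by auto
      then show False using G_zero False by blast
    qed
    then have ex: "excess t m = m" unfolding excess_def by simp
    obtain KA where KA: "\<And>v. v > 0 \<Longrightarrow> cmod (A (t + \<i> * of_real v)) \<le> KA" using real_zero_A[OF hf hf0(2) t] by blast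
    obtain c d where cd: "c > 0" "d > 0" "\<And>v. 0 < v \<Longrightarrow> v < d \<Longrightarrow> c \<le> cmod (G (t + \<i> * of_real v))"
      using cont_lower[OF PW_entire[OF G_PW] False] by blast
    show ?thesis by (rule comb[of KA 0 c d 0]) (use KA cd ex in auto)
  next
    case True
    then obtain h where h: "h holomorphic_on UNIV" "\<And>z. G z = (z - t) * h z"
      using entire_divide[OF PW_entire[OF G_PW]] by blast
    have tL: "t \<in> L1 \<union> L2 - {l0}" and ht: "h t \<noteq> 0" using G_zeros[OF h] by auto
    obtain c d where cd: "c > 0" "d > 0" "\<And>v. 0 < v \<Longrightarrow> v < d \<Longrightarrow> c \<le> cmod (h (t + \<i> * of_real v))"
      using cont_lower[OF h(1) ht] by blast
    have cG: "c * v ^ 1 \<le> cmod (G (t + \<i> * of_real v))" if "0 < v" "v < d" for v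
      using cd(3)[OF that] that unfolding h(2)[of "t + \<i> * of_real v"] by (simp add: norm_mult mult.commute)
    show ?thesis
    proof (cases "t \<in> L2")
      case True
      then have ex: "excess t m + 1 = m" using m unfolding excess_def by simp
      obtain KA where KA: "\<And>v. v > 0 \<Longrightarrow> cmod (A (t + \<i> * of_real v)) \<le> KA" using real_zero_A[OF hf hf0(2) t] by blast
      show ?thesis by (rule comb[of KA 0 c d 1]) (use KA cd cG ex in auto)
    next
      case False
      then have ex: "excess t m = m" unfolding excess_def by simp
      have "t \<in> L1 - {l0}" using tL False by auto
      then obtain KA where KA: "\<And>v. v > 0 \<Longrightarrow> cmod (A (t + \<i> * of_real v)) \<le> KA * v" using real_zero_A_L1[OF hf hf0(2) t] by blast
      show ?thesis by (rule comb[of KA 1 c d 1]) (use KA cd cG ex in auto)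
    qed
  qed
qed

text \<open>Far out \<open>P + \<beta>\<close> stays away from 0, also on approach to the real line,
  whereas a zero of positive excess makes it 0 at \<open>t\<close> or in the limit.\<close>

lemma zeros_bounded:
  assumes ab: "\<not> (a = 0 \<and> b = 0)"
  obtains R where "R > 0" "\<And>f2 t m. f2 holomorphic_on UNIV \<Longrightarrow> (\<And>z. f z = (z - t) ^ m * f2 z) \<Longrightarrow> excess t m \<ge> 1 \<Longrightarrow> cmod t < R"
proof -
  obtain \<kappa> R where k: "\<kappa> > 0" "R > 0" "\<And>w. Im w \<noteq> 0 \<Longrightarrow> cmod w \<ge> R \<Longrightarrow> \<kappa> \<le> cmod (a + b * w + \<beta> w)"
    using affine_lower[OF ab] by blast
  have "cmod t < R + 1" if f2: "f2 holomorphic_on UNIV" "\<And>z. f z = (z - t) ^ m * f2 z" and n: "excess t m \<ge> 1" for f2 t m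
  proof (rule ccontr)
    assume "\<not> cmod t < R + 1"
    then have tR: "cmod t \<ge> R + 1" by simp
    show False
    proof (cases "Im t = 0")
      case False
      then show False using nonreal_zero[OF f2 n False] k(3)[OF False] k(1) tR by simp
    next
      case True
      obtain K d where K: "d > 0" "\<And>v. 0 < v \<Longrightarrow> v < d \<Longrightarrow> cmod (a + b * (t + \<i> * of_real v) + \<beta> (t + \<i> * of_real v)) \<le> K * v ^ excess t m"
        using real_zero_bound[OF f2 n True] by blast
      have "\<kappa> \<le> K * v ^ excess t m" if v: "0 < v" "v < min d 1" for v
      proof -
        have "cmod (t + \<i> * of_real v) \<ge> R" using tR v norm_triangle_ineq2[of t "- \<i> * of_real v"] by (simp add: norm_mult)
        moreover have "Im (t + \<i> * of_real v) \<noteq> 0" using True v by simp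
        ultimately show ?thesis using k(3) K(2)[of v] v by fastforce
      qed
      then have "\<forall>\<^sub>F v in at_right 0. \<kappa> \<le> K * v ^ excess t m"
        using K(1) by (auto simp: eventually_at_right_field intro!: exI[of _ "min d 1"])
      moreover have "((\<lambda>v. K * v ^ excess t m) \<longlongrightarrow> K * 0 ^ excess t m) (at_right 0)"
        by (intro tendsto_intros)
      ultimately have "\<kappa> \<le> K * 0 ^ excess t m" by (intro tendsto_lowerbound) auto
      then show False using k(1) n by (cases "excess t m") auto
    qed
  qed
  note main = this
  show ?thesis
  proof (rule that)
    show "R + 1 > 0" using k(2) by simp
    show "cmod t < R + 1" if "f2 holomorphic_on UNIV" "\<And>z. f z = (z - t) ^ m * f2 z" "excess t m \<ge> 1" for f2 t m
      using that by (rule main)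
  qed
qed

text \<open>With \<open>P = 0\<close> everything is read off \<open>\<beta>\<close>: its lower bound
  excludes nonreal zeros, and along a vertical segment it decays no faster than \<open>v\<close>,
  which limits the excess to 1. Its limit 0 at \<open>t\<close> is the orthogonality of
  \<open>f\<close> and \<open>f / (z - t)\<close>.\<close>

lemma zeros_real:
  assumes ab: "a = 0" "b = 0" and f2: "f2 holomorphic_on UNIV" "\<And>z. f z = (z - t) ^ m * f2 z"
    and n: "excess t m \<ge> 1"
  shows "Im t = 0" "excess t m = 1" "\<exists>hf\<in>PW. (\<forall>z. f z = (z - t) * hf z) \<and> pw_inner f hf = 0"
proof -
  have m: "m \<ge> 1" using n unfolding excess_def by (auto split: if_splits)
  have ft: "f t = 0" using f2(2)[of t] m by simp
  obtain \<kappa> where k: "\<kappa> > 0" "\<And>w. Im w \<noteq> 0 \<Longrightarrow> \<kappa> * \<bar>Im w\<bar> / (1 + (cmod w)\<^sup>2) \<le> cmod (\<beta> w)"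
    using \<beta>_lower by blast
  show t: "Im t = 0"
  proof (rule ccontr)
    assume t: "Im t \<noteq> 0"
    have "1 + (cmod t)\<^sup>2 > 0" by (simp add: add_pos_nonneg)
    then have "\<kappa> * \<bar>Im t\<bar> / (1 + (cmod t)\<^sup>2) > 0" using k(1) t by simp
    then show False using k(2)[OF t] nonreal_zero[OF f2 n t] ab by simp
  qed
  obtain hf where hf0: "hf holomorphic_on UNIV" "\<And>z. f z = (z - t) * hf z"
    using entire_divide[OF PW_entire[OF f_PW] ft] by blast
  have hf: "hf \<in> PW" by (rule PW_divide[OF f_PW hf0])
  obtain d K where K0: "d > 0" "\<And>v. 0 < v \<Longrightarrow> v < d \<Longrightarrow> cmod (a + b * (t + \<i> * of_real v) + \<beta> (t + \<i> * of_real v)) \<le> K * v ^ excess t m"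
    using real_zero_bound[OF f2 n t] by blast
  have K: "d > 0" "\<And>v. 0 < v \<Longrightarrow> v < d \<Longrightarrow> cmod (\<beta> (t + \<i> * of_real v)) \<le> K * v ^ excess t m"
    using K0 ab by simp_all
  obtain K2 where K2: "\<And>v. v > 0 \<Longrightarrow> cmod (\<beta> (t + \<i> * of_real v) - pw_inner f hf) \<le> K2 * v"
    using real_zero_\<beta>[OF hf hf0(2) t] by blast
  have "cmod (pw_inner f hf) \<le> K * v ^ excess t m + K2 * v" if "0 < v" "v < d" for v
    using K(2)[OF that] K2[OF that(1)] norm_triangle_ineq4[of "\<beta> (t + \<i> * of_real v)" "\<beta> (t + \<i> * of_real v) - pw_inner f hf"] by simp
  then have "\<forall>\<^sub>F v in at_right 0. cmod (pw_inner f hf) \<le> K * v ^ excess t m + K2 * v"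
    using K(1) by (auto simp: eventually_at_right_field intro!: exI[of _ d])
  moreover have "((\<lambda>v. K * v ^ excess t m + K2 * v) \<longlongrightarrow> K * 0 ^ excess t m + K2 * 0) (at_right 0)"
    by (intro tendsto_intros)
  ultimately have "cmod (pw_inner f hf) \<le> K * 0 ^ excess t m + K2 * 0" by (intro tendsto_lowerbound) auto
  then have "pw_inner f hf = 0" using n by (cases "excess t m") auto
  then show "\<exists>hf\<in>PW. (\<forall>z. f z = (z - t) * hf z) \<and> pw_inner f hf = 0" using hf hf0 by blast
  show "excess t m = 1"
  proof (rule ccontr)
    assume "excess t m \<noteq> 1"
    then obtain j where j: "excess t m = Suc (Suc j)" using n by (metis One_nat_def Suc_le_D old.nat.exhaust)
    define c where "c = \<kappa> / (1 + (cmod t + 1)\<^sup>2)"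
    have c: "c > 0" unfolding c_def using k(1) by (simp add: add_pos_nonneg)
    have "c \<le> K * v ^ Suc j" if v: "0 < v" "v < min d 1" for v
    proof -
      let ?w = "t + \<i> * of_real v"
      have "cmod ?w \<le> cmod t + 1" using v norm_triangle_ineq[of t "\<i> * of_real v"] by (simp add: norm_mult)
      then have "(cmod ?w)\<^sup>2 \<le> (cmod t + 1)\<^sup>2" by (intro power_mono) auto
      then have "c * v \<le> \<kappa> * \<bar>Im ?w\<bar> / (1 + (cmod ?w)\<^sup>2)"
        unfolding c_def using v t k(1) by (auto intro!: divide_left_mono mult_pos_pos add_pos_nonneg)
      also have "\<dots> \<le> cmod (\<beta> ?w)" using v t by (intro k(2)) auto
      also have "\<dots> \<le> K * v ^ Suc (Suc j)" using K(2)[of v] v j by simp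
      finally have "c * v \<le> (K * v ^ Suc j) * v" by (simp add: mult_ac)
      then show ?thesis using v by (simp add: mult_le_cancel_right)
    qed
    then have "\<forall>\<^sub>F v in at_right 0. c \<le> K * v ^ Suc j"
      using K(1) by (auto simp: eventually_at_right_field intro!: exI[of _ "min d 1"])
    moreover have "((\<lambda>v. K * v ^ Suc j) \<longlongrightarrow> K * 0 ^ Suc j) (at_right 0)"
      by (intro tendsto_intros)
    ultimately have "c \<le> K * 0 ^ Suc j" by (intro tendsto_lowerbound) auto
    then show False using c by simp
  qed
qed

end

subsection \<open>The case \<open>P = 0\<close>\<close>

text \<open>Telescoping: for \<open>d <= m\<close> the term \<open>1 / m^2\<close> is at most
  \<open>2 / (d m) - 2 / (d (m + d))\<close>, and once the smallest point \<open>m\<close> is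
  removed the rest begins at \<open>m + d\<close>.\<close>

lemma separated_sum_pos:
  fixes T :: "real set"
  assumes "finite T" and d: "d > 0"
  shows "d \<le> r \<Longrightarrow> (\<And>t. t \<in> T \<Longrightarrow> r \<le> t) \<Longrightarrow> (\<And>s t. s \<in> T \<Longrightarrow> t \<in> T \<Longrightarrow> s \<noteq> t \<Longrightarrow> d \<le> \<bar>s - t\<bar>)
    \<Longrightarrow> (\<Sum>t\<in>T. 1 / t\<^sup>2) \<le> 2 / (d * r)"
  using assms(1)
proof (induction T arbitrary: r rule: finite_linorder_min_induct)
  case empty
  then show ?case using d by simp
next
  case (insert m A)
  have m: "m \<ge> r" "m > 0" using insert.prems(1,2) d by (auto intro: less_le_trans)
  have "(\<Sum>t\<in>A. 1 / t\<^sup>2) \<le> 2 / (d * (m + d))"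
  proof (rule insert.IH)
    fix t assume t: "t \<in> A"
    then have "m < t" using insert.hyps by auto
    moreover have "d \<le> \<bar>m - t\<bar>" using insert.prems(3)[of m t] t \<open>m < t\<close> by auto
    ultimately show "m + d \<le> t" by linarith
  qed (use m insert.prems in auto)
  moreover have "m \<notin> A" using insert.hyps by auto
  ultimately have "(\<Sum>t\<in>insert m A. 1 / t\<^sup>2) \<le> 1 / m\<^sup>2 + 2 / (d * (m + d))" using insert.hyps by simp
  also have "\<dots> \<le> 2 / (d * m)"
  proof -
    have md: "m + d > 0" using m d by simp
    have "2 / (d * m) - 2 / (d * (m + d)) = 2 / (m * (m + d))"
    proof -
      have "m \<noteq> 0" "d \<noteq> 0" "m + d \<noteq> 0" using m d md by auto
      then show ?thesis by (simp add: divide_simps)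
    qed
    moreover have "1 / m\<^sup>2 \<le> 2 / (m * (m + d))"
    proof -
      have "m * (m + d) \<le> 2 * m\<^sup>2" using insert.prems(1) m d by (simp add: power2_eq_square algebra_simps)
      then have "2 / (2 * m\<^sup>2) \<le> 2 / (m * (m + d))" using m md by (intro divide_left_mono mult_pos_pos) auto
      then show ?thesis by simp
    qed
    ultimately show ?thesis by simp
  qed
  also have "\<dots> \<le> 2 / (d * r)" using m d insert.prems(1) by (intro divide_left_mono mult_left_mono mult_pos_pos) auto
  finally show ?case .
qed

lemma separated_sum:
  fixes T :: "real set"
  assumes T: "finite T" and d: "d > 0" "d \<le> r"
    and far: "\<And>t. t \<in> T \<Longrightarrow> r \<le> \<bar>x - t\<bar>"
    and sep: "\<And>s t. s \<in> T \<Longrightarrow> t \<in> T \<Longrightarrow> s \<noteq> t \<Longrightarrow> d \<le> \<bar>s - t\<bar>"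
  shows "(\<Sum>t\<in>T. 1 / (x - t)\<^sup>2) \<le> 4 / (d * r)"
proof -
  define P N where "P = {t\<in>T. x < t}" and "N = {t\<in>T. \<not> x < t}"
  have PN: "T = P \<union> N" "P \<inter> N = {}" "finite P" "finite N" using T unfolding P_def N_def by auto
  have "(\<Sum>t\<in>P. 1 / (x - t)\<^sup>2) = (\<Sum>u\<in>(\<lambda>t. t - x) ` P. 1 / u\<^sup>2)"
    by (subst sum.reindex) (auto simp: inj_on_def power2_commute[of x])
  also have "\<dots> \<le> 2 / (d * r)"
  proof (rule separated_sum_pos[OF _ d])
    show "r \<le> v" if "v \<in> (\<lambda>t. t - x) ` P" for v using that far by (fastforce simp: P_def)
    show "d \<le> \<bar>v - v'\<bar>" if v: "v \<in> (\<lambda>t. t - x) ` P" "v' \<in> (\<lambda>t. t - x) ` P" "v \<noteq> v'" for v v'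
    proof -
      obtain t t' where "t \<in> T" "t' \<in> T" "v = (t - x)" "v' = (t' - x)" "t \<noteq> t'" using v unfolding P_def by blast
      then show ?thesis using sep[of t t'] by (simp add: abs_minus_commute)
    qed
  qed (use PN in auto)
  finally have 1: "(\<Sum>t\<in>P. 1 / (x - t)\<^sup>2) \<le> 2 / (d * r)" .
  have "(\<Sum>t\<in>N. 1 / (x - t)\<^sup>2) = (\<Sum>u\<in>(\<lambda>t. x - t) ` N. 1 / u\<^sup>2)"
    by (subst sum.reindex) (auto simp: inj_on_def)
  also have "\<dots> \<le> 2 / (d * r)"
  proof (rule separated_sum_pos[OF _ d])
    show "r \<le> v" if "v \<in> (\<lambda>t. x - t) ` N" for v using that far by (fastforce simp: N_def)
    show "d \<le> \<bar>v - v'\<bar>" if v: "v \<in> (\<lambda>t. x - t) ` N" "v' \<in> (\<lambda>t. x - t) ` N" "v \<noteq> v'" for v v'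
    proof -
      obtain t t' where "t \<in> T" "t' \<in> T" "v = (x - t)" "v' = (x - t')" "t \<noteq> t'" using v unfolding N_def by blast
      then show ?thesis using sep[of t t'] by (simp add: abs_minus_commute)
    qed
  qed (use PN in auto)
  finally have 2: "(\<Sum>t\<in>N. 1 / (x - t)\<^sup>2) \<le> 2 / (d * r)" .
  show ?thesis unfolding PN(1) using 1 2 by (subst sum.union_disjoint[OF PN(3,4,2)]) simp
qed

text \<open>By the point bound an interval of length \<open>2 \<rho>\<close> carries at most the
  fraction \<open>2 \<rho> C^2\<close> of the squared norm; \<open>\<rho>\<close> makes this
  fraction one half.\<close>

lemma PW_mass_away:
  obtains \<rho> where "\<rho> > 0"
    "\<And>h t. h \<in> PW \<Longrightarrow> (pw_norm h)\<^sup>2 \<le> 2 * (LINT x|lborel. indicator {x. \<rho> \<le> \<bar>x - t\<bar>} x * (cmod (h (of_real x)))\<^sup>2)"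
proof -
  obtain C where C: "C > 0" "\<And>f w. f \<in> PW \<Longrightarrow> cmod (f w) \<le> C * exp (pi * \<bar>Im w\<bar>) * pw_norm f"
    using PW_point_bound by blast
  define \<rho> where "\<rho> = 1 / (4 * C\<^sup>2)"
  have \<rho>: "\<rho> > 0" unfolding \<rho>_def using C(1) by simp
  have "(pw_norm h)\<^sup>2 \<le> 2 * (LINT x|lborel. indicator {x. \<rho> \<le> \<bar>x - t\<bar>} x * (cmod (h (of_real x)))\<^sup>2)" if h: "h \<in> PW" for h t
  proof -
    let ?p = "\<lambda>x. (cmod (h (complex_of_real x)))\<^sup>2"
    let ?S = "{x::real. \<rho> \<le> \<bar>x - t\<bar>}"
    have ip: "integrable lborel ?p" by (rule square_integrableD[OF PW_square_integrable[OF h]])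
    have i1: "integrable lborel (\<lambda>x. indicator ?S x * ?p x)"
      using integrable_mult_indicator[OF _ ip, of ?S] by simp
    have i2: "integrable lborel (\<lambda>x. indicator {t-\<rho>..t+\<rho>} x * (C\<^sup>2 * (pw_norm h)\<^sup>2))"
      by (intro integrable_mult_left integrable_real_indicator) (auto simp: emeasure_lborel_Icc_eq)
    have "(pw_norm h)\<^sup>2 = (LINT x|lborel. ?p x)" by (rule pw_norm_sq)
    also have "\<dots> \<le> (LINT x|lborel. indicator ?S x * ?p x + indicator {t-\<rho>..t+\<rho>} x * (C\<^sup>2 * (pw_norm h)\<^sup>2))"
    proof (rule integral_mono)
      fix x
      show "?p x \<le> indicator ?S x * ?p x + indicator {t-\<rho>..t+\<rho>} x * (C\<^sup>2 * (pw_norm h)\<^sup>2)"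
      proof (cases "x \<in> ?S")
        case True
        then show ?thesis by simp
      next
        case False
        have "?p x \<le> (C * pw_norm h)\<^sup>2" using C(2)[OF h, of "of_real x"] by (intro power_mono) auto
        then show ?thesis using False by (auto simp: indicator_def power_mult_distrib abs_le_iff)
      qed
    qed (use ip i1 i2 in auto)
    also have "\<dots> = (LINT x|lborel. indicator ?S x * ?p x) + 2 * \<rho> * (C\<^sup>2 * (pw_norm h)\<^sup>2)"
      using i1 i2 \<rho> by (simp add: Bochner_Integration.integral_add)
    also have "2 * \<rho> * (C\<^sup>2 * (pw_norm h)\<^sup>2) = (pw_norm h)\<^sup>2 / 2" unfolding \<rho>_def using C(1) by simp
    finally show ?thesis by simp
  qed
  then show ?thesis using that \<rho> by blast
qed

section \<open>The orthogonal quotients f / (z - t)\<close>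

context mixed_complement
begin

text \<open>If \<open>P = 0\<close>, every zero of \<open>f\<close> with positive excess lies in \<open>Zs\<close>: the condition \<open>pw_inner f h = 0\<close>
expresses that \<open>\<beta>\<close> vanishes there.\<close>

definition Zs :: "real set" where
  "Zs = {t. \<exists>h\<in>PW. (\<forall>z. f z = (z - of_real t) * h z) \<and> pw_inner f h = 0}"

definition u :: "real \<Rightarrow> complex \<Rightarrow> complex" where
  "u t = (SOME h. h \<in> PW \<and> (\<forall>z. f z = (z - of_real t) * h z) \<and> pw_inner f h = 0)"

lemma u_props:
  assumes "t \<in> Zs"
  shows "u t \<in> PW" "f z = (z - of_real t) * u t z" "pw_inner f (u t) = 0"
proof -
  have "\<exists>h. h \<in> PW \<and> (\<forall>z. f z = (z - of_real t) * h z) \<and> pw_inner f h = 0" using assms unfolding Zs_def by blast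
  from someI_ex[OF this] show "u t \<in> PW" "f z = (z - of_real t) * u t z" "pw_inner f (u t) = 0"
    unfolding u_def by blast+
qed

text \<open>On the line \<open>(s - t) * u s * cnj (u t) = u s * cnj f - f * cnj (u t)\<close> holds
  pointwise, and both terms on the right integrate to 0.\<close>

lemma u_orthogonal:
  assumes s: "s \<in> Zs" and t: "t \<in> Zs" and st: "s \<noteq> t"
  shows "pw_inner (u s) (u t) = 0"
proof -
  have "of_real (s - t) * pw_inner (u s) (u t) = (LINT x|lborel. of_real (s - t) * (u s (of_real x) * cnj (u t (of_real x))))"
    unfolding pw_inner_def by (rule integral_mult_right_zero[symmetric])
  also have "\<dots> = (LINT x|lborel. u s (of_real x) * cnj (f (of_real x)) - f (of_real x) * cnj (u t (of_real x)))"
  proof (intro Bochner_Integration.integral_cong refl)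
    fix x :: real
    have "u s (of_real x) * cnj (f (of_real x)) - f (of_real x) * cnj (u t (of_real x))
      = u s (of_real x) * cnj ((of_real x - of_real t) * u t (of_real x)) - ((of_real x - of_real s) * u s (of_real x)) * cnj (u t (of_real x))"
      using u_props(2)[OF s, of "of_real x"] u_props(2)[OF t, of "of_real x"] by metis
    also have "\<dots> = of_real (s - t) * (u s (of_real x) * cnj (u t (of_real x)))"
      by (simp add: algebra_simps)
    finally show "of_real (s - t) * (u s (of_real x) * cnj (u t (of_real x))) = u s (of_real x) * cnj (f (of_real x)) - f (of_real x) * cnj (u t (of_real x))" ..
  qed
  also have "\<dots> = pw_inner (u s) f - pw_inner f (u t)"
    unfolding pw_inner_def
    by (rule Bochner_Integration.integral_diff[OF pw_inner_integrable[OF u_props(1)[OF s] f_PW] pw_inner_integrable[OF f_PW u_props(1)[OF t]]])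
  also have "\<dots> = 0" using u_props(3)[OF s] u_props(3)[OF t] pw_inner_commute[of "u s" f] by simp
  finally show ?thesis using st by simp
qed

lemma u_pos: "t \<in> Zs \<Longrightarrow> pw_norm (u t) > 0"
proof -
  assume t: "t \<in> Zs"
  have "pw_norm (u t) \<noteq> 0"
  proof
    assume "pw_norm (u t) = 0"
    then have "u t z = 0" for z using PW_norm_eq_0[OF u_props(1)[OF t]] by blast
    then have "f z = 0" for z using u_props(2)[OF t, of z] by simp
    then show False using f_pos unfolding pw_norm_def by simp
  qed
  then show ?thesis using pw_norm_nonneg[of "u t"] by simp
qed

text \<open>The divided difference \<open>v\<close> satisfies \<open>(z - s) * v z = u t z\<close>.
  Half of its mass lies at distance \<open>\<rho>\<close> or more from \<open>s\<close>, so its norm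
  is at most \<open>sqrt 2 / \<rho>\<close> times that of \<open>u t\<close>; orthogonality of
  \<open>u s\<close> and \<open>u t\<close> makes it at least \<open>1 / |t - s|\<close> times that
  norm.\<close>

lemma u_separation:
  assumes \<rho>: "\<rho> > 0"
    "\<And>h t. h \<in> PW \<Longrightarrow> (pw_norm h)\<^sup>2 \<le> 2 * (LINT x|lborel. indicator {x. \<rho> \<le> \<bar>x - t\<bar>} x * (cmod (h (of_real x)))\<^sup>2)"
    and s: "s \<in> Zs" and t: "t \<in> Zs" and st: "s \<noteq> t"
  shows "\<rho> / 2 \<le> \<bar>s - t\<bar>"
proof -
  define v where "v = (\<lambda>z. of_real (1 / (t - s)) * (u t z - u s z))"
  have vP: "v \<in> PW" unfolding v_def by (intro PW_cmult PW_diff u_props s t)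
  have vc: "(z - of_real s) * v z = u t z" for z
  proof -
    have "(z - of_real s) * (u t z - u s z) = (z - of_real s) * u t z - (z - of_real t) * u t z"
      using u_props(2)[OF s, of z] u_props(2)[OF t, of z] by (simp add: right_diff_distrib)
    also have "\<dots> = of_real (t - s) * u t z" by (simp add: algebra_simps)
    finally show ?thesis unfolding v_def using st by (simp add: field_simps)
  qed
  have nt: "(pw_norm (u t))\<^sup>2 > 0" using u_pos[OF t] by simp
  have "(pw_norm v)\<^sup>2 \<le> 2 * (LINT x|lborel. indicator {x. \<rho> \<le> \<bar>x - s\<bar>} x * (cmod (v (of_real x)))\<^sup>2)" by (rule \<rho>(2)[OF vP])
  also have "\<dots> \<le> 2 * (LINT x|lborel. (cmod (u t (of_real x)))\<^sup>2 / \<rho>\<^sup>2)"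
  proof (intro mult_left_mono integral_mono)
    show "integrable lborel (\<lambda>x. indicator {x. \<rho> \<le> \<bar>x - s\<bar>} x * (cmod (v (of_real x)))\<^sup>2)"
      using integrable_mult_indicator[OF _ square_integrableD[OF PW_square_integrable[OF vP]], of "{x. \<rho> \<le> \<bar>x - s\<bar>}"] by simp
    show "integrable lborel (\<lambda>x. (cmod (u t (of_real x)))\<^sup>2 / \<rho>\<^sup>2)"
      by (intro integrable_divide_zero square_integrableD[OF PW_square_integrable[OF u_props(1)[OF t]]])
    fix x :: real
    show "indicator {x. \<rho> \<le> \<bar>x - s\<bar>} x * (cmod (v (of_real x)))\<^sup>2 \<le> (cmod (u t (of_real x)))\<^sup>2 / \<rho>\<^sup>2"
    proof (cases "\<rho> \<le> \<bar>x - s\<bar>")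
      case True
      have "cmod (u t (of_real x)) = \<bar>x - s\<bar> * cmod (v (of_real x))"
        unfolding vc[of "of_real x", symmetric] norm_mult by (metis norm_of_real of_real_diff)
      then have "\<rho> * cmod (v (of_real x)) \<le> cmod (u t (of_real x))" using True by (simp add: mult_right_mono)
      then have "(\<rho> * cmod (v (of_real x)))\<^sup>2 \<le> (cmod (u t (of_real x)))\<^sup>2" using \<rho>(1) by (intro power_mono) auto
      then show ?thesis using \<rho>(1) True by (simp add: power_mult_distrib field_simps)
    next
      case False
      then show ?thesis by simp
    qed
  qed auto
  also have "\<dots> = 2 * ((pw_norm (u t))\<^sup>2 / \<rho>\<^sup>2)" unfolding pw_norm_sq by simp
  finally have v1: "(pw_norm v)\<^sup>2 \<le> 2 * ((pw_norm (u t))\<^sup>2 / \<rho>\<^sup>2)" .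
  have "(pw_norm v)\<^sup>2 = (1 / (t - s))\<^sup>2 * (pw_norm (\<lambda>z. u t z - u s z))\<^sup>2"
    unfolding v_def pw_norm_cmult by (simp add: power_mult_distrib power_divide del: of_real_divide of_real_diff)
  also have "(pw_norm (\<lambda>z. u t z - u s z))\<^sup>2 = (pw_norm (u t))\<^sup>2 + (pw_norm (u s))\<^sup>2"
    using pw_norm_sq_diff[OF u_props(1)[OF t] u_props(1)[OF s]] u_orthogonal[OF t s] st by simp
  finally have "(1 / (t - s))\<^sup>2 * (pw_norm (u t))\<^sup>2 \<le> (pw_norm v)\<^sup>2" by (simp add: algebra_simps)
  with v1 have "(1 / (t - s))\<^sup>2 * (pw_norm (u t))\<^sup>2 \<le> (2 / \<rho>\<^sup>2) * (pw_norm (u t))\<^sup>2" by simp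
  then have "(1 / (t - s))\<^sup>2 \<le> 2 / \<rho>\<^sup>2" using nt by (rule mult_right_le_imp_le)
  then have "\<rho>\<^sup>2 \<le> 2 * (t - s)\<^sup>2" using \<rho>(1) st by (simp add: power_divide field_simps)
  then have "\<rho>\<^sup>2 / 4 \<le> (t - s)\<^sup>2" using zero_le_power2[of "t - s"] by linarith
  then have "(\<rho> / 2)\<^sup>2 \<le> (t - s)\<^sup>2" by (simp add: power_divide)
  then have "(\<rho> / 2)\<^sup>2 \<le> \<bar>s - t\<bar>\<^sup>2" using power2_commute[of s t] by simp
  then show ?thesis by (rule power2_le_imp_le) simp
qed

lemma u_sum_norm:
  assumes "finite T" "T \<subseteq> Zs"
  shows "(\<lambda>z. \<Sum>t\<in>T. u t z) \<in> PW" "(pw_norm (\<lambda>z. \<Sum>t\<in>T. u t z))\<^sup>2 = (\<Sum>t\<in>T. (pw_norm (u t))\<^sup>2)"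
proof -
  show "(\<lambda>z. \<Sum>t\<in>T. u t z) \<in> PW" using assms by (intro PW_sum u_props) auto
  have "(pw_norm (\<lambda>z. \<Sum>t\<in>T. u t z))\<^sup>2 = (\<Sum>t\<in>T. (pw_norm (u t))\<^sup>2) \<and> (\<forall>s\<in>Zs - T. pw_inner (\<lambda>z. \<Sum>t\<in>T. u t z) (u s) = 0)"
    using assms
  proof (induction T rule: finite_induct)
    case empty
    then show ?case by (simp add: pw_norm_def pw_inner_def)
  next
    case (insert t T)
    have tZ: "t \<in> Zs" and TZ: "T \<subseteq> Zs" using insert.prems by auto
    have P: "(\<lambda>z. \<Sum>t\<in>T. u t z) \<in> PW" using TZ by (intro PW_sum u_props) auto
    have IH: "(pw_norm (\<lambda>z. \<Sum>t\<in>T. u t z))\<^sup>2 = (\<Sum>t\<in>T. (pw_norm (u t))\<^sup>2)"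
      "\<And>s. s \<in> Zs - T \<Longrightarrow> pw_inner (\<lambda>z. \<Sum>t\<in>T. u t z) (u s) = 0" using insert.IH[OF TZ] by auto
    have eq: "(\<lambda>z. \<Sum>t\<in>insert t T. u t z) = (\<lambda>z. u t z + (\<Sum>t\<in>T. u t z))" using insert.hyps by simp
    have 0: "pw_inner (u t) (\<lambda>z. \<Sum>t\<in>T. u t z) = 0"
      using IH(2)[of t] tZ insert.hyps(2) pw_inner_commute[of "u t" "\<lambda>z. \<Sum>t\<in>T. u t z"] by simp
    have "(pw_norm (\<lambda>z. \<Sum>t\<in>insert t T. u t z))\<^sup>2 = (\<Sum>t\<in>insert t T. (pw_norm (u t))\<^sup>2)"
      unfolding eq pw_norm_sq_add[OF u_props(1)[OF tZ] P] 0 IH(1) using insert.hyps by simp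
    moreover have "pw_inner (\<lambda>z. \<Sum>t\<in>insert t T. u t z) (u s) = 0" if "s \<in> Zs - insert t T" for s
      unfolding eq using pw_inner_add_left[OF u_props(1)[OF tZ] P u_props(1), of s] that IH(2)[of s] u_orthogonal[OF tZ, of s] by auto
    ultimately show ?case by blast
  qed
  then show "(pw_norm (\<lambda>z. \<Sum>t\<in>T. u t z))\<^sup>2 = (\<Sum>t\<in>T. (pw_norm (u t))\<^sup>2)" by blast
qed

lemma u_Cauchy:
  assumes t: "t \<in> Zs" and w: "Im w \<noteq> 0"
  shows "integrable lborel (\<lambda>x. f (of_real x) / (of_real x - w) * cnj (u t (of_real x)))"
    and "(LINT x|lborel. f (of_real x) / (of_real x - w) * cnj (u t (of_real x))) = \<beta> w / (w - of_real t)"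
proof -
  let ?q = "\<lambda>x. f (complex_of_real x) / (of_real x - w) * cnj (u t (of_real x))"
  have "integrable lborel (\<lambda>x. f (of_real x) * cnj (u t (of_real x)) / (of_real x - w))"
    by (rule Cauchy_integrable(1)[OF pw_inner_integrable[OF f_PW u_props(1)[OF t]] w])
  then show i: "integrable lborel ?q" by (simp add: mult_ac)
  have "\<beta> w = (LINT x|lborel. f (of_real x) * cnj (u t (of_real x)) + (w - of_real t) * ?q x)"
    unfolding \<beta>_def
  proof (intro Bochner_Integration.integral_cong refl)
    fix x :: real
    have nz: "of_real x - w \<noteq> 0" using of_real_minus_nonreal[OF w, of x] .
    have "(of_real x - of_real t) / (of_real x - w) = 1 + (w - of_real t) / (of_real x - w)"
      using nz by (simp add: field_simps)
    then have "f (of_real x) * cnj (u t (of_real x)) * ((of_real x - of_real t) / (of_real x - w))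
       = f (of_real x) * cnj (u t (of_real x)) * (1 + (w - of_real t) / (of_real x - w))" by (rule arg_cong)
    moreover have "cnj (f (of_real x)) = (of_real x - of_real t) * cnj (u t (of_real x))"
      using u_props(2)[OF t, of "of_real x"] by simp
    ultimately show "of_real ((cmod (f (of_real x)))\<^sup>2) / (of_real x - w) = f (of_real x) * cnj (u t (of_real x)) + (w - of_real t) * ?q x"
      unfolding complex_norm_square by (simp add: distrib_left mult_ac)
  qed
  also have "\<dots> = pw_inner f (u t) + (w - of_real t) * (LINT x|lborel. ?q x)"
    unfolding pw_inner_def using pw_inner_integrable[OF f_PW u_props(1)[OF t]] i
    by (simp only: Bochner_Integration.integral_add integrable_mult_right integral_mult_right_zero)
  also have "pw_inner f (u t) = 0" by (rule u_props(3)[OF t])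
  finally have "\<beta> w = (w - of_real t) * (LINT x|lborel. ?q x)" by simp
  moreover have "w - of_real t \<noteq> 0" using w by (auto simp: complex_eq_iff)
  ultimately show "(LINT x|lborel. ?q x) = \<beta> w / (w - of_real t)" by simp
qed

text \<open>Testing \<open>\<Sum>t\<in>T. u t\<close> against \<open>f / (x - \<i> R)\<close>: as \<open>pw_inner f (u t) = 0\<close>, each \<open>t\<close> contributes
\<open>\<beta> (\<i> R) / (\<i> R - t)\<close>, and these terms do not cancel because the imaginary parts of \<open>1 / (\<i> R - t)\<close> all have
the same sign.\<close>

lemma count_by_norms:
  obtains C where "C > 0" "\<And>T R. finite T \<Longrightarrow> T \<subseteq> Zs \<Longrightarrow> R \<ge> 1 \<Longrightarrow> (\<And>t. t \<in> T \<Longrightarrow> \<bar>t\<bar> \<le> R) \<Longrightarrow>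
     real (card T) \<le> C * R * sqrt (\<Sum>t\<in>T. (pw_norm (u t))\<^sup>2)"
proof -
  obtain \<kappa> where k: "\<kappa> > 0" "\<And>w. Im w \<noteq> 0 \<Longrightarrow> \<kappa> * \<bar>Im w\<bar> / (1 + (cmod w)\<^sup>2) \<le> cmod (\<beta> w)"
    using \<beta>_lower by blast
  define C where "C = 4 * pw_norm f / \<kappa>"
  have C: "C > 0" unfolding C_def using k(1) f_pos by simp
  have "real (card T) \<le> C * R * sqrt (\<Sum>t\<in>T. (pw_norm (u t))\<^sup>2)"
    if T: "finite T" "T \<subseteq> Zs" and R: "R \<ge> 1" and tR: "\<And>t. t \<in> T \<Longrightarrow> \<bar>t\<bar> \<le> R" for T R
  proof -
    define w where "w = \<i> * complex_of_real R"
    have w: "Im w = R" "Re w = 0" "cmod w = R" "Im w \<noteq> 0" unfolding w_def using R by (auto simp: norm_mult)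
    define h where "h = (\<lambda>z. \<Sum>t\<in>T. u t z)"
    have hP: "h \<in> PW" and hn: "(pw_norm h)\<^sup>2 = (\<Sum>t\<in>T. (pw_norm (u t))\<^sup>2)" unfolding h_def using u_sum_norm[OF T] by auto
    define \<psi> where "\<psi> = (\<lambda>x. f (complex_of_real x) / (of_real x - w))"
    have \<psi>b: "cmod (\<psi> x) \<le> (1 / R) * cmod (f (of_real x))" for x
    proof -
      have "R \<le> cmod (of_real x - w)" using abs_Im_le_cmod[of "of_real x - w"] w(1) by simp
      then have "cmod (f (of_real x)) / cmod (of_real x - w) \<le> cmod (f (of_real x)) / R" using R by (intro frac_le) auto
      then show ?thesis unfolding \<psi>_def norm_divide by simp
    qed
    have \<psi>: "square_integrable \<psi>"
      by (rule square_integrable_bound[OF PW_square_integrable[OF f_PW] _ \<psi>b]) (unfold \<psi>_def, measurable)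
    have n\<psi>: "sqrt (LINT x|lborel. (cmod (\<psi> x))\<^sup>2) \<le> pw_norm f / R"
    proof -
      have "(LINT x|lborel. (cmod (\<psi> x))\<^sup>2) \<le> (LINT x|lborel. (1 / R)\<^sup>2 * (cmod (f (of_real x)))\<^sup>2)"
      proof (intro integral_mono square_integrableD[OF \<psi>] integrable_mult_right square_integrableD[OF PW_square_integrable[OF f_PW]])
        show "(cmod (\<psi> x))\<^sup>2 \<le> (1 / R)\<^sup>2 * (cmod (f (of_real x)))\<^sup>2" for x
          using power_mono[OF \<psi>b[of x], of 2] by (simp add: power_mult_distrib power_divide)
      qed
      also have "\<dots> = (1 / R)\<^sup>2 * (pw_norm f)\<^sup>2" unfolding pw_norm_sq by (rule integral_mult_right_zero)
      also have "\<dots> = (pw_norm f / R)\<^sup>2" by (simp add: power_divide)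
      finally have "sqrt (LINT x|lborel. (cmod (\<psi> x))\<^sup>2) \<le> sqrt ((pw_norm f / R)\<^sup>2)" by (rule real_sqrt_le_mono)
      then show ?thesis using R f_pos by simp
    qed
    have "(LINT x|lborel. \<psi> x * cnj (h (of_real x))) = (LINT x|lborel. (\<Sum>t\<in>T. f (of_real x) / (of_real x - w) * cnj (u t (of_real x))))"
      unfolding \<psi>_def h_def by (simp add: sum_distrib_left)
    also have "\<dots> = (\<Sum>t\<in>T. \<beta> w / (w - of_real t))"
      using u_Cauchy[OF _ w(4)] T(2) by (subst Bochner_Integration.integral_sum) (auto intro!: sum.cong)
    finally have I: "(LINT x|lborel. \<psi> x * cnj (h (of_real x))) = \<beta> w * (\<Sum>t\<in>T. 1 / (w - of_real t))"
      by (simp add: sum_distrib_left)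
    have "cmod (LINT x|lborel. \<psi> x * cnj (h (of_real x))) \<le> (pw_norm f / R) * pw_norm h"
      using square_integrable_Cauchy_Schwarz_norm[OF \<psi> square_integrable_cnj[OF PW_square_integrable[OF hP]]]
        mult_right_mono[OF n\<psi> pw_norm_nonneg[of h]] unfolding pw_norm_def[of h] by simp
    then have up: "cmod (\<beta> w) * cmod (\<Sum>t\<in>T. 1 / (w - of_real t)) \<le> (pw_norm f / R) * pw_norm h" unfolding I norm_mult .
    have lo2: "real (card T) / (2 * R) \<le> cmod (\<Sum>t\<in>T. 1 / (w - of_real t))"
    proof -
      have "Im (1 / (w - of_real t)) \<le> - (1 / (2 * R))" if t: "t \<in> T" for t
      proof -
        have "Im (1 / (w - of_real t)) = - R / (t\<^sup>2 + R\<^sup>2)" using w(1,2) by (simp add: Im_divide)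
        moreover have "1 / (2 * R) \<le> R / (t\<^sup>2 + R\<^sup>2)"
        proof -
          have "t\<^sup>2 \<le> R\<^sup>2" using power_mono[OF tR[OF t], of 2] by simp
          then have "t\<^sup>2 + R\<^sup>2 \<le> 2 * R * R" by (simp add: power2_eq_square)
          moreover have "t\<^sup>2 + R\<^sup>2 > 0" using R by (simp add: add_nonneg_pos)
          ultimately show ?thesis using R by (simp add: field_simps)
        qed
        ultimately show ?thesis by simp
      qed
      then have "Im (\<Sum>t\<in>T. 1 / (w - of_real t)) \<le> (\<Sum>t\<in>T. - (1 / (2 * R)))" unfolding Im_sum by (intro sum_mono) auto
      then have "real (card T) / (2 * R) \<le> \<bar>Im (\<Sum>t\<in>T. 1 / (w - of_real t))\<bar>" by simp
      then show ?thesis using abs_Im_le_cmod order_trans by blast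
    qed
    have lo1: "\<kappa> / (2 * R) \<le> cmod (\<beta> w)"
    proof -
      have "1 + R\<^sup>2 \<le> 2 * R * R" using R by (simp add: power2_eq_square mult_ge1_I)
      then have "\<kappa> * (1 + R\<^sup>2) \<le> \<kappa> * (2 * R * R)" using k(1) by (intro mult_left_mono) auto
      moreover have "1 + R\<^sup>2 > 0" by (simp add: add_pos_nonneg)
      ultimately have "\<kappa> / (2 * R) \<le> \<kappa> * R / (1 + R\<^sup>2)" using R by (simp add: divide_le_eq le_divide_eq mult_ac)
      also have "\<dots> \<le> cmod (\<beta> w)" using k(2)[OF w(4)] w R by simp
      finally show ?thesis .
    qed
    have "(\<kappa> / (2 * R)) * (real (card T) / (2 * R)) \<le> (pw_norm f / R) * pw_norm h"
      using mult_mono[OF lo1 lo2] up R k(1) by fastforce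
    then have "real (card T) \<le> C * R * pw_norm h" unfolding C_def using R k(1) by (simp add: field_simps)
    moreover have "pw_norm h = sqrt (\<Sum>t\<in>T. (pw_norm (u t))\<^sup>2)" unfolding hn[symmetric] using pw_norm_nonneg[of h] by simp
    ultimately show ?thesis by simp
  qed
  then show ?thesis using that C by blast
qed

text \<open>The mass of \<open>u t\<close> near \<open>t\<close> is controlled by the mass away from \<open>t\<close>, where \<open>|u t| = |f| / |x - t|\<close>; the
sum over \<open>t\<close> of \<open>1 / (x - t)\<^sup>2\<close> is bounded by separation.\<close>

lemma norms_small:
  assumes e: "e > 0"
  obtains L where "L \<ge> 1" "\<And>T. finite T \<Longrightarrow> T \<subseteq> Zs \<Longrightarrow> (\<And>t. t \<in> T \<Longrightarrow> L \<le> \<bar>t\<bar>) \<Longrightarrow> (\<Sum>t\<in>T. (pw_norm (u t))\<^sup>2) \<le> e"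
proof -
  obtain \<rho> where \<rho>: "\<rho> > 0"
    "\<And>h t. h \<in> PW \<Longrightarrow> (pw_norm h)\<^sup>2 \<le> 2 * (LINT x|lborel. indicator {x. \<rho> \<le> \<bar>x - t\<bar>} x * (cmod (h (of_real x)))\<^sup>2)"
    using PW_mass_away by blast
  define d where "d = \<rho> / 2"
  have d: "d > 0" "d \<le> \<rho>" unfolding d_def using \<rho>(1) by auto
  have sep: "d \<le> \<bar>s - t\<bar>" if "s \<in> Zs" "t \<in> Zs" "s \<noteq> t" for s t unfolding d_def by (rule u_separation[OF \<rho> that])
  let ?p = "\<lambda>x. (cmod (f (complex_of_real x)))\<^sup>2"
  have ip: "integrable lborel ?p" by (rule square_integrableD[OF PW_square_integrable[OF f_PW]])
  define \<eta> where "\<eta> = (LINT x|lborel. ?p x)"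
  have \<eta>0: "\<eta> \<ge> 0" unfolding \<eta>_def by (intro integral_nonneg_AE) auto
  \<comment> \<open>Chosen together with \<open>r\<close> so that the integrals over the outside and
    the inside of \<open>[-M, M]\<close> each contribute at most \<open>e / 2\<close>; the 16
    collects the 2 of the mass estimate, the 4 of the separated sum and this halving.\<close>
  define e1 where "e1 = e * (d * \<rho>) / 16"
  have e1: "e1 > 0" unfolding e1_def using e d \<rho>(1) by simp
  obtain M where M: "M > 0" "\<bar>LINT x|lborel. indicator {x. \<bar>x\<bar> > M} x * ?p x\<bar> < e1"
    using tail_integral_small[OF ip e1] by blast
  define r where "r = \<rho> + 1 + 16 * \<eta> / (e * d)"
  have q0: "16 * \<eta> / (e * d) \<ge> 0" using \<eta>0 e d by simp
  have r: "r \<ge> \<rho>" "r \<ge> 1" "r \<ge> 16 * \<eta> / (e * d)" unfolding r_def using \<rho>(1) q0 by linarith+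
  have "(\<Sum>t\<in>T. (pw_norm (u t))\<^sup>2) \<le> e" if T: "finite T" "T \<subseteq> Zs" "\<And>t. t \<in> T \<Longrightarrow> M + r \<le> \<bar>t\<bar>" for T
  proof -
    let ?I = "\<lambda>t x. indicator {x. \<rho> \<le> \<bar>x - t\<bar>} x * (cmod (u t (of_real x)))\<^sup>2"
    have iI: "integrable lborel (?I t)" if "t \<in> T" for t
    proof -
      have "u t \<in> PW" using that T(2) by (intro u_props) auto
      then show ?thesis
        using integrable_mult_indicator[OF _ square_integrableD[OF PW_square_integrable], of "{x. \<rho> \<le> \<bar>x - t\<bar>}" "u t"] by simp
    qed
    have iM: "integrable lborel (\<lambda>x. indicator {x. \<bar>x\<bar> > M} x * ?p x)"
      using integrable_mult_indicator[OF _ ip, of "{x. \<bar>x\<bar> > M}"] by simp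
    have pt: "(\<Sum>t\<in>T. ?I t x) \<le> (4 / (d * r)) * ?p x + (4 / (d * \<rho>)) * (indicator {x. \<bar>x\<bar> > M} x * ?p x)" for x
    proof -
      define T' where "T' = {t\<in>T. \<rho> \<le> \<bar>x - t\<bar>}"
      have T': "finite T'" "T' \<subseteq> Zs" using T unfolding T'_def by auto
      have ueq: "(cmod (u t (of_real x)))\<^sup>2 = ?p x * (1 / (x - t)\<^sup>2)" if t: "t \<in> T'" for t
      proof -
        have "t \<in> Zs" "x \<noteq> t" using t T' \<rho>(1) unfolding T'_def by auto
        have "cmod (f (of_real x)) = \<bar>x - t\<bar> * cmod (u t (of_real x))"
          unfolding u_props(2)[OF \<open>t \<in> Zs\<close>, of "of_real x"] norm_mult by (metis norm_of_real of_real_diff)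
        then have "?p x = (x - t)\<^sup>2 * (cmod (u t (of_real x)))\<^sup>2" by (simp add: power_mult_distrib)
        then show ?thesis using \<open>x \<noteq> t\<close> by simp
      qed
      have "(\<Sum>t\<in>T. ?I t x) = (\<Sum>t\<in>T'. (cmod (u t (of_real x)))\<^sup>2)"
        unfolding T'_def using T(1) by (intro sum.mono_neutral_cong_right) (auto simp: indicator_def)
      also have "\<dots> = (\<Sum>t\<in>T'. ?p x * (1 / (x - t)\<^sup>2))" by (intro sum.cong refl ueq)
      also have "\<dots> = ?p x * (\<Sum>t\<in>T'. 1 / (x - t)\<^sup>2)" by (rule sum_distrib_left[symmetric])
      finally have eq: "(\<Sum>t\<in>T. ?I t x) = ?p x * (\<Sum>t\<in>T'. 1 / (x - t)\<^sup>2)" .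
      have sT: "d \<le> \<bar>s - t\<bar>" if "s \<in> T'" "t \<in> T'" "s \<noteq> t" for s t using sep that T' by blast
      show ?thesis
      proof (cases "\<bar>x\<bar> > M")
        case True
        have "(\<Sum>t\<in>T'. 1 / (x - t)\<^sup>2) \<le> 4 / (d * \<rho>)"
          by (rule separated_sum[OF T'(1) d _ sT]) (auto simp: T'_def)
        then have "?p x * (\<Sum>t\<in>T'. 1 / (x - t)\<^sup>2) \<le> ?p x * (4 / (d * \<rho>))" by (intro mult_left_mono) auto
        moreover have "(4 / (d * r)) * ?p x \<ge> 0" using d r by simp
        ultimately show ?thesis unfolding eq using True by (simp add: mult.commute)
      next
        case False
        have "(\<Sum>t\<in>T'. 1 / (x - t)\<^sup>2) \<le> 4 / (d * r)"
        proof (rule separated_sum[OF T'(1) d(1) _ _ sT])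
          show "d \<le> r" using d r by linarith
          fix t assume "t \<in> T'"
          then have "M + r \<le> \<bar>t\<bar>" using T(3) unfolding T'_def by auto
          then show "r \<le> \<bar>x - t\<bar>" using False by linarith
        qed
        then have "?p x * (\<Sum>t\<in>T'. 1 / (x - t)\<^sup>2) \<le> ?p x * (4 / (d * r))" by (intro mult_left_mono) auto
        then show ?thesis unfolding eq using False by (simp add: mult.commute)
      qed
    qed
    have "(\<Sum>t\<in>T. (pw_norm (u t))\<^sup>2) \<le> (\<Sum>t\<in>T. 2 * (LINT x|lborel. ?I t x))"
      using T(2) by (intro sum_mono \<rho>(2) u_props) auto
    also have "\<dots> = 2 * (LINT x|lborel. (\<Sum>t\<in>T. ?I t x))"
      using iI by (simp add: sum_distrib_left Bochner_Integration.integral_sum)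
    also have "\<dots> \<le> 2 * (LINT x|lborel. (4 / (d * r)) * ?p x + (4 / (d * \<rho>)) * (indicator {x. \<bar>x\<bar> > M} x * ?p x))"
    proof (intro mult_left_mono integral_mono)
      show "integrable lborel (\<lambda>x. \<Sum>t\<in>T. ?I t x)" by (rule Bochner_Integration.integrable_sum[OF iI])
      show "integrable lborel (\<lambda>x. (4 / (d * r)) * ?p x + (4 / (d * \<rho>)) * (indicator {x. \<bar>x\<bar> > M} x * ?p x))"
        by (intro Bochner_Integration.integrable_add integrable_mult_right ip iM)
    qed (use pt in auto)
    also have "\<dots> = 2 * ((4 / (d * r)) * \<eta> + (4 / (d * \<rho>)) * (LINT x|lborel. indicator {x. \<bar>x\<bar> > M} x * ?p x))"
      unfolding \<eta>_def using ip iM by (simp only: Bochner_Integration.integral_add integrable_mult_right integral_mult_right_zero)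
    also have "\<dots> \<le> 2 * (e / 4 + e / 4)"
    proof (intro mult_left_mono add_mono)
      show "(4 / (d * r)) * \<eta> \<le> e / 4" using r d e by (simp add: field_simps)
      have "(4 / (d * \<rho>)) * (LINT x|lborel. indicator {x. \<bar>x\<bar> > M} x * ?p x) \<le> (4 / (d * \<rho>)) * e1"
        using M(2) d \<rho>(1) by (intro mult_left_mono) auto
      also have "\<dots> = e / 4" unfolding e1_def using d \<rho>(1) by simp
      finally show "(4 / (d * \<rho>)) * (LINT x|lborel. indicator {x. \<bar>x\<bar> > M} x * ?p x) \<le> e / 4" .
    qed auto
    finally show ?thesis by simp
  qed
  moreover have "M + r \<ge> 1" using M(1) r(2) by simp
  ultimately show ?thesis using that by blast
qed

text \<open>The squared norms enter the count through a square root, so the points are taken so far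
  out that the squared norms add up to at most \<open>(e / C)^2\<close>.\<close>

lemma Zs_sparse:
  assumes e: "e > 0"
  obtains L where "L \<ge> 1" "\<And>T R. finite T \<Longrightarrow> T \<subseteq> Zs \<Longrightarrow> R > 0 \<Longrightarrow> (\<And>t. t \<in> T \<Longrightarrow> L \<le> \<bar>t\<bar> \<and> \<bar>t\<bar> \<le> R) \<Longrightarrow> real (card T) \<le> e * R"
proof -
  obtain C where C: "C > 0" "\<And>T R. finite T \<Longrightarrow> T \<subseteq> Zs \<Longrightarrow> R \<ge> 1 \<Longrightarrow> (\<And>t. t \<in> T \<Longrightarrow> \<bar>t\<bar> \<le> R) \<Longrightarrow>
     real (card T) \<le> C * R * sqrt (\<Sum>t\<in>T. (pw_norm (u t))\<^sup>2)" using count_by_norms by blast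
  have e2: "(e / C)\<^sup>2 > 0" using e C(1) by simp
  obtain L where L: "L \<ge> 1" "\<And>T. finite T \<Longrightarrow> T \<subseteq> Zs \<Longrightarrow> (\<And>t. t \<in> T \<Longrightarrow> L \<le> \<bar>t\<bar>) \<Longrightarrow> (\<Sum>t\<in>T. (pw_norm (u t))\<^sup>2) \<le> (e / C)\<^sup>2"
    using norms_small[OF e2] by blast
  have "real (card T) \<le> e * R" if T: "finite T" "T \<subseteq> Zs" "R > 0" "\<And>t. t \<in> T \<Longrightarrow> L \<le> \<bar>t\<bar> \<and> \<bar>t\<bar> \<le> R" for T R
  proof (cases "T = {}")
    case True
    then show ?thesis using e T(3) by simp
  next
    case False
    then obtain t where "t \<in> T" by blast
    then have R: "R \<ge> 1" using T(4)[of t] L(1) by linarith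
    have "(\<Sum>t\<in>T. (pw_norm (u t))\<^sup>2) \<le> (e / C)\<^sup>2" using T by (intro L(2)) auto
    then have "sqrt (\<Sum>t\<in>T. (pw_norm (u t))\<^sup>2) \<le> e / C" using e C(1) by (metis divide_nonneg_pos less_eq_real_def real_sqrt_le_mono real_sqrt_unique)
    then have "C * R * sqrt (\<Sum>t\<in>T. (pw_norm (u t))\<^sup>2) \<le> C * R * (e / C)" using C(1) R by (intro mult_left_mono) auto
    also have "\<dots> = e * R" using C(1) by simp
    finally show ?thesis using C(2)[OF T(1,2) R] T(4) by fastforce
  qed
  then show ?thesis using that L(1) by blast
qed

end

subsection \<open>Comparing the zeros of \<open>f\<close> and \<open>G\<close>\<close>

lemma entire_factor_order:
  fixes F :: "complex \<Rightarrow> complex"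
  assumes F: "F holomorphic_on UNIV" and t: "F t = 0" and a: "F a \<noteq> 0"
  obtains m h where "m \<ge> 1" "h holomorphic_on UNIV" "h t \<noteq> 0" "\<And>z. F z = (z - t) ^ m * h z"
proof -
  have nc: "\<not> F constant_on UNIV"
  proof
    assume "F constant_on UNIV"
    then obtain y where "\<And>x. F x = y" unfolding constant_on_def by auto
    then show False using t a by metis
  qed
  note fac = holomorphic_factor_zero_nonconstant[OF F open_UNIV connected_UNIV UNIV_I t nc]
  have "\<exists>g r n. 0 < (n::nat) \<and> 0 < r \<and> g holomorphic_on ball t r \<and> (\<forall>w\<in>ball t r. F w = (w - t) ^ n * g w) \<and> (\<forall>w\<in>ball t r. g w \<noteq> 0)"
    by (rule fac, intro exI conjI, assumption+) simp_all
  then obtain g r n where g: "0 < n" "0 < r" "g holomorphic_on ball t r"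
      "\<And>w. w \<in> ball t r \<Longrightarrow> F w = (w - t) ^ n * g w" "\<And>w. w \<in> ball t r \<Longrightarrow> g w \<noteq> 0"
    by (elim exE conjE) metis
  define h where "h = (\<lambda>z. if z = t then g t else F z / (z - t) ^ n)"
  have "h holomorphic_on ball t r \<union> (- {t})"
  proof (rule holomorphic_on_Un)
    show "h holomorphic_on ball t r"
    proof (rule holomorphic_transform[OF g(3)])
      show "g w = h w" if "w \<in> ball t r" for w
        using g(4)[OF that] by (cases "w = t") (simp_all add: h_def)
    qed
    have "(\<lambda>z. F z / (z - t) ^ n) holomorphic_on - {t}"
      by (intro holomorphic_intros holomorphic_on_subset[OF F]) auto
    then show "h holomorphic_on - {t}" by (rule holomorphic_transform) (auto simp: h_def)
  qed auto
  moreover have "ball t r \<union> (- {t}) = UNIV" using g(2) by auto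
  ultimately have "h holomorphic_on UNIV" by simp
  moreover have "h t \<noteq> 0" using g(5)[of t] g(2) by (simp add: h_def)
  moreover have "F z = (z - t) ^ n * h z" for z using t g(1) by (simp add: h_def)
  ultimately show ?thesis using that[of n h] g(1) by simp
qed

lemma factor_exponent_le:
  fixes h1 h2 :: "complex \<Rightarrow> complex"
  assumes h1: "h1 holomorphic_on UNIV" and h2: "h2 holomorphic_on UNIV" "h2 t \<noteq> 0"
    and eq: "\<And>z. (z - t) ^ m * h1 z = (z - t) ^ n * h2 z"
  shows "m \<le> n"
proof (rule ccontr)
  assume "\<not> m \<le> n"
  then obtain j where j: "m = n + Suc j" by (metis add_Suc_right less_imp_Suc_add not_le)
  have c: "isCont h1 t" "isCont h2 t"
    using holomorphic_on_imp_continuous_on[OF h1] holomorphic_on_imp_continuous_on[OF h2(1)] by (simp_all add: continuous_on_eq_continuous_at)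
  have ev: "\<forall>\<^sub>F z in at t. (z - t) ^ Suc j * h1 z = h2 z"
  proof -
    have "(z - t) ^ Suc j * h1 z = h2 z" if "z \<noteq> t" for z
      using eq[of z] that unfolding j by (simp add: power_add mult.assoc)
    then show ?thesis by (simp add: eventually_at_filter)
  qed
  have "((\<lambda>z. (z - t) ^ Suc j * h1 z) \<longlongrightarrow> (t - t) ^ Suc j * h1 t) (at t)"
    using c(1) unfolding isCont_def by (intro tendsto_intros)
  from Lim_transform_eventually[OF this ev] have "(h2 \<longlongrightarrow> 0) (at t)" by simp
  from tendsto_unique[OF trivial_limit_at this c(2)[unfolded isCont_def]] show False using h2(2) by simp
qed

lemma entire_finite_zeros:
  fixes F :: "complex \<Rightarrow> complex"
  assumes F: "F holomorphic_on UNIV" and a: "F a \<noteq> 0" and K: "compact K"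
  shows "finite {z\<in>K. F z = 0}"
proof (cases "F constant_on UNIV")
  case True
  then have "{z\<in>K. F z = 0} = {}" using a unfolding constant_on_def by auto
  then show ?thesis by (metis finite.emptyI)
next
  case False
  then show ?thesis by (intro holomorphic_compact_finite_zeros[OF F open_UNIV connected_UNIV K]) auto
qed

text \<open>Induction on the number of zeros in \<open>K\<close>: dividing out one zero with its
  full multiplicity leaves the orders at the others unchanged.\<close>

lemma entire_zero_factorization:
  fixes F :: "complex \<Rightarrow> complex"
  assumes "F holomorphic_on UNIV" "F a \<noteq> 0" and K: "compact K"
  obtains m F1 where "F1 holomorphic_on UNIV" "\<And>z. z \<in> K \<Longrightarrow> F1 z \<noteq> 0"
    "\<And>z. F z = (\<Prod>t\<in>{z\<in>K. F z = 0}. (z - t) ^ m t) * F1 z"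
    "\<And>t. t \<in> {z\<in>K. F z = 0} \<Longrightarrow> m t \<ge> 1 \<and> (\<exists>h. h holomorphic_on UNIV \<and> h t \<noteq> 0 \<and> (\<forall>z. F z = (z - t) ^ m t * h z))"
proof -
  have "\<exists>m F1. F1 holomorphic_on UNIV \<and> (\<forall>z\<in>K. F1 z \<noteq> 0) \<and> (\<forall>z. F z = (\<Prod>t\<in>{z\<in>K. F z = 0}. (z - t) ^ m t) * F1 z)
      \<and> (\<forall>t\<in>{z\<in>K. F z = 0}. m t \<ge> 1 \<and> (\<exists>h. h holomorphic_on UNIV \<and> h t \<noteq> 0 \<and> (\<forall>z. F z = (z - t) ^ m t * h z)))"
    using assms(1,2)
  proof (induction "card {z\<in>K. F z = 0}" arbitrary: F)
    case 0
    then have "{z\<in>K. F z = 0} = {}" using entire_finite_zeros[OF 0(2,3) K] by simp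
    note E = this
    then have "\<forall>z\<in>K. F z \<noteq> 0" by blast
    then show ?case unfolding E using 0(2) by (intro exI[of _ "\<lambda>_. 1"] exI[of _ F]) simp
  next
    case (Suc n)
    have fin: "finite {z\<in>K. F z = 0}" using entire_finite_zeros[OF Suc(3,4) K] .
    have "{z\<in>K. F z = 0} \<noteq> {}" using Suc(2) by (metis card.empty nat.distinct(1))
    then obtain t where t: "t \<in> K" "F t = 0" by auto
    obtain k h where h: "k \<ge> 1" "h holomorphic_on UNIV" "h t \<noteq> 0" "\<And>z. F z = (z - t) ^ k * h z"
      using entire_factor_order[OF Suc(3) t(2) Suc(4)] by blast
    have Z: "{z\<in>K. F z = 0} = insert t {z\<in>K. h z = 0}" "t \<notin> {z\<in>K. h z = 0}" using h t by auto
    have finh: "finite {z\<in>K. h z = 0}" using fin Z by (metis finite_insert)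
    have ha: "h a \<noteq> 0" using h(4)[of a] Suc(4) by auto
    have "n = card {z\<in>K. h z = 0}" using Suc(2) Z finh by simp
    from Suc(1)[OF this h(2) ha] obtain m F1 where m: "F1 holomorphic_on UNIV" "\<And>z. z \<in> K \<Longrightarrow> F1 z \<noteq> 0"
      "\<And>z. h z = (\<Prod>t\<in>{z\<in>K. h z = 0}. (z - t) ^ m t) * F1 z"
      "\<And>t. t \<in> {z\<in>K. h z = 0} \<Longrightarrow> m t \<ge> 1 \<and> (\<exists>h'. h' holomorphic_on UNIV \<and> h' t \<noteq> 0 \<and> (\<forall>z. h z = (z - t) ^ m t * h' z))" by blast
    have "F z = (\<Prod>s\<in>{z\<in>K. F z = 0}. (z - s) ^ (m(t := k)) s) * F1 z" for z
    proof -
      have "(\<Prod>s\<in>{z\<in>K. F z = 0}. (z - s) ^ (m(t := k)) s) = (z - t) ^ k * (\<Prod>s\<in>{z\<in>K. h z = 0}. (z - s) ^ (m(t := k)) s)"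
        unfolding Z(1) using finh Z(2) by simp
      also have "(\<Prod>s\<in>{z\<in>K. h z = 0}. (z - s) ^ (m(t := k)) s) = (\<Prod>s\<in>{z\<in>K. h z = 0}. (z - s) ^ m s)"
        using Z(2) by (intro prod.cong) auto
      finally show ?thesis using h(4)[of z] m(3)[of z] by simp
    qed
    moreover have "(m(t := k)) s \<ge> 1 \<and> (\<exists>h'. h' holomorphic_on UNIV \<and> h' s \<noteq> 0 \<and> (\<forall>z. F z = (z - s) ^ (m(t := k)) s * h' z))"
      if s: "s \<in> {z\<in>K. F z = 0}" for s
    proof (cases "s = t")
      case True
      then show ?thesis using h by auto
    next
      case False
      then have sh: "s \<in> {z\<in>K. h z = 0}" using s Z by auto
      then obtain h' where h': "h' holomorphic_on UNIV" "h' s \<noteq> 0" "\<And>z. h z = (z - s) ^ m s * h' z" using m(4) by blast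
      have "(\<lambda>z. (z - t) ^ k * h' z) holomorphic_on UNIV" by (intro holomorphic_intros h')
      moreover have "(s - t) ^ k * h' s \<noteq> 0" using False h' by simp
      moreover have "F z = (z - s) ^ m s * ((z - t) ^ k * h' z)" for z unfolding h(4)[of z] h'(3)[of z] by simp
      ultimately show ?thesis using m(4)[OF sh] False by auto
    qed
    ultimately show ?case using m(1,2) by (intro exI[of _ "m(t := k)"] exI[of _ F1]) blast
  qed
  then obtain m F1 where 1: "F1 holomorphic_on UNIV" and 2: "\<forall>z\<in>K. F1 z \<noteq> 0"
    and 3: "\<forall>z. F z = (\<Prod>t\<in>{z\<in>K. F z = 0}. (z - t) ^ m t) * F1 z"
    and 4: "\<forall>t\<in>{z\<in>K. F z = 0}. m t \<ge> 1 \<and> (\<exists>h. h holomorphic_on UNIV \<and> h t \<noteq> 0 \<and> (\<forall>z. F z = (z - t) ^ m t * h z))"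
    by (elim exE conjE)
  show ?thesis by (rule that[OF 1 2[rule_format] 3[rule_format] 4[rule_format]])
qed

text \<open>On the circle \<open>r^2 = s * cnj s\<close>, hence
  \<open>s^2 - r^2 = s * (s - cnj s)\<close>; since \<open>a\<close> is real, \<open>s\<close> and
  \<open>z\<close> have the same imaginary part.\<close>

lemma real_center_circle:
  assumes a: "a \<in> \<real>" and z: "cmod (z - a) = r"
  shows "cmod ((z - a)\<^sup>2 - of_real (r\<^sup>2)) = 2 * r * \<bar>Im z\<bar>"
proof -
  define s where "s = z - a"
  have s: "s * cnj s = of_real (r\<^sup>2)" using z complex_norm_square[of s] unfolding s_def by simp
  have "s\<^sup>2 - of_real (r\<^sup>2) = s * (s - cnj s)" unfolding s[symmetric] by (simp add: power2_eq_square algebra_simps)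
  also have "cmod \<dots> = r * (2 * \<bar>Im s\<bar>)" using z unfolding norm_mult s_def[symmetric] complex_diff_cnj by (simp add: norm_mult)
  also have "Im s = Im z" unfolding s_def using a by (auto simp: complex_is_Real_iff)
  finally show ?thesis unfolding s_def by simp
qed

text \<open>Jensen's inequality for \<open>G / F\<close> in multiplicative form. The factor \<open>(z - a)\<^sup>2 - r\<^sup>2\<close> vanishes at the two
  real points of the circle, so that a bound blowing up towards the real axis suffices.\<close>

lemma jensen_quotient:
  fixes F G :: "complex \<Rightarrow> complex"
  assumes F: "F holomorphic_on UNIV" "F a \<noteq> 0" and G: "G holomorphic_on UNIV" "G a \<noteq> 0"
    and a: "a \<in> \<real>" and r: "r > 0"
    and F1: "F1 holomorphic_on UNIV" "\<And>z. z \<in> cball a r \<Longrightarrow> F1 z \<noteq> 0"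
      "\<And>z. F z = (\<Prod>t\<in>T. (z - t) ^ m t) * F1 z" and T: "finite T" "T \<subseteq> ball a r"
    and G1: "G1 holomorphic_on UNIV"
      "\<And>z. G z = (\<Prod>s\<in>S. (z - s)) * G1 z" and S: "finite S" "S \<subseteq> ball a r"
    and bound: "\<And>z. cmod (z - a) = r \<Longrightarrow> Im z \<noteq> 0 \<Longrightarrow> (2 * r * \<bar>Im z\<bar>)\<^sup>2 * cmod (G z) \<le> B * cmod (F z)"
    and B: "B \<ge> 0"
  shows "r ^ 4 * cmod (G a) * (\<Prod>s\<in>S. r / cmod (s - a)) \<le> B * cmod (F a) * (\<Prod>t\<in>T. (r / cmod (t - a)) ^ m t)"
proof -
  \<comment> \<open>The reflected factor of a zero \<open>s\<close> in the disc: on the circle it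
    has the modulus of \<open>z - s\<close>, it has no zero in the closed disc, and its value at the
    centre is \<open>r\<close>.\<close>
  define b where "b = (\<lambda>s z. (of_real (r\<^sup>2) - cnj (s - a) * (z - a)) / of_real r)"
  \<comment> \<open>The quadratic is squared because \<open>G / F\<close> may blow up like
    \<open>1 / (Im z)^2\<close>; at the centre it leaves the factor \<open>r ^ 4\<close>.\<close>
  define W where "W = (\<lambda>z. ((z - a)\<^sup>2 - of_real (r\<^sup>2))\<^sup>2 * G1 z * (\<Prod>s\<in>S. b s z) / (F1 z * (\<Prod>t\<in>T. b t z ^ m t)))"
  have bn: "cmod (b s z) = cmod (z - s)" if "cmod (z - a) = r" for s z
  proof -
    have ca: "cnj a = a" using a by (simp add: complex_is_Real_iff complex_eq_iff)
    have "of_real (r\<^sup>2) = (z - a) * cnj (z - a)" using that complex_norm_square[of "z - a"] by simp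
    then have "of_real (r\<^sup>2) - cnj (s - a) * (z - a) = (z - a) * cnj (z - s)" by (simp add: algebra_simps)
    then show ?thesis unfolding b_def using that r by (simp add: norm_divide norm_mult del: complex_cnj_diff)
  qed
  have bnz: "b s z \<noteq> 0" if "s \<in> ball a r" "z \<in> cball a r" for s z
  proof
    assume "b s z = 0"
    then have "of_real (r\<^sup>2) = cnj (s - a) * (z - a)" unfolding b_def using r by simp
    then have "cmod (of_real (r\<^sup>2)) = cmod (s - a) * cmod (z - a)" by (metis complex_mod_cnj norm_mult)
    then have "r\<^sup>2 = cmod (s - a) * cmod (z - a)" by (simp add: norm_power)
    also have "\<dots> \<le> cmod (s - a) * r" using that by (intro mult_left_mono) (auto simp: dist_norm norm_minus_commute)
    also have "\<dots> < r * r" using that r by (intro mult_strict_right_mono) (auto simp: dist_norm norm_minus_commute)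
    finally show False by (simp add: power2_eq_square)
  qed
  have ba: "b s a = of_real r" for s unfolding b_def using r by (simp add: power2_eq_square)
  have holW: "W holomorphic_on cball a r" unfolding W_def b_def
  proof (intro holomorphic_intros holomorphic_on_subset[OF F1(1)] holomorphic_on_subset[OF G1(1)])
    fix z assume z: "z \<in> cball a r"
    show "F1 z * (\<Prod>t\<in>T. ((of_real (r\<^sup>2) - cnj (t - a) * (z - a)) / of_real r) ^ m t) \<noteq> 0"
    proof -
      have "F1 z * (\<Prod>t\<in>T. b t z ^ m t) \<noteq> 0" using F1(2)[OF z] bnz[OF _ z] T by auto
      then show ?thesis unfolding b_def .
    qed
  qed (use r in auto)
  have "cmod (W a) \<le> B"
  proof (rule maximum_modulus_frontier[of W "cball a r" B a])
    fix z assume "z \<in> frontier (cball a r)"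
    then have z: "cmod (z - a) = r" by (simp add: dist_norm norm_minus_commute)
    have zc: "z \<in> cball a r" using z by (simp add: dist_norm norm_minus_commute)
    show "cmod (W z) \<le> B"
    proof (cases "Im z = 0")
      case True
      then have "(z - a)\<^sup>2 - of_real (r\<^sup>2) = 0" using real_center_circle[OF a z] by simp
      then show ?thesis unfolding W_def using B by simp
    next
      case False
      have pS: "(\<Prod>s\<in>S. cmod (b s z)) = (\<Prod>s\<in>S. cmod (z - s))" using bn[OF z] by simp
      have pT: "(\<Prod>t\<in>T. cmod (b t z) ^ m t) = (\<Prod>t\<in>T. cmod (z - t) ^ m t)" using bn[OF z] by simp
      have Gz: "cmod (G z) = (\<Prod>s\<in>S. cmod (z - s)) * cmod (G1 z)" unfolding G1(2)[of z] norm_mult prod_norm[symmetric] ..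
      have Fz: "cmod (F z) = (\<Prod>t\<in>T. cmod (z - t) ^ m t) * cmod (F1 z)" unfolding F1(3)[of z] norm_mult prod_norm[symmetric] norm_power ..
      have nz: "cmod (F1 z * (\<Prod>t\<in>T. b t z ^ m t)) > 0" using F1(2)[OF zc] bnz[OF _ zc] T by auto
      have den: "cmod (F1 z * (\<Prod>t\<in>T. b t z ^ m t)) = cmod (F z)" unfolding Fz norm_mult prod_norm[symmetric] norm_power pT by simp
      have "cmod (W z) = (2 * r * \<bar>Im z\<bar>)\<^sup>2 * cmod (G z) / cmod (F z)"
        unfolding W_def norm_divide den unfolding norm_mult norm_power real_center_circle[OF a z] prod_norm[symmetric] pS Gz by simp
      also have "\<dots> \<le> B" using bound[OF z False] nz unfolding den by (simp add: divide_le_eq)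
      finally show ?thesis .
    qed
  next
    show "W holomorphic_on interior (cball a r)" using holW by (rule holomorphic_on_subset) auto
    show "continuous_on (closure (cball a r)) W" using holW by (simp add: holomorphic_on_imp_continuous_on)
  qed (use r in auto)
  moreover have "cmod (W a) = r ^ 4 * cmod (G1 a) * r ^ card S / (cmod (F1 a) * (\<Prod>t\<in>T. r ^ m t))"
    unfolding W_def ba norm_divide norm_mult prod_norm[symmetric] norm_power using r
    by (simp add: norm_power power_mult[symmetric])
  ultimately have W: "r ^ 4 * cmod (G1 a) * r ^ card S / (cmod (F1 a) * (\<Prod>t\<in>T. r ^ m t)) \<le> B" by simp
  have Ga: "cmod (G a) = (\<Prod>s\<in>S. cmod (s - a)) * cmod (G1 a)" unfolding G1(2)[of a] norm_mult prod_norm[symmetric] by (simp add: norm_minus_commute)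
  have Fa: "cmod (F a) = (\<Prod>t\<in>T. cmod (t - a) ^ m t) * cmod (F1 a)" unfolding F1(3)[of a] norm_mult prod_norm[symmetric] norm_power by (simp add: norm_minus_commute)
  have F1a: "cmod (F1 a) > 0" using F1(2)[of a] r by simp
  have PT: "(\<Prod>t\<in>T. r ^ m t) > 0" using r by (intro prod_pos) auto
  have PTa: "(\<Prod>t\<in>T. cmod (t - a) ^ m t) \<noteq> 0" using Fa F(2) by auto
  have PSa: "(\<Prod>s\<in>S. cmod (s - a)) \<noteq> 0" using Ga G(2) by auto
  have L: "cmod (G a) * (\<Prod>s\<in>S. r / cmod (s - a)) = cmod (G1 a) * r ^ card S"
    unfolding Ga using PSa by (simp add: prod_dividef)
  have R: "cmod (F a) * (\<Prod>t\<in>T. (r / cmod (t - a)) ^ m t) = cmod (F1 a) * (\<Prod>t\<in>T. r ^ m t)"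
    unfolding Fa using PTa by (simp add: power_divide prod_dividef)
  have "r ^ 4 * (cmod (G1 a) * r ^ card S) \<le> B * (cmod (F1 a) * (\<Prod>t\<in>T. r ^ m t))"
    using W F1a PT by (simp add: pos_divide_le_eq mult_ac)
  then show ?thesis unfolding L[symmetric] R[symmetric] by (simp add: mult.assoc)
qed

text \<open>The element of largest modulus has modulus at least \<open>card T / e\<close>, by the
  counting hypothesis for the whole set. Removing such elements one by one produces the factorial,
  so that a small counting density becomes a slow exponential through
  \<open>power_over_fact_le_exp\<close>.\<close>

lemma prod_inverse_sparse:
  fixes T :: "real set"
  assumes T: "finite T" and pos: "\<And>t. t \<in> T \<Longrightarrow> t \<noteq> 0"
    and sp: "\<And>U R. U \<subseteq> T \<Longrightarrow> R > 0 \<Longrightarrow> (\<And>t. t \<in> U \<Longrightarrow> \<bar>t\<bar> \<le> R) \<Longrightarrow> real (card U) \<le> e * R" and e: "e > 0"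
  shows "(\<Prod>t\<in>T. 1 / \<bar>t\<bar>) \<le> e ^ card T / fact (card T)"
  using T pos sp
proof (induction T rule: finite_ranking_induct[where f = "\<lambda>t. \<bar>t\<bar>"])
  case empty
  then show ?case by simp
next
  case (insert x S)
  show ?case
  proof (cases "x \<in> S")
    case True
    then show ?thesis using insert.IH insert.prems by (simp add: insert_absorb)
  next
    case False
    have x: "\<bar>x\<bar> > 0" using insert.prems(1)[of x] by simp
    have "real (card (insert x S)) \<le> e * \<bar>x\<bar>"
      by (rule insert.prems(2)[OF order_refl x]) (use insert.hyps in auto)
    then have n: "real (Suc (card S)) \<le> e * \<bar>x\<bar>" using False insert.hyps by simp
    have IH: "(\<Prod>t\<in>S. 1 / \<bar>t\<bar>) \<le> e ^ card S / fact (card S)"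
    proof (rule insert.IH)
      show "t \<noteq> 0" if "t \<in> S" for t using insert.prems(1)[of t] that by simp
      show "real (card U) \<le> e * R" if "U \<subseteq> S" "R > 0" "\<And>t. t \<in> U \<Longrightarrow> \<bar>t\<bar> \<le> R" for U R
        by (rule insert.prems(2)) (use that in auto)
    qed
    have "1 / \<bar>x\<bar> \<le> e / real (Suc (card S))" using n x by (simp add: field_simps)
    then have "(1 / \<bar>x\<bar>) * (\<Prod>t\<in>S. 1 / \<bar>t\<bar>) \<le> (e / real (Suc (card S))) * (e ^ card S / fact (card S))"
      using IH e by (intro mult_mono prod_nonneg) auto
    also have "\<dots> = e ^ Suc (card S) / fact (Suc (card S))" by simp
    finally show ?thesis using False insert.hyps by simp
  qed
qed

lemma power_over_fact_le_exp: "(y::real) \<ge> 0 \<Longrightarrow> y ^ n / fact n \<le> exp y"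
  using sum_le_suminf[OF summable_exp_generic[of y], of "{n}"] by (simp add: exp_def divide_inverse_commute scaleR_conv_of_real mult.commute)

section \<open>Centres and radii avoiding the zeros\<close>

context mixed_complement
begin

definition good_radius :: "real \<Rightarrow> real \<Rightarrow> bool" where
  "good_radius a r \<longleftrightarrow> (\<forall>z. cmod (z - of_real a) = r \<longrightarrow> f z \<noteq> 0 \<and> G z \<noteq> 0)"

lemma f_nonzero: obtains z where "f z \<noteq> 0"
  using f_pos unfolding pw_norm_def by fastforce

lemma finite_zeros_f: "compact K \<Longrightarrow> finite {z\<in>K. f z = 0}"
  using f_nonzero entire_finite_zeros[OF PW_entire[OF f_PW]] by metis

lemma finite_zeros_G: "compact K \<Longrightarrow> finite {z\<in>K. G z = 0}"
  using G_l0 entire_finite_zeros[OF PW_entire[OF G_PW]] by (metis one_neq_zero)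

text \<open>The centre must be real for the quadratic in Jensen's inequality to vanish on the real
  axis, and it must avoid the zeros of both functions, which may include the origin.\<close>

lemma center: obtains a where "0 \<le> a" "a \<le> 1" "f (of_real a) \<noteq> 0" "G (of_real a) \<noteq> 0"
proof -
  have "finite ({z\<in>cball 0 1. f z = 0} \<union> {z\<in>cball 0 1. G z = 0})"
    by (intro finite_UnI finite_zeros_f finite_zeros_G) auto
  moreover have "infinite (complex_of_real ` {0..1})" by (simp add: finite_image_iff inj_on_def)
  ultimately obtain z where "z \<in> complex_of_real ` {0..1}" "z \<notin> {z\<in>cball 0 1. f z = 0} \<union> {z\<in>cball 0 1. G z = 0}"
    by (meson finite_subset subsetI)
  then show ?thesis using that by auto
qed

lemma good_radius_exists: obtains r where "x \<le> r" "r \<le> x + 1" "good_radius a r"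
proof -
  let ?K = "cball (complex_of_real a) (\<bar>x\<bar> + 1)"
  let ?Z = "{z\<in>?K. f z = 0} \<union> {z\<in>?K. G z = 0}"
  have "finite ((\<lambda>z. cmod (z - of_real a)) ` ?Z)" using finite_zeros_f[of ?K] finite_zeros_G[of ?K] by simp
  moreover have "infinite {x..x+1}" by simp
  ultimately obtain r where r: "r \<in> {x..x+1}" "r \<notin> (\<lambda>z. cmod (z - of_real a)) ` ?Z" by (meson finite_subset subsetI)
  have "good_radius a r" unfolding good_radius_def
  proof (intro allI impI)
    fix z assume z: "cmod (z - of_real a) = r"
    moreover have "r \<le> \<bar>x\<bar> + 1" using r(1) by auto
    ultimately have "z \<in> ?K" by (simp add: dist_norm norm_minus_commute)
    then show "f z \<noteq> 0 \<and> G z \<noteq> 0" using r(2) z by blast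
  qed
  then show ?thesis using that r(1) by auto
qed

end

context mixed_complement_affine
begin

definition zero_orders :: "complex set \<Rightarrow> (complex \<Rightarrow> nat) \<Rightarrow> bool" where
  "zero_orders T m \<longleftrightarrow> (\<forall>t\<in>T. m t \<ge> 1 \<and> (\<exists>h. h holomorphic_on UNIV \<and> h t \<noteq> 0 \<and> (\<forall>z. f z = (z - t) ^ m t * h z)))"

lemma zero_ordersD:
  assumes "zero_orders T m" "t \<in> T"
  shows "m t \<ge> 1" "\<exists>h. h holomorphic_on UNIV \<and> h t \<noteq> 0 \<and> (\<forall>z. f z = (z - t) ^ m t * h z)"
  using assms unfolding zero_orders_def by blast+

lemma factorization_f:
  assumes "f w \<noteq> 0" "compact K"
  obtains m F1 where "F1 holomorphic_on UNIV" "\<And>z. z \<in> K \<Longrightarrow> F1 z \<noteq> 0"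
    "\<And>z. f z = (\<Prod>t\<in>{z\<in>K. f z = 0}. (z - t) ^ m t) * F1 z" "zero_orders {z\<in>K. f z = 0} m"
  by (rule entire_zero_factorization[OF PW_entire[OF f_PW] assms])
     (rule that, assumption+, unfold zero_orders_def, blast)

lemma G_zero_set: "G z = 0 \<longleftrightarrow> z \<in> L1 \<union> L2 - {l0}"
proof
  assume "G z = 0"
  then obtain h where h: "h holomorphic_on UNIV" "\<And>w. G w = (w - z) * h w"
    using entire_divide[OF PW_entire[OF G_PW]] by blast
  show "z \<in> L1 \<union> L2 - {l0}" using G_zeros[OF h] by blast
qed (rule G_zero)

lemma G_factorization:
  assumes K: "compact K"
  obtains G1 where "G1 holomorphic_on UNIV" "\<And>z. G z = (\<Prod>s\<in>{z\<in>K. G z = 0}. (z - s)) * G1 z"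
proof -
  obtain n G1 where G1: "G1 holomorphic_on UNIV" "\<And>z. G z = (\<Prod>t\<in>{z\<in>K. G z = 0}. (z - t) ^ n t) * G1 z"
    "\<And>t. t \<in> {z\<in>K. G z = 0} \<Longrightarrow> n t \<ge> 1 \<and> (\<exists>h. h holomorphic_on UNIV \<and> h t \<noteq> 0 \<and> (\<forall>z. G z = (z - t) ^ n t * h z))"
  proof -
    have "G l0 \<noteq> 0" using G_l0 by simp
    then show ?thesis
      by (rule entire_zero_factorization[OF PW_entire[OF G_PW] _ K]) (rule that; assumption)
  qed
  have n: "n t = 1" if t: "t \<in> {z\<in>K. G z = 0}" for t
  proof -
    obtain h where h: "h holomorphic_on UNIV" "\<And>z. G z = (z - t) ^ n t * h z" and n1: "n t \<ge> 1" using G1(3)[OF t] by blast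
    have "G t = 0" using t by simp
    then obtain h2 where h2: "h2 holomorphic_on UNIV" "\<And>z. G z = (z - t) * h2 z"
      using entire_divide[OF PW_entire[OF G_PW]] by blast
    have "h2 t \<noteq> 0" using G_zeros[OF h2] by blast
    moreover have "(z - t) ^ n t * h z = (z - t) ^ 1 * h2 z" for z using h(2)[of z] h2(2)[of z] by simp
    ultimately have "n t \<le> 1" using factor_exponent_le[OF h(1) h2(1)] by blast
    then show ?thesis using n1 by simp
  qed
  have "(\<Prod>t\<in>{z\<in>K. G z = 0}. (z - t) ^ n t) = (\<Prod>t\<in>{z\<in>K. G z = 0}. (z - t))" for z
    by (intro prod.cong refl) (simp add: n)
  then have "G z = (\<Prod>s\<in>{z\<in>K. G z = 0}. (z - s)) * G1 z" for z using G1(2)[of z] by simp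
  then show ?thesis using that G1(1) by blast
qed

text \<open>The quotient \<open>G / f\<close> equals \<open>A / (P + \<beta>)\<close>. The upper
  bound for \<open>A\<close> and the lower bound for \<open>P + \<beta>\<close> each cost one factor
  \<open>|Im z|\<close>, which accounts for the square on the left.\<close>

lemma sphere_bound:
  obtains B R where "B > 0" "R \<ge> 1" "\<And>r c z. 0 \<le> c \<Longrightarrow> c \<le> 1 \<Longrightarrow> r \<ge> R \<Longrightarrow> cmod (z - of_real c) = r \<Longrightarrow> Im z \<noteq> 0 \<Longrightarrow>
     (2 * r * \<bar>Im z\<bar>)\<^sup>2 * cmod (G z) \<le> (B * r\<^sup>2 * (1 + r)\<^sup>2) * cmod (f z)"
proof -
  obtain \<kappa> R0 where k: "\<kappa> > 0" "R0 > 0"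
    "\<And>w. Im w \<noteq> 0 \<Longrightarrow> cmod w \<ge> R0 \<Longrightarrow> \<kappa> * \<bar>Im w\<bar> / (1 + (cmod w)\<^sup>2) \<le> cmod (a + b * w + \<beta> w)"
    using ratio_lower by blast
  obtain KA where KA: "KA > 0" "\<And>w. Im w \<noteq> 0 \<Longrightarrow> cmod (A w) \<le> KA / \<bar>Im w\<bar>" using A_bound by blast
  define B where "B = 8 * KA / \<kappa>"
  have B: "B > 0" unfolding B_def using KA k by simp
  have "(2 * r * \<bar>Im z\<bar>)\<^sup>2 * cmod (G z) \<le> (B * r\<^sup>2 * (1 + r)\<^sup>2) * cmod (f z)"
    if c: "0 \<le> c" "c \<le> 1" and r: "r \<ge> R0 + 1" and z: "cmod (z - of_real c) = r" and im: "Im z \<noteq> 0" for r c z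
  proof -
    have z1: "cmod z \<ge> R0" using norm_triangle_ineq4[of z "of_real c"] z r c by simp
    have z2: "cmod z \<le> 1 + r" using norm_triangle_ineq[of "z - of_real c" "of_real c"] z c by simp
    define q where "q = 1 + (cmod z)\<^sup>2"
    have q: "q > 0" unfolding q_def by (simp add: add_pos_nonneg)
    have "(cmod z)\<^sup>2 \<le> (1 + r)\<^sup>2" using z2 by (intro power_mono) auto
    moreover have "1 \<le> (1 + r)\<^sup>2" using r k(2) by (intro one_le_power) auto
    ultimately have q2: "q \<le> 2 * (1 + r)\<^sup>2" unfolding q_def by simp
    have "cmod (G z) * (\<kappa> * \<bar>Im z\<bar> / q) \<le> cmod (G z) * cmod (a + b * z + \<beta> z)"
      unfolding q_def using k(3)[OF im z1] by (intro mult_left_mono) auto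
    also have "\<dots> = cmod (f z) * cmod (A z)" using main_identity[OF im] by (metis norm_mult)
    also have "\<dots> \<le> cmod (f z) * (KA / \<bar>Im z\<bar>)" using KA(2)[OF im] by (intro mult_left_mono) auto
    finally have "cmod (G z) * (\<kappa> * \<bar>Im z\<bar> / q) * (\<bar>Im z\<bar> * q / \<kappa>) \<le> cmod (f z) * (KA / \<bar>Im z\<bar>) * (\<bar>Im z\<bar> * q / \<kappa>)"
      using q k(1) by (intro mult_right_mono) auto
    then have g: "\<bar>Im z\<bar>\<^sup>2 * cmod (G z) \<le> cmod (f z) * KA * q / \<kappa>"
      using q k(1) im by (simp add: power2_eq_square mult_ac)
    have "(2 * r * \<bar>Im z\<bar>)\<^sup>2 * cmod (G z) = 4 * r\<^sup>2 * (\<bar>Im z\<bar>\<^sup>2 * cmod (G z))" by (simp add: power_mult_distrib)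
    also have "\<dots> \<le> 4 * r\<^sup>2 * (cmod (f z) * KA * q / \<kappa>)" using g by (intro mult_left_mono) auto
    also have "\<dots> = (4 * r\<^sup>2 * cmod (f z) * KA / \<kappa>) * q" by simp
    also have "\<dots> \<le> (4 * r\<^sup>2 * cmod (f z) * KA / \<kappa>) * (2 * (1 + r)\<^sup>2)" using q2 KA(1) k(1) by (intro mult_left_mono) auto
    also have "\<dots> = (B * r\<^sup>2 * (1 + r)\<^sup>2) * cmod (f z)" unfolding B_def by simp
    finally show ?thesis .
  qed
  moreover have "R0 + 1 \<ge> 1" using k(2) by simp
  ultimately show ?thesis using that B by blast
qed

text \<open>Each simple zero of \<open>G\<close> on \<open>L2\<close> is matched by one order of the
  zero of \<open>f\<close> at the same point, so these terms cancel between the two products and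
  leave \<open>L1 - {l0}\<close> against the excess.\<close>

lemma jensen_bound:
  assumes c: "0 \<le> c" "c \<le> 1" "f (of_real c) \<noteq> 0" "G (of_real c) \<noteq> 0"
  obtains K R where "K > 0" "R \<ge> 1"
    "\<And>r. r \<ge> R \<Longrightarrow> good_radius c r \<Longrightarrow> \<exists>m. zero_orders {z\<in>cball (of_real c) r. f z = 0} m \<and>
       (\<Prod>s\<in>cball (of_real c) r \<inter> (L1 - {l0}). r / cmod (s - of_real c))
         \<le> K * (1 + r)\<^sup>2 * (\<Prod>t\<in>{z\<in>cball (of_real c) r. f z = 0}. (r / cmod (t - of_real c)) ^ excess t (m t))"
proof -
  let ?c = "complex_of_real c"
  obtain B R where B: "B > 0" "R \<ge> 1" "\<And>r c z. 0 \<le> c \<Longrightarrow> c \<le> 1 \<Longrightarrow> r \<ge> R \<Longrightarrow> cmod (z - of_real c) = r \<Longrightarrow> Im z \<noteq> 0 \<Longrightarrow>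
     (2 * r * \<bar>Im z\<bar>)\<^sup>2 * cmod (G z) \<le> (B * r\<^sup>2 * (1 + r)\<^sup>2) * cmod (f z)"
    using sphere_bound by blast
  define K where "K = B * cmod (f ?c) / cmod (G ?c)"
  have K: "K > 0" unfolding K_def using B(1) c by simp
  have "\<exists>m. zero_orders {z\<in>cball ?c r. f z = 0} m \<and>
       (\<Prod>s\<in>cball ?c r \<inter> (L1 - {l0}). r / cmod (s - ?c))
         \<le> K * (1 + r)\<^sup>2 * (\<Prod>t\<in>{z\<in>cball ?c r. f z = 0}. (r / cmod (t - ?c)) ^ excess t (m t))"
    if r: "r \<ge> R" and good: "good_radius c r" for r
  proof -
    define T where "T = {z\<in>cball ?c r. f z = 0}"
    define S where "S = {z\<in>cball ?c r. G z = 0}"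
    define S1 where "S1 = cball ?c r \<inter> (L1 - {l0})"
    define S2 where "S2 = {t\<in>T. t \<in> L2}"
    have r0: "r > 0" "r \<ge> 1" using r B(2) by auto
    have finT: "finite T" and finS: "finite S" unfolding T_def S_def by (intro finite_zeros_f finite_zeros_G compact_cball)+
    have SS: "S = S1 \<union> S2" "S1 \<inter> S2 = {}"
      unfolding S_def S1_def S2_def T_def using G_zero_set f_L2 disj l0 by auto
    have finSS: "finite S1" "finite S2" using finS SS(1) by auto
    have ball: "z \<in> ball ?c r" if "z \<in> cball ?c r" "f z = 0 \<or> G z = 0" for z
    proof -
      have "cmod (z - ?c) \<noteq> r" using good that(2) unfolding good_radius_def by auto
      then show ?thesis using that(1) by (simp add: dist_norm norm_minus_commute)
    qed
    obtain m F1 where F1: "F1 holomorphic_on UNIV" "\<And>z. z \<in> cball ?c r \<Longrightarrow> F1 z \<noteq> 0"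
      "\<And>z. f z = (\<Prod>t\<in>T. (z - t) ^ m t) * F1 z" and mT: "zero_orders T m"
      by (rule factorization_f[OF c(3) compact_cball[of ?c r], folded T_def]) (rule that; assumption)
    obtain G1 where G1: "G1 holomorphic_on UNIV" "\<And>z. G z = (\<Prod>s\<in>S. (z - s)) * G1 z"
      using G_factorization[OF compact_cball[of ?c r]] unfolding S_def by blast
    define x where "x = (\<lambda>t. r / cmod (t - ?c))"
    have J: "r ^ 4 * cmod (G ?c) * (\<Prod>s\<in>S. x s) \<le> (B * r\<^sup>2 * (1 + r)\<^sup>2) * cmod (f ?c) * (\<Prod>t\<in>T. x t ^ m t)"
      unfolding x_def
    proof (rule jensen_quotient[OF PW_entire[OF f_PW] c(3) PW_entire[OF G_PW] c(4) _ r0(1) F1 finT _ G1 finS])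
      show "T \<subseteq> ball ?c r" "S \<subseteq> ball ?c r" using ball unfolding T_def S_def by auto
      show "(2 * r * \<bar>Im z\<bar>)\<^sup>2 * cmod (G z) \<le> (B * r\<^sup>2 * (1 + r)\<^sup>2) * cmod (f z)" if "cmod (z - ?c) = r" "Im z \<noteq> 0" for z
        by (rule B(3)[OF c(1,2) r that])
    qed (use B(1) in auto)
    have xpos: "x t > 0" if "t \<in> T \<union> S" for t
    proof -
      have "t \<noteq> ?c" using that c(3,4) unfolding T_def S_def by auto
      then show ?thesis unfolding x_def using r0 by simp
    qed
    have "(\<Prod>t\<in>T. x t ^ m t) = (\<Prod>t\<in>T. x t ^ excess t (m t) * (if t \<in> L2 then x t else 1))"
    proof (intro prod.cong refl)
      fix t assume "t \<in> T"
      then have "m t \<ge> 1" using zero_ordersD(1)[OF mT] by blast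
      then show "x t ^ m t = x t ^ excess t (m t) * (if t \<in> L2 then x t else 1)"
        unfolding excess_def by (cases "m t") auto
    qed
    also have "\<dots> = (\<Prod>t\<in>T. x t ^ excess t (m t)) * (\<Prod>t\<in>T. if t \<in> L2 then x t else 1)" by (rule prod.distrib)
    also have "(\<Prod>t\<in>T. if t \<in> L2 then x t else 1) = (\<Prod>t\<in>S2. x t)" unfolding S2_def using finT by (rule prod.inter_filter[symmetric])
    finally have P: "(\<Prod>t\<in>T. x t ^ m t) = (\<Prod>t\<in>T. x t ^ excess t (m t)) * (\<Prod>t\<in>S2. x t)" .
    have PS: "(\<Prod>s\<in>S. x s) = (\<Prod>s\<in>S1. x s) * (\<Prod>s\<in>S2. x s)" unfolding SS(1) by (rule prod.union_disjoint[OF finSS SS(2)])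
    have P2: "(\<Prod>s\<in>S2. x s) > 0" by (intro prod_pos) (use xpos SS(1) in auto)
    have "(r ^ 4 * cmod (G ?c) * (\<Prod>s\<in>S1. x s)) * (\<Prod>s\<in>S2. x s)
        \<le> ((B * r\<^sup>2 * (1 + r)\<^sup>2) * cmod (f ?c) * (\<Prod>t\<in>T. x t ^ excess t (m t))) * (\<Prod>s\<in>S2. x s)"
      using J unfolding P PS by (simp add: mult_ac)
    then have "r ^ 4 * cmod (G ?c) * (\<Prod>s\<in>S1. x s) \<le> (B * r\<^sup>2 * (1 + r)\<^sup>2) * cmod (f ?c) * (\<Prod>t\<in>T. x t ^ excess t (m t))"
      using P2 by (rule mult_right_le_imp_le)
    \<comment> \<open>Enlarging \<open>r^2\<close> to \<open>r ^ 4\<close> matches the power on the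
      left, which then cancels.\<close>
    also have "\<dots> \<le> (B * r ^ 4 * (1 + r)\<^sup>2) * cmod (f ?c) * (\<Prod>t\<in>T. x t ^ excess t (m t))"
    proof (intro mult_right_mono mult_left_mono)
      show "r\<^sup>2 \<le> r ^ 4" using r0 by (intro power_increasing) auto
      show "0 \<le> (\<Prod>t\<in>T. x t ^ excess t (m t))" by (intro prod_nonneg zero_le_power less_imp_le xpos) auto
    qed (use B(1) in auto)
    finally have "r ^ 4 * (cmod (G ?c) * (\<Prod>s\<in>S1. x s)) \<le> r ^ 4 * (B * (1 + r)\<^sup>2 * cmod (f ?c) * (\<Prod>t\<in>T. x t ^ excess t (m t)))"
      by (simp add: mult_ac)
    then have "cmod (G ?c) * (\<Prod>s\<in>S1. x s) \<le> B * (1 + r)\<^sup>2 * cmod (f ?c) * (\<Prod>t\<in>T. x t ^ excess t (m t))"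
      by (rule mult_left_le_imp_le) (use r0 in simp)
    then have "(\<Prod>s\<in>S1. x s) \<le> K * (1 + r)\<^sup>2 * (\<Prod>t\<in>T. x t ^ excess t (m t))"
      unfolding K_def using c(4) by (simp add: field_simps)
    then show ?thesis using mT unfolding T_def S1_def x_def by blast
  qed
  then show ?thesis using that[of K R] K B(2) by blast
qed

text \<open>For nonzero \<open>P\<close> the zeros with positive excess lie in a fixed disc and
  yield a power of \<open>1 + r\<close>. For \<open>P = 0\<close> those outside a fixed disc are
  simple in excess, real and sparse, and contribute at most \<open>exp (e * r)\<close>.\<close>

lemma excess_product_bound:
  assumes c: "0 \<le> c" "c \<le> 1" "f (of_real c) \<noteq> 0" and e: "e > 0"
  obtains C N where "C > 0" "\<And>r T m. r \<ge> 1 \<Longrightarrow> finite T \<Longrightarrow> (\<And>t. t \<in> T \<Longrightarrow> f t = 0) \<Longrightarrow> zero_orders T m \<Longrightarrow>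
      (\<Prod>t\<in>T. (r / cmod (t - of_real c)) ^ excess t (m t)) \<le> C * (1 + r) ^ N * exp (e * r)"
proof -
  let ?c = "complex_of_real c"
  have near: "\<exists>q\<ge>1. \<forall>t\<in>{z\<in>cball 0 R. f z = 0}. \<forall>r\<ge>1. r / cmod (t - ?c) \<le> q * (1 + r)" for R
  proof -
    let ?T0 = "{z\<in>cball 0 R. f z = 0}"
    have fin: "finite ?T0" by (rule finite_zeros_f) simp
    define q where "q = 1 + (\<Sum>t\<in>?T0. 1 / cmod (t - ?c))"
    have "q \<ge> 1" unfolding q_def by (simp add: sum_nonneg)
    moreover have "r / cmod (t - ?c) \<le> q * (1 + r)" if t: "t \<in> ?T0" and r: "r \<ge> 1" for t r
    proof -
      have "1 / cmod (t - ?c) \<le> (\<Sum>t\<in>?T0. 1 / cmod (t - ?c))" using fin t by (intro member_le_sum) auto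
      then have "1 / cmod (t - ?c) \<le> q" unfolding q_def by simp
      then have "r * (1 / cmod (t - ?c)) \<le> r * q" using r by (intro mult_left_mono) auto
      also have "\<dots> \<le> q * (1 + r)" using \<open>q \<ge> 1\<close> by (simp add: algebra_simps)
      finally show ?thesis by simp
    qed
    ultimately show ?thesis by blast
  qed
  show ?thesis
  proof (cases "a = 0 \<and> b = 0")
    case False
    obtain R where R: "R > 0" "\<And>f2 t m. f2 holomorphic_on UNIV \<Longrightarrow> (\<And>z. f z = (z - t) ^ m * f2 z) \<Longrightarrow> excess t m \<ge> 1 \<Longrightarrow> cmod t < R"
      using zeros_bounded[OF False] by blast
    let ?T0 = "{z\<in>cball 0 R. f z = 0}"
    have fin: "finite ?T0" by (rule finite_zeros_f) simp
    obtain q where q: "q \<ge> 1" "\<And>t r. t \<in> ?T0 \<Longrightarrow> r \<ge> 1 \<Longrightarrow> r / cmod (t - ?c) \<le> q * (1 + r)" using near by blast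
    \<comment> \<open>Reference orders fixed independently of \<open>r\<close>; the orders
      \<open>m\<close> supplied for each radius are bounded by them, since both describe the same
      zeros of \<open>f\<close>.\<close>
    obtain m0 where m0: "zero_orders ?T0 m0"
      by (rule factorization_f[OF c(3) compact_cball[of 0 R]]) (rule that)
    define N where "N = (\<Sum>t\<in>?T0. m0 t)"
    have main: "(\<Prod>t\<in>T. (r / cmod (t - ?c)) ^ excess t (m t)) \<le> q ^ N * (1 + r) ^ N * exp (e * r)"
      if r: "r \<ge> 1" and T: "finite T" "\<And>t. t \<in> T \<Longrightarrow> f t = 0" and m: "zero_orders T m" for r T m
    proof -
      define y where "y = q * (1 + r)"
      have y: "y \<ge> 1" unfolding y_def using q(1) r by (metis add_increasing2 less_eq_real_def mult_ge1_I order_trans zero_le_one)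
      define j where "j = (\<lambda>t. if t \<in> ?T0 then m0 t else 0)"
      have "(\<Prod>t\<in>T. (r / cmod (t - ?c)) ^ excess t (m t)) \<le> (\<Prod>t\<in>T. y ^ j t)"
      proof (rule prod_mono, intro conjI)
        fix t assume t: "t \<in> T"
        show "0 \<le> (r / cmod (t - ?c)) ^ excess t (m t)" using r by simp
        obtain h where h: "h holomorphic_on UNIV" "\<And>z. f z = (z - t) ^ m t * h z" using zero_ordersD(2)[OF m t] by blast
        show "(r / cmod (t - ?c)) ^ excess t (m t) \<le> y ^ j t"
        proof (cases "excess t (m t) \<ge> 1")
          case True
          have t0: "t \<in> ?T0" using R(2)[OF h True] T(2)[OF t] by simp
          obtain h0 where h0: "h0 holomorphic_on UNIV" "h0 t \<noteq> 0" "\<And>z. f z = (z - t) ^ m0 t * h0 z" using zero_ordersD(2)[OF m0 t0] by blast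
          have "m t \<le> m0 t" by (rule factor_exponent_le[OF h(1) h0(1,2)]) (metis h(2) h0(3))
          then have "excess t (m t) \<le> j t" using t0 unfolding excess_def j_def by auto
          moreover have "(r / cmod (t - ?c)) ^ excess t (m t) \<le> y ^ excess t (m t)"
            unfolding y_def using q(2)[OF t0 r] r by (intro power_mono) auto
          ultimately show ?thesis using power_increasing[OF _ y] order_trans by blast
        next
          case False
          then have "excess t (m t) = 0" by simp
          then show ?thesis using one_le_power[OF y] by simp
        qed
      qed
      also have "\<dots> = y ^ (\<Sum>t\<in>T. j t)" by (rule power_sum[symmetric])
      also have "\<dots> \<le> y ^ N"
      proof (rule power_increasing[OF _ y])
        have "(\<Sum>t\<in>T. j t) = (\<Sum>t\<in>T \<inter> ?T0. m0 t)" unfolding j_def using T(1) by (simp add: sum.inter_restrict)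
        also have "\<dots> \<le> N" unfolding N_def using fin by (intro sum_mono2) auto
        finally show "(\<Sum>t\<in>T. j t) \<le> N" .
      qed
      also have "\<dots> = q ^ N * (1 + r) ^ N" unfolding y_def by (rule power_mult_distrib)
      also have "\<dots> \<le> q ^ N * (1 + r) ^ N * exp (e * r)"
      proof -
        have "1 \<le> exp (e * r)" using e r by simp
        moreover have "q ^ N * (1 + r) ^ N \<ge> 0" using q(1) r by simp
        ultimately show ?thesis by (metis mult.right_neutral mult_left_mono)
      qed
      finally show ?thesis .
    qed
    have "q ^ N > 0" using q(1) by simp
    from that[OF this main] show ?thesis .
  next
    case True
    have e2: "e / 2 > 0" using e by simp
    obtain L0 where L0: "L0 \<ge> 1" "\<And>T R. finite T \<Longrightarrow> T \<subseteq> Zs \<Longrightarrow> R > 0 \<Longrightarrow> (\<And>t. t \<in> T \<Longrightarrow> L0 \<le> \<bar>t\<bar> \<and> \<bar>t\<bar> \<le> R) \<Longrightarrow> real (card T) \<le> e / 2 * R"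
      using Zs_sparse[OF e2] by blast
    \<comment> \<open>From modulus 2 on, moving the origin to \<open>c\<close> in
      \<open>[0, 1]\<close> at most halves a distance. The factor 2 so lost is offset by taking the
      sparseness constant \<open>e / 2\<close>.\<close>
    define L where "L = L0 + 1"
    have L: "L \<ge> 2" "L \<ge> L0" unfolding L_def using L0(1) by auto
    let ?T0 = "{z\<in>cball 0 L. f z = 0}"
    have fin: "finite ?T0" by (rule finite_zeros_f) simp
    obtain q where q: "q \<ge> 1" "\<And>t r. t \<in> ?T0 \<Longrightarrow> r \<ge> 1 \<Longrightarrow> r / cmod (t - ?c) \<le> q * (1 + r)" using near by blast
    define N where "N = card ?T0"
    have main: "(\<Prod>t\<in>T. (r / cmod (t - ?c)) ^ excess t (m t)) \<le> q ^ N * (1 + r) ^ N * exp (e * r)"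
      if r: "r \<ge> 1" and T: "finite T" "\<And>t. t \<in> T \<Longrightarrow> f t = 0" and m: "zero_orders T m" for r T m
    proof -
      define y where "y = q * (1 + r)"
      have y: "y \<ge> 1" unfolding y_def using q(1) r by (metis add_increasing2 less_eq_real_def mult_ge1_I order_trans zero_le_one)
      define T' where "T' = {t\<in>T. excess t (m t) \<ge> 1}"
      define X Y where "X = {t\<in>T'. cmod t \<le> L}" and "Y = {t\<in>T'. \<not> cmod t \<le> L}"
      have XY: "T' = X \<union> Y" "X \<inter> Y = {}" "finite X" "finite Y" "X \<subseteq> ?T0"
        unfolding X_def Y_def T'_def using T by auto
      have real: "Im t = 0" "excess t (m t) = 1" "Re t \<in> Zs" if t: "t \<in> T'" for t
      proof -
        have tT: "t \<in> T" "excess t (m t) \<ge> 1" using t unfolding T'_def by auto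
        obtain h where h: "h holomorphic_on UNIV" "\<And>z. f z = (z - t) ^ m t * h z" using zero_ordersD(2)[OF m tT(1)] by blast
        have ab: "a = 0" "b = 0" using True by auto
        note zr = zeros_real[OF ab h tT(2)]
        show "Im t = 0" "excess t (m t) = 1" by (fact zr)+
        have "complex_of_real (Re t) = t" using zr(1) by (simp add: complex_eq_iff)
        then show "Re t \<in> Zs" using zr(3) unfolding Zs_def by simp
      qed
      define x where "x = (\<lambda>t. r / cmod (t - ?c))"
      have x0: "x t \<ge> 0" for t unfolding x_def using r by simp
      have "(\<Prod>t\<in>T. x t ^ excess t (m t)) = (\<Prod>t\<in>T'. x t ^ excess t (m t))"
        unfolding T'_def using T(1) by (intro prod.mono_neutral_right) (auto simp: not_le)
      also have "\<dots> = (\<Prod>t\<in>T'. x t)" using real(2) by (intro prod.cong) auto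
      also have "\<dots> = (\<Prod>t\<in>X. x t) * (\<Prod>t\<in>Y. x t)" unfolding XY(1) by (rule prod.union_disjoint[OF XY(3,4,2)])
      also have "\<dots> \<le> y ^ N * exp (e * r)"
      proof (rule mult_mono)
        have "(\<Prod>t\<in>X. x t) \<le> (\<Prod>t\<in>X. y)"
          unfolding x_def y_def using q(2) XY(5) r by (intro prod_mono) auto
        also have "\<dots> = y ^ card X" by simp
        also have "\<dots> \<le> y ^ N" unfolding N_def using fin XY(5) by (intro power_increasing[OF _ y] card_mono)
        finally show "(\<Prod>t\<in>X. x t) \<le> y ^ N" .
        define U where "U = Re ` Y"
        have inj: "inj_on Re Y" using real(1) XY(1) by (auto simp: inj_on_def complex_eq_iff)
        have finU: "finite U" unfolding U_def using XY(4) by simp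
        have Ub: "\<bar>v\<bar> > L" "v \<in> Zs" if v: "v \<in> U" for v
        proof -
          obtain t where t: "t \<in> Y" "v = Re t" using v unfolding U_def by auto
          then have tT: "t \<in> T'" "cmod t > L" unfolding Y_def by auto
          then have "cmod t = \<bar>v\<bar>" using real(1)[OF tT(1)] t(2) by (simp add: cmod_def)
          then show "\<bar>v\<bar> > L" "v \<in> Zs" using tT real(3)[OF tT(1)] t(2) by auto
        qed
        have "(\<Prod>t\<in>Y. x t) \<le> (\<Prod>t\<in>Y. 2 * r * (1 / \<bar>Re t\<bar>))"
        proof (rule prod_mono, intro conjI x0)
          fix t assume t: "t \<in> Y"
          then have tT: "t \<in> T'" "cmod t > L" unfolding Y_def by auto
          then have n: "cmod t = \<bar>Re t\<bar>" using real(1)[OF tT(1)] by (simp add: cmod_def)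
          have "cmod (t - ?c) \<ge> cmod t / 2" using norm_triangle_ineq2[of t ?c] c tT(2) L(1) by simp
          then have "r / cmod (t - ?c) \<le> r / (cmod t / 2)" using r tT(2) L(1) by (intro frac_le) auto
          then show "x t \<le> 2 * r * (1 / \<bar>Re t\<bar>)" unfolding x_def n by (simp add: mult.commute)
        qed
        also have "\<dots> = (\<Prod>v\<in>U. 2 * r * (1 / \<bar>v\<bar>))" unfolding U_def by (simp add: prod.reindex[OF inj])
        also have "\<dots> = (2 * r) ^ card U * (\<Prod>v\<in>U. 1 / \<bar>v\<bar>)" by (simp add: prod.distrib[symmetric] flip: prod_constant)
        also have "\<dots> \<le> (2 * r) ^ card U * ((e / 2) ^ card U / fact (card U))"
        proof (intro mult_left_mono prod_inverse_sparse[OF finU _ _ e2])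
          show "v \<noteq> 0" if "v \<in> U" for v using Ub(1)[OF that] L(1) by auto
          show "real (card V) \<le> e / 2 * R" if V: "V \<subseteq> U" "R > 0" "\<And>t. t \<in> V \<Longrightarrow> \<bar>t\<bar> \<le> R" for V R
          proof (rule L0(2))
            show "finite V" using V(1) finU by (rule finite_subset)
            show "V \<subseteq> Zs" using V(1) Ub(2) by blast
            show "L0 \<le> \<bar>t\<bar> \<and> \<bar>t\<bar> \<le> R" if "t \<in> V" for t using Ub(1)[of t] V(1) V(3)[OF that] that L(2) by auto
          qed (rule V(2))
        qed (use r in auto)
        also have "\<dots> = (e * r) ^ card U / fact (card U)" by (simp add: power_mult_distrib power_divide)
        also have "\<dots> \<le> exp (e * r)" using e r by (intro power_over_fact_le_exp) auto
        finally show "(\<Prod>t\<in>Y. x t) \<le> exp (e * r)" .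
      qed (use y x0 in \<open>auto intro: prod_nonneg\<close>)
      also have "\<dots> = q ^ N * (1 + r) ^ N * exp (e * r)" unfolding y_def by (simp add: power_mult_distrib)
      finally show ?thesis unfolding x_def .
    qed
    have "q ^ N > 0" using q(1) by simp
    from that[OF this main] show ?thesis .
  qed
qed

text \<open>With \<open>r\<close> about \<open>exp 1\<close> times the counting radius, every
  counted node contributes a factor of at least \<open>exp 1\<close> to the product in Jensen's
  inequality, and the other nodes at least 1. The count is therefore bounded by the logarithm of the
  right side, a linear term of slope proportional to \<open>\<delta>\<close> plus a logarithm of a
  power.\<close>

lemma L1_growth:
  assumes \<delta>: "\<delta> > 0"
  obtains C N R where "C > 0" "R \<ge> 1"
    "\<And>x. x \<ge> 0 \<Longrightarrow> real (card {l\<in>L1. cmod l \<le> x}) \<le> 1 + ln (C * (3 * (x + R) + 10) ^ N) + \<delta> * (3 * (x + R) + 10)"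
proof -
  obtain c where c: "0 \<le> c" "c \<le> 1" "f (of_real c) \<noteq> 0" "G (of_real c) \<noteq> 0" using center by blast
  let ?c = "complex_of_real c"
  obtain K R where K: "K > 0" "R \<ge> 1"
    "\<And>r. r \<ge> R \<Longrightarrow> good_radius c r \<Longrightarrow> \<exists>m. zero_orders {z\<in>cball ?c r. f z = 0} m \<and>
       (\<Prod>s\<in>cball ?c r \<inter> (L1 - {l0}). r / cmod (s - ?c))
         \<le> K * (1 + r)\<^sup>2 * (\<Prod>t\<in>{z\<in>cball ?c r. f z = 0}. (r / cmod (t - ?c)) ^ excess t (m t))"
    using jensen_bound[OF c] by blast
  obtain C N where C: "C > 0" "\<And>r T m. r \<ge> 1 \<Longrightarrow> finite T \<Longrightarrow> (\<And>t. t \<in> T \<Longrightarrow> f t = 0) \<Longrightarrow> zero_orders T m \<Longrightarrow>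
      (\<Prod>t\<in>T. (r / cmod (t - ?c)) ^ excess t (m t)) \<le> C * (1 + r) ^ N * exp (\<delta> * r)"
    using excess_product_bound[OF c(1-3) \<delta>] by blast
  have "real (card {l\<in>L1. cmod l \<le> x}) \<le> 1 + ln (K * C * (3 * (x + R) + 10) ^ (N + 2)) + \<delta> * (3 * (x + R) + 10)" if x: "x \<ge> 0" for x
  proof -
    define X where "X = x + R"
    have X: "X \<ge> R" "X \<ge> x" "X \<ge> 1" unfolding X_def using x K(2) by auto
    \<comment> \<open>A counted node has distance at most \<open>X + 1\<close> from the centre, so
      this radius leaves the ratio \<open>exp 1\<close>.\<close>
    obtain r where r: "exp 1 * (X + 1) \<le> r" "r \<le> exp 1 * (X + 1) + 1" "good_radius c r" using good_radius_exists by blast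
    have e1: "exp 1 \<le> (3::real)" by (rule exp_le)
    have e2: "(1::real) \<le> exp 1" by simp
    have r3: "r \<le> 3 * X + 4" using r(2) mult_right_mono[OF e1, of "X + 1"] X by simp
    have "1 * (X + 1) \<le> exp 1 * (X + 1)" using X by (intro mult_right_mono[OF e2]) auto
    also note r(1)
    finally have rX: "r \<ge> X + 1" by simp
    have rR: "r \<ge> R" "r \<ge> 1" "r > 0" using rX X by auto
    define S1 where "S1 = cball ?c r \<inter> (L1 - {l0})"
    have "S1 \<subseteq> {z\<in>cball ?c r. G z = 0}" unfolding S1_def using G_zero by auto
    then have fS1: "finite S1" using finite_zeros_G[of "cball ?c r"] finite_subset by auto
    obtain m where m: "zero_orders {z\<in>cball ?c r. f z = 0} m"
       "(\<Prod>s\<in>S1. r / cmod (s - ?c)) \<le> K * (1 + r)\<^sup>2 * (\<Prod>t\<in>{z\<in>cball ?c r. f z = 0}. (r / cmod (t - ?c)) ^ excess t (m t))"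
      using K(3)[OF rR(1) r(3)] unfolding S1_def by blast
    have "(\<Prod>t\<in>{z\<in>cball ?c r. f z = 0}. (r / cmod (t - ?c)) ^ excess t (m t)) \<le> C * (1 + r) ^ N * exp (\<delta> * r)"
      by (rule C(2)[OF rR(2) finite_zeros_f _ m(1)]) auto
    then have "K * (1 + r)\<^sup>2 * (\<Prod>t\<in>{z\<in>cball ?c r. f z = 0}. (r / cmod (t - ?c)) ^ excess t (m t)) \<le> K * (1 + r)\<^sup>2 * (C * (1 + r) ^ N * exp (\<delta> * r))"
      using K(1) by (intro mult_left_mono) auto
    from order_trans[OF m(2) this] have up: "(\<Prod>s\<in>S1. r / cmod (s - ?c)) \<le> K * C * (1 + r) ^ (N + 2) * exp (\<delta> * r)"
      by (simp add: power_add power2_eq_square mult_ac)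
    define S0 where "S0 = {l\<in>L1 - {l0}. cmod l \<le> x}"
    have S0d: "cmod (l - ?c) \<le> X + 1" if "l \<in> S0" for l
      using that norm_triangle_ineq4[of l ?c] c X unfolding S0_def by simp
    have S01: "S0 \<subseteq> S1"
    proof
      fix l assume l: "l \<in> S0"
      then have "cmod (l - ?c) \<le> r" using S0d rX by fastforce
      then show "l \<in> S1" using l unfolding S0_def S1_def by (simp add: dist_norm norm_minus_commute)
    qed
    have lc: "l \<noteq> ?c" if "l \<in> S1" for l using that c(4) G_zero unfolding S1_def by auto
    have "exp (real (card S0)) = (\<Prod>s\<in>S0. exp 1)" by (simp add: exp_of_nat_mult[symmetric])
    also have "\<dots> \<le> (\<Prod>s\<in>S0. r / cmod (s - ?c))"
    proof (rule prod_mono, intro conjI)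
      fix s assume s: "s \<in> S0"
      have d: "cmod (s - ?c) > 0" using lc S01 s by auto
      have "exp 1 * cmod (s - ?c) \<le> exp 1 * (X + 1)" using S0d[OF s] by (intro mult_left_mono) auto
      then have "exp 1 * cmod (s - ?c) \<le> r" using r(1) by linarith
      then show "exp 1 \<le> r / cmod (s - ?c)" using d by (simp add: pos_le_divide_eq)
    qed auto
    also have "\<dots> \<le> (\<Prod>s\<in>S1. r / cmod (s - ?c))"
    proof (rule prod_mono2[OF fS1 S01])
      fix s assume s: "s \<in> S1 - S0"
      have "cmod (s - ?c) > 0" using lc s by auto
      moreover have "cmod (s - ?c) \<le> r" using s unfolding S1_def by (auto simp: dist_norm norm_minus_commute)
      ultimately show "1 \<le> r / cmod (s - ?c)" by simp
    qed (use rR in auto)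
    also note up
    \<comment> \<open>From \<open>exp 1 <= 3\<close> one has \<open>r <= 3 X + 4\<close>; the 10 is
      a rounded surplus that also covers \<open>1 + r\<close>.\<close>
    also have "K * C * (1 + r) ^ (N + 2) * exp (\<delta> * r) \<le> K * C * (3 * X + 10) ^ (N + 2) * exp (\<delta> * (3 * X + 10))"
      using r3 rR K(1) C(1) \<delta> by (intro mult_mono power_mono) auto
    finally have ex: "exp (real (card S0)) \<le> K * C * (3 * X + 10) ^ (N + 2) * exp (\<delta> * (3 * X + 10))" .
    have pos: "K * C * (3 * X + 10) ^ (N + 2) > 0" using K(1) C(1) X by simp
    have "real (card S0) \<le> ln (K * C * (3 * X + 10) ^ (N + 2) * exp (\<delta> * (3 * X + 10)))"
      using ex by (metis exp_gt_zero ln_exp ln_le_cancel_iff order_less_le_trans)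
    also have "\<dots> = ln (K * C * (3 * X + 10) ^ (N + 2)) + \<delta> * (3 * X + 10)"
      by (subst ln_mult_pos[OF pos]) simp_all
    finally have n0: "real (card S0) \<le> ln (K * C * (3 * X + 10) ^ (N + 2)) + \<delta> * (3 * X + 10)" .
    have fS0: "finite S0" using finite_subset[OF S01 fS1] .
    \<comment> \<open>The node \<open>l0\<close>, where \<open>G\<close> does not vanish, accounts
      for the summand 1.\<close>
    have "{l\<in>L1. cmod l \<le> x} \<subseteq> insert l0 S0" unfolding S0_def by auto
    then have "card {l\<in>L1. cmod l \<le> x} \<le> card (insert l0 S0)" using fS0 by (intro card_mono) auto
    also have "\<dots> \<le> Suc (card S0)" by (rule card_insert_le_m1) auto
    finally show ?thesis using n0 unfolding X_def by simp
  qed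
  then show ?thesis using that[of "K * C" R "N + 2"] K(1,2) C(1) by simp
qed

end

section \<open>Positive upper density against logarithmic growth\<close>

lemma upper_density_posE:
  assumes "upper_density L > 0"
  obtains c where "c > 0" "\<And>R. \<exists>r\<ge>R. 2 * c * r < real (card {l\<in>L. cmod l \<le> r})"
proof -
  obtain c where c: "0 < ereal c" "ereal c < upper_density L" using ereal_dense2[OF assms] by blast
  have "\<exists>r\<ge>R. 2 * c * r < real (card {l\<in>L. cmod l \<le> r})" for R :: real
  proof (rule ccontr)
    assume n: "\<not> ?thesis"
    have "\<forall>\<^sub>F r in at_top. ereal (real (card {l\<in>L. cmod l \<le> r}) / (2 * r)) \<le> ereal c"
      using eventually_ge_at_top[of "max R 1"]
    proof eventually_elim
      case (elim r)
      then have "real (card {l\<in>L. cmod l \<le> r}) \<le> c * (2 * r)" using n by (auto simp: not_less mult_ac)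
      then show ?case using elim by (simp add: pos_divide_le_eq)
    qed
    then have "upper_density L \<le> ereal c" unfolding upper_density_def by (rule Limsup_bounded)
    then show False using c(2) by simp
  qed
  then show ?thesis using that c(1) by simp
qed

lemma log_linear_eventually_less:
  fixes C R c \<delta> :: real
  assumes "C > 0" "\<delta> * 3 < c"
  shows "\<forall>\<^sub>F x in at_top. 1 + ln (C * (3 * (x + R) + 10) ^ N) + \<delta> * (3 * (x + R) + 10) < c * x"
proof -
  define d where "d = c - 3 * \<delta>"
  have d: "d > 0" unfolding d_def using assms by simp
  have "\<forall>\<^sub>F x in at_top. 1 + ln C + real N * ln (3 * (x + R) + 10) + \<delta> * (3 * R + 10) < d * x"
    using d by real_asymp
  moreover have "\<forall>\<^sub>F x in at_top. 3 * (x + R) + 10 > 0" by real_asymp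
  ultimately show ?thesis
  proof eventually_elim
    case (elim x)
    have "ln (C * (3 * (x + R) + 10) ^ N) = ln C + real N * ln (3 * (x + R) + 10)"
      using assms(1) elim(2) by (simp add: ln_mult ln_realpow)
    then show ?case using elim(1) unfolding d_def by (simp add: algebra_simps)
  qed
qed

theorem theorem1p2:
  fixes \<Lambda> \<Lambda>1 \<Lambda>2 :: "complex set"
    and g :: "complex \<Rightarrow> complex \<Rightarrow> complex"
  assumes exact: "exact_PW pw_kernel \<Lambda>"
    and g_PW: "\<forall>l\<in>\<Lambda>. g l \<in> PW"
    and biorth: "\<forall>l\<in>\<Lambda>. \<forall>m\<in>\<Lambda>. pw_inner (g l) (pw_kernel m) = (if l = m then 1 else 0)"
    and part: "\<Lambda> = \<Lambda>1 \<union> \<Lambda>2" "\<Lambda>1 \<inter> \<Lambda>2 = {}"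
    and dens: "upper_density \<Lambda>1 > 0"
  shows "complete_PW (\<lambda>l. if l \<in> \<Lambda>1 then g l else pw_kernel l) \<Lambda>"
proof (rule ccontr)
  let ?F = "\<lambda>l. if l \<in> \<Lambda>1 then g l else pw_kernel l"
  assume incomplete: "\<not> ?thesis"
  have "?F l \<in> PW" if "l \<in> \<Lambda>" for l using g_PW pw_kernel_PW that by simp
  then obtain f where f: "f \<in> PW" "pw_norm f > 0" and orth: "\<And>l. l \<in> \<Lambda> \<Longrightarrow> pw_inner f (?F l) = 0"
    using orthogonal_if_not_complete[OF _ incomplete] by blast
  obtain c where c: "c > 0" "\<And>R. \<exists>r\<ge>R. 2 * c * r < real (card {l\<in>\<Lambda>1. cmod l \<le> r})"
    using upper_density_posE[OF dens] by blast
  \<comment> \<open>A radius of at least \<open>1 / c\<close> with the density inequality already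
    contains more than two points of \<open>\<Lambda>1\<close>.\<close>
  obtain l0 l1 where l: "l0 \<in> \<Lambda>1" "l1 \<in> \<Lambda>1" "l1 \<noteq> l0"
  proof -
    obtain r where r: "r \<ge> 1 / c" "2 * c * r < real (card {l\<in>\<Lambda>1. cmod l \<le> r})" using c(2) by blast
    have "c * r \<ge> 1" using r(1) c(1) by (simp add: pos_divide_le_eq mult.commute)
    then have "2 \<le> card {l\<in>\<Lambda>1. cmod l \<le> r}" using r(2) by linarith
    then obtain S where S: "S \<subseteq> {l\<in>\<Lambda>1. cmod l \<le> r}" "card S = 2" by (meson obtain_subset_with_card_n)
    from S(2) obtain x y where "S = {x, y}" "x \<noteq> y" by (meson card_2_iff)
    then show ?thesis using that[of x y] S(1) by auto
  qed
  interpret mixed_complement \<Lambda>1 \<Lambda>2 g f l0 l1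
  proof
    show "complete_PW pw_kernel (\<Lambda>1 \<union> \<Lambda>2)" using exact unfolding exact_PW_def part(1) by blast
    show "g l \<in> PW" if "l \<in> \<Lambda>1 \<union> \<Lambda>2" for l using g_PW part(1) that by blast
    then show "g l m = (if l = m then 1 else 0)" if "l \<in> \<Lambda>1 \<union> \<Lambda>2" "m \<in> \<Lambda>1 \<union> \<Lambda>2" for l m
      using biorth part(1) that by (metis pw_inner_kernel)
    show "f l = 0" if "l \<in> \<Lambda>2" for l
    proof -
      have "l \<notin> \<Lambda>1" "l \<in> \<Lambda>" using that part by auto
      then show ?thesis using orth[of l] pw_inner_kernel[OF f(1), of l] by simp
    qed
    show "pw_inner f (g l) = 0" if "l \<in> \<Lambda>1" for l using orth[of l] that part(1) by simp
  qed (use part(2) f l in auto)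
  obtain a b where "\<And>z. D z = G z * (a + b * z)" using D_affine by blast
  then interpret mixed_complement_affine \<Lambda>1 \<Lambda>2 g f l0 l1 a b by unfold_locales
  \<comment> \<open>Multiplied by the coefficient 3 of the growth bound this gives slope
    \<open>c\<close>, below the slope \<open>2 * c\<close> that the density guarantees at
    arbitrarily large radii.\<close>
  have c3: "c / 3 > 0" using c(1) by simp
  obtain C N R where C: "C > 0"
    "\<And>x. x \<ge> 0 \<Longrightarrow> real (card {l\<in>\<Lambda>1. cmod l \<le> x}) \<le> 1 + ln (C * (3 * (x + R) + 10) ^ N) + c / 3 * (3 * (x + R) + 10)"
    by (rule L1_growth[OF c3]) (rule that; assumption)
  have "\<forall>\<^sub>F x in at_top. 1 + ln (C * (3 * (x + R) + 10) ^ N) + c / 3 * (3 * (x + R) + 10) < 2 * c * x"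
    by (rule log_linear_eventually_less) (use c(1) C(1) in auto)
  then obtain x0 where x0: "\<And>x. x \<ge> x0 \<Longrightarrow> 1 + ln (C * (3 * (x + R) + 10) ^ N) + c / 3 * (3 * (x + R) + 10) < 2 * c * x"
    unfolding eventually_at_top_linorder by blast
  obtain x where "x \<ge> max x0 0" "2 * c * x < real (card {l\<in>\<Lambda>1. cmod l \<le> x})" using c(2) by blast
  then show False using C(2)[of x] x0[of x] by simp
qed

end
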